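(* Let $\mathcal A$ be a small associative category and $\mathcal D$ a small permutative category. Left $\mathcal A$-module structures on $\mathcal D$ determine and are determined by multifunctors $\ell\mathbf M^{\Sigma_*}\to\mathbf P$ sending $A$ to $\mathcal A$ and $M$ to $\mathcal D$ such that the restriction $\Sigma_*\to\ell\mathbf M^{\Sigma_*}\to\mathbf P$ (to the object $A$) gives the structure map for $\mathcal A$ as an associative category.
   Context: **Multicategories.** A multicategory (symmetric colored operad) has objects, $k$-morphisms $\mathbf M_k(a_1,\dots,a_k;b)$ for $k\ge0$, right symmetric group actions $\sigma^*:\mathbf M_k(a_1,\dots,a_k;b)\to\mathbf M_k(a_{\sigma(1)},\dots,a_{\sigma(k)};b)$, units, and multiproducts $\Gamma$ satisfying the usual operad identities; a multifunctor preserves all this structure. Sets are regarded as discrete categories. **Permutative categories.** A permutative category is a category $\mathcal C$ with a functor $\oplus$, an object $0$ and a natural isomorphism $\gamma:a\oplus b\cong b\oplus a$ such that $\oplus$ is strictly associative, $0$ is a strict unit, $\gamma_{a,0}=\mathrm{id}$, $\gamma_{b,a}\gamma_{a,b}=\mathrm{id}$, $\gamma_{a\oplus b,c}=(\gamma_{a,c}\oplus 1)(1\oplus\gamma_{b,c})$. **The multicategory $\mathbf P$** (enriched over small categories). Objects: small permutative categories. An object of $\mathbf P_k(\mathcal C_1,\dots,\mathcal C_k;\mathcal D)$ (a $k$-linear map) is a functor $f:\mathcal C_1\times\dots\times\mathcal C_k\to\mathcal D$ with $f(c_1,\dots,c_k)=0$ if any of the $c_i$ is $0$, with natural transformations $\delta_i:f(c_i)\oplus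 f(c_i')\to f(c_i\oplus c_i')$ in each variable (fixed variables suppressed), with $\delta_i=\mathrm{id}$ if $c_i$, $c_i'$ or any other $c_j$ is $0$, and $f(\gamma)\delta_i=\delta_i\gamma$; $\delta_i(\delta_i\oplus1)=\delta_i(1\oplus\delta_i)$; for $i\ne j$, $\delta_j(\delta_i\oplus\delta_i)=\delta_i(\delta_j\oplus\delta_j)(1\oplus\gamma\oplus1)$ as maps $f(c_i,c_j)\oplus f(c_i',c_j)\oplus f(c_i,c_j')\oplus f(c_i',c_j')\to f(c_i\oplus c_i',c_j\oplus c_j')$. Morphisms $\phi:f\to g$ are natural transformations with $\phi\,\delta_i^f=\delta_i^g(\phi\oplus\phi)$. $\sigma^*f(c_{\sigma(1)},\dots,c_{\sigma(k)})=f(c_1,\dots,c_k)$; $\Gamma(g;f_1,\dots,f_n)=g\circ(f_1\times\dots\times f_n)$ with distributivity maps $g(\delta_i^{f_j})\circ\delta_j^g$. **Associative category:** a permutative category $\mathcal A$ with a functor $\otimes:\mathcal A\times\mathcal A\to\mathcal A$, strictly associative with strict unit object $1$, and natural distributivity maps $d_l(a,a';b):(a\otimes b)\oplus(a'\otimes b)\to(a\oplus a')\otimes b$ and $d_r(a;b,b'):(a\otimes b)\oplus(a\otimes b')\to a\otimes(b\oplus b')$ such that: (a) $a\otimes0=0\otimes a=0$ for all $a$; (b) $d_l(d_l\oplus1)=d_l(1\oplus d_l)$, and similarly for $d_r$; (c) $(\gamma\otimes1)d_l=d_l\gamma$, $(1\otimes\gamma)d_r=d_r\gamma$; (d) $d_l(a,a';b\otimes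 c)=(d_l(a,a';b)\otimes1_c)d_l(a\otimes b,a'\otimes b;c)$, $d_r(a\otimes b;c,c')=(1_a\otimes d_r(b;c,c'))d_r(a;b\otimes c,b\otimes c')$; (e) $(d_r(a;b,b')\otimes1_c)d_l(a\otimes b,a\otimes b';c)=(1_a\otimes d_l(b,b';c))d_r(a;b\otimes c,b'\otimes c)$; (f) $d_l(a,a';b\oplus b')(d_r(a;b,b')\oplus d_r(a';b,b'))=d_r(a\oplus a';b,b')(d_l(a,a';b)\oplus d_l(a,a';b'))(1\oplus\gamma\oplus1)$. **Left $\mathcal A$-module structure** on a permutative category $\mathcal D$: a functor $\otimes:\mathcal A\times\mathcal D\to\mathcal D$ that is strictly associative (the two composites $\mathcal A\times\mathcal A\times\mathcal D\to\mathcal D$ agree) and strictly unital (the composite $\mathcal D\cong\{1\}\times\mathcal D\to\mathcal A\times\mathcal D\to\mathcal D$ is the identity), together with natural distributivity maps $d_l:(a\otimes d)\oplus(a'\otimes d)\to(a\oplus a')\otimes d$ and $d_r:(a\otimes d)\oplus(a\otimes d')\to a\otimes(d\oplus d')$, subject to the commutativity of all the diagrams in the definition of associative category above (conditions (a)–(f), read with the last tensor factor in $\mathcal D$ and the preceding ones in $\mathcal A$). **Operad $\Sigma_*$:** $k$-th set $\Sigma_k$ with right multiplication action, $\Gamma(\sigma;\phi_1,\dots,\phi_k)=\sigma\langle j_1,\dots,j_k\rangle\circ(\phi_1\amalg\dots\amalg\phi_k)$ for $\phi_i\in\Sigma_{j_i}$, where $\sigma\langle j_1,\dots,j_k\rangle$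 permutes blocks $j_1\amalg\dots\amalg j_k\to j_{\sigma^{-1}(1)}\amalg\dots\amalg j_{\sigma^{-1}(k)}$. The structure map $\Sigma_*\to\mathbf P$ of $\mathcal A$ sends $\sigma$ to $(a_1,\dots,a_k)\mapsto a_{\sigma^{-1}(1)}\otimes\dots\otimes a_{\sigma^{-1}(k)}$ with distributivity maps composed from $d_l$ and $d_r$. **$\ell\mathbf M^{\Sigma_*}$** has two objects $A,M$; $\ell\mathbf M^{\Sigma_*}_k(A^k;A)=\Sigma_k$; $\ell\mathbf M^{\Sigma_*}_k(A^{j-1},M,A^{k-j};M)=\{\sigma\in\Sigma_k:\sigma(j)=k\}$; all other $k$-morphism sets are empty; actions and multiproduct are defined exactly as in $\Sigma_*$. Restricting to the object $A$ gives a multifunctor $\Sigma_*\to\ell\mathbf M^{\Sigma_*}$. The correspondence: the pairing $\otimes:\mathcal A\times\mathcal D\to\mathcal D$ with $\delta_1=d_l$, $\delta_2=d_r$ is the image of the single element of $\ell\mathbf M^{\Sigma_*}_2(A,M;M)$.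
   Formalization: Added to (a)–(f), for A and for modules: d_l, d_r are identities when an argument is 0, d_r(1;d,d')=id, and in A d_l(a,a';1)=id. The zero conditions, also in P, are required on arrows too (f(..,id_0,..)=id_0). Without these the claim fails or P is not closed under Γ. *)

theory Defs
  imports "HOL-Combinatorics.Permutations" "HOL-Library.FuncSet"
begin

text \<open>
  Small categories are given by carrier sets of objects and arrows. Positions in a list of
  inputs are counted from 0, and a permutation in $\Sigma_k$ is a function \<open>\<sigma>\<close> with
  \<open>\<sigma> permutes {..<k}\<close>. Functions that are part of a structure which is counted or compared
  (multilinear maps, their transformations, multifunctors, module structures) are
  \<^const>\<open>undefined\<close> outside their domain, so that equality of records is equality of structures.
\<close>

section \<open>Categories and permutative categories\<close>

record ('o, 'm) cat =
  Ob :: "'o set"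
  Ar :: "'m set"
  Dom :: "'m \<Rightarrow> 'o"
  Cod :: "'m \<Rightarrow> 'o"
  ident :: "'o \<Rightarrow> 'm"
  Comp :: "'m \<Rightarrow> 'm \<Rightarrow> 'm"  (infixl "\<cdot>\<index>" 55)

definition hom :: "('o, 'm, 'z) cat_scheme \<Rightarrow> 'o \<Rightarrow> 'o \<Rightarrow> 'm set" where
  "hom C a b = {f \<in> Ar C. Dom C f = a \<and> Cod C f = b}"

locale category =
  fixes C :: "('o, 'm, 'z) cat_scheme" (structure)
  assumes Dom_in: "f \<in> Ar C \<Longrightarrow> Dom C f \<in> Ob C"
    and Cod_in: "f \<in> Ar C \<Longrightarrow> Cod C f \<in> Ob C"
    and ident_in: "a \<in> Ob C \<Longrightarrow> ident C a \<in> hom C a a"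
    and Comp_in: "\<lbrakk>f \<in> hom C a b; g \<in> hom C b c\<rbrakk> \<Longrightarrow> g \<cdot> f \<in> hom C a c"
    and Comp_ident: "f \<in> hom C a b \<Longrightarrow> f \<cdot> ident C a = f"
    and ident_Comp: "f \<in> hom C a b \<Longrightarrow> ident C b \<cdot> f = f"
    and Comp_assoc: "\<lbrakk>f \<in> hom C a b; g \<in> hom C b c; h \<in> hom C c d\<rbrakk>
          \<Longrightarrow> (h \<cdot> g) \<cdot> f = h \<cdot> (g \<cdot> f)"

definition preserves_cat :: "('o, 'm, 'y) cat_scheme \<Rightarrow> ('p, 'n, 'z) cat_scheme
    \<Rightarrow> ('o \<Rightarrow> 'p) \<Rightarrow> ('m \<Rightarrow> 'n) \<Rightarrow> bool" where
  "preserves_cat C D Fo Fm \<longleftrightarrow>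
     (\<forall>a\<in>Ob C. Fo a \<in> Ob D) \<and>
     (\<forall>f\<in>Ar C. Fm f \<in> hom D (Fo (Dom C f)) (Fo (Cod C f))) \<and>
     (\<forall>a\<in>Ob C. Fm (ident C a) = ident D (Fo a)) \<and>
     (\<forall>f\<in>Ar C. \<forall>g\<in>Ar C. Dom C g = Cod C f \<longrightarrow> Fm (g \<cdot>\<^bsub>C\<^esub> f) = Fm g \<cdot>\<^bsub>D\<^esub> Fm f)"

definition bifunctor :: "('o, 'm, 'x) cat_scheme \<Rightarrow> ('o, 'm, 'y) cat_scheme
    \<Rightarrow> ('o, 'm, 'z) cat_scheme \<Rightarrow> ('o \<Rightarrow> 'o \<Rightarrow> 'o) \<Rightarrow> ('m \<Rightarrow> 'm \<Rightarrow> 'm) \<Rightarrow> bool" where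
  "bifunctor A B C Fo Fm \<longleftrightarrow>
     (\<forall>a\<in>Ob A. \<forall>b\<in>Ob B. Fo a b \<in> Ob C) \<and>
     (\<forall>f\<in>Ar A. \<forall>g\<in>Ar B. Fm f g \<in> hom C (Fo (Dom A f) (Dom B g)) (Fo (Cod A f) (Cod B g))) \<and>
     (\<forall>a\<in>Ob A. \<forall>b\<in>Ob B. Fm (ident A a) (ident B b) = ident C (Fo a b)) \<and>
     (\<forall>f\<in>Ar A. \<forall>f'\<in>Ar A. \<forall>g\<in>Ar B. \<forall>g'\<in>Ar B. Dom A f' = Cod A f \<and> Dom B g' = Cod B g
        \<longrightarrow> Fm (f' \<cdot>\<^bsub>A\<^esub> f) (g' \<cdot>\<^bsub>B\<^esub> g) = Fm f' g' \<cdot>\<^bsub>C\<^esub> Fm f g)"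

text \<open>The sum is written \<open>\<oplus>\<close> on objects and \<open>\<boxplus>\<close> on arrows.\<close>

record ('o, 'm) pcat = "('o, 'm) cat" +
  sum_ob :: "'o \<Rightarrow> 'o \<Rightarrow> 'o"  (infixl "\<oplus>\<index>" 65)
  sum_ar :: "'m \<Rightarrow> 'm \<Rightarrow> 'm"  (infixl "\<boxplus>\<index>" 65)
  null :: 'o  ("\<zero>\<index>")
  gam :: "'o \<Rightarrow> 'o \<Rightarrow> 'm"  ("\<gamma>\<index>")

locale permutative = category C for C :: "('o, 'm, 'z) pcat_scheme" (structure) +
  assumes sum_bifunctor: "bifunctor C C C (sum_ob C) (sum_ar C)"
    and null_in: "\<zero> \<in> Ob C"
    and sum_ob_assoc: "\<lbrakk>a \<in> Ob C; b \<in> Ob C; c \<in> Ob C\<rbrakk> \<Longrightarrow> (a \<oplus> b) \<oplus> c = a \<oplus> (b \<oplus> c)"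
    and sum_ar_assoc: "\<lbrakk>f \<in> Ar C; g \<in> Ar C; h \<in> Ar C\<rbrakk> \<Longrightarrow> (f \<boxplus> g) \<boxplus> h = f \<boxplus> (g \<boxplus> h)"
    and sum_ob_null: "a \<in> Ob C \<Longrightarrow> a \<oplus> \<zero> = a" "a \<in> Ob C \<Longrightarrow> \<zero> \<oplus> a = a"
    and sum_ar_null: "f \<in> Ar C \<Longrightarrow> f \<boxplus> ident C \<zero> = f" "f \<in> Ar C \<Longrightarrow> ident C \<zero> \<boxplus> f = f"
    and gam_in: "\<lbrakk>a \<in> Ob C; b \<in> Ob C\<rbrakk> \<Longrightarrow> \<gamma> a b \<in> hom C (a \<oplus> b) (b \<oplus> a)"
    and gam_natural: "\<lbrakk>f \<in> hom C a a'; g \<in> hom C b b'\<rbrakk>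
          \<Longrightarrow> (g \<boxplus> f) \<cdot> \<gamma> a b = \<gamma> a' b' \<cdot> (f \<boxplus> g)"
    and gam_null: "a \<in> Ob C \<Longrightarrow> \<gamma> a \<zero> = ident C a"
    and gam_gam: "\<lbrakk>a \<in> Ob C; b \<in> Ob C\<rbrakk> \<Longrightarrow> \<gamma> b a \<cdot> \<gamma> a b = ident C (a \<oplus> b)"
    and gam_sum: "\<lbrakk>a \<in> Ob C; b \<in> Ob C; c \<in> Ob C\<rbrakk>
          \<Longrightarrow> \<gamma> (a \<oplus> b) c = (\<gamma> a c \<boxplus> ident C b) \<cdot> (ident C a \<boxplus> \<gamma> b c)"

text \<open>A finite product of categories, with tuples as lists.\<close>

definition prod_cat :: "('o, 'm, 'z) cat_scheme list \<Rightarrow> ('o list, 'm list) cat" where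
  "prod_cat Cs =
     \<lparr>Ob = listset (map Ob Cs), Ar = listset (map Ar Cs),
      Dom = map2 Dom Cs, Cod = map2 Cod Cs, ident = map2 ident Cs,
      Comp = (\<lambda>gs fs. map2 (\<lambda>C (g, f). g \<cdot>\<^bsub>C\<^esub> f) Cs (zip gs fs))\<rparr>"

section \<open>Multicategories enriched over small categories, and multifunctors\<close>

text \<open>
  The data of a multicategory enriched over categories. The category \<open>ops\<close> is the disjoint union
  of all the categories $M_k(a_1,\dots,a_k;b)$; the latter consists of the objects of \<open>ops\<close> with
  source \<open>[a\<^sub>1, \<dots>, a\<^sub>k]\<close> and target \<open>b\<close>. The right action of \<open>\<sigma>\<close> is \<open>act_ob \<sigma>\<close>, \<open>act_ar \<sigma>\<close>, and
  \<open>Gam_ob\<close>, \<open>Gam_ar\<close> is the multiproduct. Multifunctors only refer to these data, so the operad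
  identities are not part of the definitions.
\<close>

record ('c, 'f, 't) multicat =
  colors :: "'c set"
  ops :: "('f, 't) cat"
  source :: "'f \<Rightarrow> 'c list"
  target :: "'f \<Rightarrow> 'c"
  unit_op :: "'c \<Rightarrow> 'f"
  act_ob :: "(nat \<Rightarrow> nat) \<Rightarrow> 'f \<Rightarrow> 'f"
  act_ar :: "(nat \<Rightarrow> nat) \<Rightarrow> 't \<Rightarrow> 't"
  Gam_ob :: "'f \<Rightarrow> 'f list \<Rightarrow> 'f"
  Gam_ar :: "'t \<Rightarrow> 't list \<Rightarrow> 't"

record ('c, 'f, 't, 'd, 'g, 'u) mfun =
  on_color :: "'c \<Rightarrow> 'd"
  on_ob :: "'f \<Rightarrow> 'g"
  on_ar :: "'t \<Rightarrow> 'u"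

locale multifunctor =
  fixes M :: "('c, 'f, 't) multicat" and N :: "('d, 'g, 'u) multicat"
    and F :: "('c, 'f, 't, 'd, 'g, 'u) mfun"
  assumes color_in: "c \<in> colors M \<Longrightarrow> on_color F c \<in> colors N"
    and functorial: "preserves_cat (ops M) (ops N) (on_ob F) (on_ar F)"
    and pres_source: "f \<in> Ob (ops M) \<Longrightarrow> source N (on_ob F f) = map (on_color F) (source M f)"
    and pres_target: "f \<in> Ob (ops M) \<Longrightarrow> target N (on_ob F f) = on_color F (target M f)"
    and pres_unit: "c \<in> colors M \<Longrightarrow> on_ob F (unit_op M c) = unit_op N (on_color F c)"
    and pres_act_ob: "\<lbrakk>f \<in> Ob (ops M); \<sigma> permutes {..<length (source M f)}\<rbrakk>
          \<Longrightarrow> on_ob F (act_ob M \<sigma> f) = act_ob N \<sigma> (on_ob F f)"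
    and pres_act_ar:
          "\<lbrakk>\<phi> \<in> Ar (ops M); \<sigma> permutes {..<length (source M (Dom (ops M) \<phi>))}\<rbrakk>
          \<Longrightarrow> on_ar F (act_ar M \<sigma> \<phi>) = act_ar N \<sigma> (on_ar F \<phi>)"
    and pres_Gam_ob:
          "\<lbrakk>g \<in> Ob (ops M); set fs \<subseteq> Ob (ops M); map (target M) fs = source M g\<rbrakk>
          \<Longrightarrow> on_ob F (Gam_ob M g fs) = Gam_ob N (on_ob F g) (map (on_ob F) fs)"
    and pres_Gam_ar:
          "\<lbrakk>\<psi> \<in> Ar (ops M); set \<phi>s \<subseteq> Ar (ops M);
            map (\<lambda>\<phi>. target M (Dom (ops M) \<phi>)) \<phi>s = source M (Dom (ops M) \<psi>)\<rbrakk>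
          \<Longrightarrow> on_ar F (Gam_ar M \<psi> \<phi>s) = Gam_ar N (on_ar F \<psi>) (map (on_ar F) \<phi>s)"
    and color_ext: "on_color F \<in> extensional (colors M)"
    and ob_ext: "on_ob F \<in> extensional (Ob (ops M))"
    and ar_ext: "on_ar F \<in> extensional (Ar (ops M))"

definition mfun_comp :: "('c, 'f, 't) multicat \<Rightarrow> ('d, 'g, 'u, 'e, 'h, 'v) mfun
    \<Rightarrow> ('c, 'f, 't, 'd, 'g, 'u) mfun \<Rightarrow> ('c, 'f, 't, 'e, 'h, 'v) mfun" where
  "mfun_comp M G F =
     \<lparr>on_color = compose (colors M) (on_color G) (on_color F),
      on_ob = compose (Ob (ops M)) (on_ob G) (on_ob F),
      on_ar = compose (Ar (ops M)) (on_ar G) (on_ar F)\<rparr>"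

section \<open>The multicategory of permutative categories\<close>

text \<open>
  In a multilinear map with source \<open>Cs\<close>, \<open>mdel i cs c'\<close> is the distributivity map
  $\delta_i : f(c_i) \oplus f(c_i') \to f(c_i \oplus c_i')$, where the list \<open>cs\<close> provides
  $c_i$ and the fixed variables, and \<open>c'\<close> is $c_i'$.
\<close>

record ('o, 'm) mlin =
  msrc :: "('o, 'm) pcat list"
  mtgt :: "('o, 'm) pcat"
  mob :: "'o list \<Rightarrow> 'o"
  mar :: "'m list \<Rightarrow> 'm"
  mdel :: "nat \<Rightarrow> 'o list \<Rightarrow> 'o \<Rightarrow> 'm"

text \<open>
  That \<open>f\<close> is 0 if some variable is 0 is required of the functor \<open>f\<close>, i.e. also on arrows
  (\<open>mar_null\<close>). With \<open>mob_null\<close> alone, the condition \<open>mdel_null\<close> would not be stable under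
  composition of multilinear maps.
\<close>

locale multilinear =
  fixes Cs :: "('o, 'm) pcat list" and D :: "('o, 'm) pcat" and f :: "('o, 'm) mlin"
  assumes src_permutative: "C \<in> set Cs \<Longrightarrow> permutative C"
    and tgt_permutative: "permutative D"
    and msrc_eq: "msrc f = Cs"
    and mtgt_eq: "mtgt f = D"
    and functorial: "preserves_cat (prod_cat Cs) D (mob f) (mar f)"
    and mob_null: "\<lbrakk>cs \<in> Ob (prod_cat Cs); i < length Cs; cs ! i = \<zero>\<^bsub>Cs ! i\<^esub>\<rbrakk>
          \<Longrightarrow> mob f cs = \<zero>\<^bsub>D\<^esub>"
    and mar_null: "\<lbrakk>fs \<in> Ar (prod_cat Cs); i < length Cs; fs ! i = ident (Cs ! i) \<zero>\<^bsub>Cs ! i\<^esub>\<rbrakk>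
          \<Longrightarrow> mar f fs = ident D \<zero>\<^bsub>D\<^esub>"
    and mdel_in: "\<lbrakk>cs \<in> Ob (prod_cat Cs); i < length Cs; c' \<in> Ob (Cs ! i)\<rbrakk>
          \<Longrightarrow> mdel f i cs c'
              \<in> hom D (mob f cs \<oplus>\<^bsub>D\<^esub> mob f (cs[i := c'])) (mob f (cs[i := cs ! i \<oplus>\<^bsub>Cs ! i\<^esub> c']))"
    and mdel_natural: "\<lbrakk>fs \<in> Ar (prod_cat Cs); i < length Cs; f' \<in> Ar (Cs ! i)\<rbrakk>
          \<Longrightarrow> mar f (fs[i := fs ! i \<boxplus>\<^bsub>Cs ! i\<^esub> f'])
                \<cdot>\<^bsub>D\<^esub> mdel f i (Dom (prod_cat Cs) fs) (Dom (Cs ! i) f')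
              = mdel f i (Cod (prod_cat Cs) fs) (Cod (Cs ! i) f')
                \<cdot>\<^bsub>D\<^esub> (mar f fs \<boxplus>\<^bsub>D\<^esub> mar f (fs[i := f']))"
    and mdel_null: "\<lbrakk>cs \<in> Ob (prod_cat Cs); i < length Cs; c' \<in> Ob (Cs ! i);
            c' = \<zero>\<^bsub>Cs ! i\<^esub> \<or> (\<exists>j<length Cs. cs ! j = \<zero>\<^bsub>Cs ! j\<^esub>)\<rbrakk>
          \<Longrightarrow> mdel f i cs c' = ident D (mob f (cs[i := cs ! i \<oplus>\<^bsub>Cs ! i\<^esub> c']))"
    and mdel_gam: "\<lbrakk>cs \<in> Ob (prod_cat Cs); i < length Cs; c' \<in> Ob (Cs ! i)\<rbrakk>
          \<Longrightarrow> mar f ((ident (prod_cat Cs) cs)[i := \<gamma>\<^bsub>Cs ! i\<^esub> (cs ! i) c']) \<cdot>\<^bsub>D\<^esub> mdel f i cs c'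
              = mdel f i (cs[i := c']) (cs ! i) \<cdot>\<^bsub>D\<^esub> \<gamma>\<^bsub>D\<^esub> (mob f cs) (mob f (cs[i := c']))"
    and mdel_assoc: "\<lbrakk>cs \<in> Ob (prod_cat Cs); i < length Cs; c' \<in> Ob (Cs ! i); c'' \<in> Ob (Cs ! i)\<rbrakk>
          \<Longrightarrow> mdel f i (cs[i := cs ! i \<oplus>\<^bsub>Cs ! i\<^esub> c']) c''
                \<cdot>\<^bsub>D\<^esub> (mdel f i cs c' \<boxplus>\<^bsub>D\<^esub> ident D (mob f (cs[i := c''])))
              = mdel f i cs (c' \<oplus>\<^bsub>Cs ! i\<^esub> c'')
                \<cdot>\<^bsub>D\<^esub> (ident D (mob f cs) \<boxplus>\<^bsub>D\<^esub> mdel f i (cs[i := c']) c'')"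
    and mdel_mdel: "\<lbrakk>cs \<in> Ob (prod_cat Cs); i < length Cs; j < length Cs; i \<noteq> j;
            ci' \<in> Ob (Cs ! i); cj' \<in> Ob (Cs ! j)\<rbrakk>
          \<Longrightarrow> mdel f j (cs[i := cs ! i \<oplus>\<^bsub>Cs ! i\<^esub> ci']) cj'
                \<cdot>\<^bsub>D\<^esub> (mdel f i cs ci' \<boxplus>\<^bsub>D\<^esub> mdel f i (cs[j := cj']) ci')
              = mdel f i (cs[j := cs ! j \<oplus>\<^bsub>Cs ! j\<^esub> cj']) ci'
                \<cdot>\<^bsub>D\<^esub> (mdel f j cs cj' \<boxplus>\<^bsub>D\<^esub> mdel f j (cs[i := ci']) cj')
                \<cdot>\<^bsub>D\<^esub> (ident D (mob f cs)
                    \<boxplus>\<^bsub>D\<^esub> \<gamma>\<^bsub>D\<^esub> (mob f (cs[i := ci'])) (mob f (cs[j := cj']))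
                    \<boxplus>\<^bsub>D\<^esub> ident D (mob f (cs[i := ci', j := cj'])))"
    and mob_ext: "mob f \<in> extensional (Ob (prod_cat Cs))"
    and mar_ext: "mar f \<in> extensional (Ar (prod_cat Cs))"
    and mdel_ext: "\<not> (i < length Cs \<and> cs \<in> Ob (prod_cat Cs) \<and> c' \<in> Ob (Cs ! i))
          \<Longrightarrow> mdel f i cs c' = undefined"

record ('o, 'm) mtrans =
  tdom :: "('o, 'm) mlin"
  tcod :: "('o, 'm) mlin"
  tcomp :: "'o list \<Rightarrow> 'm"

locale multilinear_trans =
  f: multilinear Cs D "tdom \<phi>" + g: multilinear Cs D "tcod \<phi>"
  for Cs :: "('o, 'm) pcat list" and D :: "('o, 'm) pcat" and \<phi> :: "('o, 'm) mtrans" +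
  assumes tcomp_in: "cs \<in> Ob (prod_cat Cs)
          \<Longrightarrow> tcomp \<phi> cs \<in> hom D (mob (tdom \<phi>) cs) (mob (tcod \<phi>) cs)"
    and tcomp_natural: "fs \<in> Ar (prod_cat Cs)
          \<Longrightarrow> mar (tcod \<phi>) fs \<cdot>\<^bsub>D\<^esub> tcomp \<phi> (Dom (prod_cat Cs) fs)
              = tcomp \<phi> (Cod (prod_cat Cs) fs) \<cdot>\<^bsub>D\<^esub> mar (tdom \<phi>) fs"
    and tcomp_mdel: "\<lbrakk>cs \<in> Ob (prod_cat Cs); i < length Cs; c' \<in> Ob (Cs ! i)\<rbrakk>
          \<Longrightarrow> tcomp \<phi> (cs[i := cs ! i \<oplus>\<^bsub>Cs ! i\<^esub> c']) \<cdot>\<^bsub>D\<^esub> mdel (tdom \<phi>) i cs c'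
              = mdel (tcod \<phi>) i cs c' \<cdot>\<^bsub>D\<^esub> (tcomp \<phi> cs \<boxplus>\<^bsub>D\<^esub> tcomp \<phi> (cs[i := c']))"
    and tcomp_ext: "tcomp \<phi> \<in> extensional (Ob (prod_cat Cs))"

definition mlin_cat :: "(('o, 'm) mlin, ('o, 'm) mtrans) cat" where
  "mlin_cat =
     \<lparr>Ob = {f. multilinear (msrc f) (mtgt f) f},
      Ar = {\<phi>. multilinear_trans (msrc (tdom \<phi>)) (mtgt (tdom \<phi>)) \<phi>},
      Dom = tdom, Cod = tcod,
      ident = (\<lambda>f. \<lparr>tdom = f, tcod = f,
                tcomp = (\<lambda>cs\<in>Ob (prod_cat (msrc f)). ident (mtgt f) (mob f cs))\<rparr>),
      Comp = (\<lambda>\<psi> \<phi>. \<lparr>tdom = tdom \<phi>, tcod = tcod \<psi>,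
                tcomp = (\<lambda>cs\<in>Ob (prod_cat (msrc (tdom \<phi>))).
                           tcomp \<psi> cs \<cdot>\<^bsub>mtgt (tdom \<phi>)\<^esub> tcomp \<phi> cs)\<rparr>)\<rparr>"

definition mlin_unit :: "('o, 'm) pcat \<Rightarrow> ('o, 'm) mlin" where
  "mlin_unit C =
     \<lparr>msrc = [C], mtgt = C,
      mob = (\<lambda>cs\<in>Ob (prod_cat [C]). hd cs),
      mar = (\<lambda>fs\<in>Ar (prod_cat [C]). hd fs),
      mdel = (\<lambda>i cs c'. if i = 0 \<and> cs \<in> Ob (prod_cat [C]) \<and> c' \<in> Ob C
                         then ident C (hd cs \<oplus>\<^bsub>C\<^esub> c') else undefined)\<rparr>"

text \<open>
  \<open>permute_list \<sigma> [c\<^sub>1, \<dots>, c\<^sub>k]\<close> is \<open>[c\<^bsub>\<sigma>(1)\<^esub>, \<dots>, c\<^bsub>\<sigma>(k)\<^esub>]\<close>, so the value of $\sigma^* f$ at a list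
  \<open>xs\<close> is the value of $f$ at \<open>permute_list (inv \<sigma>) xs\<close>, and the \<open>i\<close>-th entry of \<open>xs\<close> is the
  \<open>\<sigma> i\<close>-th variable of $f$.
\<close>

definition mlin_act :: "(nat \<Rightarrow> nat) \<Rightarrow> ('o, 'm) mlin \<Rightarrow> ('o, 'm) mlin" where
  "mlin_act \<sigma> f = (let Cs = permute_list \<sigma> (msrc f) in
     \<lparr>msrc = Cs, mtgt = mtgt f,
      mob = (\<lambda>xs\<in>Ob (prod_cat Cs). mob f (permute_list (inv \<sigma>) xs)),
      mar = (\<lambda>xs\<in>Ar (prod_cat Cs). mar f (permute_list (inv \<sigma>) xs)),
      mdel = (\<lambda>i xs x'. if i < length Cs \<and> xs \<in> Ob (prod_cat Cs) \<and> x' \<in> Ob (Cs ! i)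
                         then mdel f (\<sigma> i) (permute_list (inv \<sigma>) xs) x' else undefined)\<rparr>)"

definition mtrans_act :: "(nat \<Rightarrow> nat) \<Rightarrow> ('o, 'm) mtrans \<Rightarrow> ('o, 'm) mtrans" where
  "mtrans_act \<sigma> \<phi> =
     \<lparr>tdom = mlin_act \<sigma> (tdom \<phi>), tcod = mlin_act \<sigma> (tcod \<phi>),
      tcomp = (\<lambda>xs\<in>Ob (prod_cat (permute_list \<sigma> (msrc (tdom \<phi>)))).
                 tcomp \<phi> (permute_list (inv \<sigma>) xs))\<rparr>"

text \<open>
  Concatenations of blocks of lengths \<open>js\<close>: \<open>n\<close> is entry \<open>n - block_start js (block_of js n)\<close>
  of block \<open>block_of js n\<close>, if \<open>n < sum_list js\<close>.
\<close>

definition block_start :: "nat list \<Rightarrow> nat \<Rightarrow> nat" where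
  "block_start js i = sum_list (take i js)"

definition block_of :: "nat list \<Rightarrow> nat \<Rightarrow> nat" where
  "block_of js n = (LEAST i. n < block_start js (Suc i))"

fun blocks :: "nat list \<Rightarrow> 'a list \<Rightarrow> 'a list list" where
  "blocks [] xs = []"
| "blocks (j # js) xs = take j xs # blocks js (drop j xs)"

definition mlin_Gam :: "('o, 'm) mlin \<Rightarrow> ('o, 'm) mlin list \<Rightarrow> ('o, 'm) mlin" where
  "mlin_Gam g fs = (let Cs = concat (map msrc fs); js = map (length \<circ> msrc) fs in
     \<lparr>msrc = Cs, mtgt = mtgt g,
      mob = (\<lambda>xs\<in>Ob (prod_cat Cs). mob g (map2 mob fs (blocks js xs))),
      mar = (\<lambda>xs\<in>Ar (prod_cat Cs). mar g (map2 mar fs (blocks js xs))),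
      mdel = (\<lambda>n xs x'.
        if n < length Cs \<and> xs \<in> Ob (prod_cat Cs) \<and> x' \<in> Ob (Cs ! n) then
          let j = block_of js n; i = n - block_start js j;
              ys = map2 mob fs (blocks js xs); zs = blocks js xs ! j
          in mar g ((ident (prod_cat (msrc g)) ys)[j := mdel (fs ! j) i zs x'])
             \<cdot>\<^bsub>mtgt g\<^esub> mdel g j ys (mob (fs ! j) (zs[i := x']))
        else undefined)\<rparr>)"

definition mtrans_Gam :: "('o, 'm) mtrans \<Rightarrow> ('o, 'm) mtrans list \<Rightarrow> ('o, 'm) mtrans" where
  "mtrans_Gam \<psi> \<phi>s =
     (let fs = map tdom \<phi>s; fs' = map tcod \<phi>s; js = map (length \<circ> msrc) fs in
     \<lparr>tdom = mlin_Gam (tdom \<psi>) fs, tcod = mlin_Gam (tcod \<psi>) fs',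
      tcomp = (\<lambda>xs\<in>Ob (prod_cat (concat (map msrc fs))).
        tcomp \<psi> (map2 mob fs' (blocks js xs))
        \<cdot>\<^bsub>mtgt (tdom \<psi>)\<^esub> mar (tdom \<psi>) (map2 tcomp \<phi>s (blocks js xs)))\<rparr>)"

definition PermCat :: "(('o, 'm) pcat, ('o, 'm) mlin, ('o, 'm) mtrans) multicat" where
  "PermCat =
     \<lparr>colors = {C. permutative C}, ops = mlin_cat, source = msrc, target = mtgt,
      unit_op = mlin_unit, act_ob = mlin_act, act_ar = mtrans_act,
      Gam_ob = mlin_Gam, Gam_ar = mtrans_Gam\<rparr>"

section \<open>The operad of symmetric groups and the multicategory for left modules\<close>

text \<open>
  A coloured permutation is a triple of a source, a target and a permutation. The multicategory
  below has a given set of these as its operations, with only identities between them.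
\<close>

type_synonym 'c cperm = "'c list \<times> 'c \<times> (nat \<Rightarrow> nat)"

definition discrete_cat :: "'a set \<Rightarrow> ('a, 'a) cat" where
  "discrete_cat X = \<lparr>Ob = X, Ar = X, Dom = (\<lambda>x. x), Cod = (\<lambda>x. x), ident = (\<lambda>x. x),
                     Comp = (\<lambda>x y. x)\<rparr>"

text \<open>The sum \<open>\<phi>\<^sub>1 \<amalg> \<dots> \<amalg> \<phi>\<^sub>k\<close> and the block permutation \<open>\<sigma>\<langle>j\<^sub>1, \<dots>, j\<^sub>k\<rangle>\<close>.\<close>

definition perm_sum :: "nat list \<Rightarrow> (nat \<Rightarrow> nat) list \<Rightarrow> nat \<Rightarrow> nat" where
  "perm_sum js \<phi>s n =
     (if n < sum_list js
      then let i = block_of js n in block_start js i + (\<phi>s ! i) (n - block_start js i)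
      else n)"

definition block_perm :: "(nat \<Rightarrow> nat) \<Rightarrow> nat list \<Rightarrow> nat \<Rightarrow> nat" where
  "block_perm \<sigma> js n =
     (if n < sum_list js
      then let i = block_of js n
           in block_start (permute_list (inv \<sigma>) js) (\<sigma> i) + (n - block_start js i)
      else n)"

definition cperm_act :: "(nat \<Rightarrow> nat) \<Rightarrow> 'c cperm \<Rightarrow> 'c cperm" where
  "cperm_act \<tau> = (\<lambda>(cs, c, \<sigma>). (permute_list \<tau> cs, c, \<sigma> \<circ> \<tau>))"

definition cperm_Gam :: "'c cperm \<Rightarrow> 'c cperm list \<Rightarrow> 'c cperm" where
  "cperm_Gam = (\<lambda>(bs, b, \<sigma>) fs.
     let js = map (length \<circ> fst) fs
     in (concat (map fst fs), b, block_perm \<sigma> js \<circ> perm_sum js (map (snd \<circ> snd) fs)))"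

definition cperm_multicat :: "'c set \<Rightarrow> 'c cperm set \<Rightarrow> ('c, 'c cperm, 'c cperm) multicat" where
  "cperm_multicat Cl X =
     \<lparr>colors = Cl, ops = discrete_cat X, source = fst, target = fst \<circ> snd,
      unit_op = (\<lambda>c. ([c], c, id)),
      act_ob = cperm_act, act_ar = cperm_act, Gam_ob = cperm_Gam, Gam_ar = cperm_Gam\<rparr>"

definition Sigma_operad :: "(unit, unit cperm, unit cperm) multicat" where
  "Sigma_operad = cperm_multicat UNIV {(us, (), \<sigma>) | us \<sigma>. \<sigma> permutes {..<length us}}"

datatype lcolor = ColA | ColM

text \<open>With positions counted from 0, $\sigma(j) = k$ reads \<open>\<sigma> j = k - 1\<close>.\<close>

definition lM :: "(lcolor, lcolor cperm, lcolor cperm) multicat" where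
  "lM = cperm_multicat UNIV
     ({(replicate k ColA, ColA, \<sigma>) | k \<sigma>. \<sigma> permutes {..<k}} \<union>
      {((replicate k ColA)[j := ColM], ColM, \<sigma>) | k j \<sigma>.
         j < k \<and> \<sigma> permutes {..<k} \<and> \<sigma> j = k - 1})"

definition lM_incl :: "(unit, unit cperm, unit cperm, lcolor, lcolor cperm, lcolor cperm) mfun" where
  "lM_incl = (let h = (\<lambda>(us, u, \<sigma>)\<in>Ob (ops Sigma_operad). (map (\<lambda>_. ColA) us, ColA, \<sigma>)) in
     \<lparr>on_color = (\<lambda>_. ColA), on_ob = h, on_ar = h\<rparr>)"

section \<open>Associative categories and left modules\<close>

text \<open>
  A pairing of permutative categories with its two distributivity maps; it is written \<open>\<otimes>\<close> on
  objects and \<open>\<boxtimes>\<close> on arrows. The map \<open>dl a a' d\<close> goes from \<open>(a \<otimes> d) \<oplus> (a' \<otimes> d)\<close> to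
  \<open>(a \<oplus> a') \<otimes> d\<close>, and \<open>dr a d d'\<close> from \<open>(a \<otimes> d) \<oplus> (a \<otimes> d')\<close> to \<open>a \<otimes> (d \<oplus> d')\<close>.
\<close>

record ('o, 'm) pairing =
  ten_ob :: "'o \<Rightarrow> 'o \<Rightarrow> 'o"  (infixl "\<otimes>\<index>" 70)
  ten_ar :: "'m \<Rightarrow> 'm \<Rightarrow> 'm"  (infixl "\<boxtimes>\<index>" 70)
  dl :: "'o \<Rightarrow> 'o \<Rightarrow> 'o \<Rightarrow> 'm"
  dr :: "'o \<Rightarrow> 'o \<Rightarrow> 'o \<Rightarrow> 'm"

text \<open>
  The axioms common to an associative category (\<open>D = A\<close>, \<open>S = T\<close>) and to a left module \<open>D\<close> over it:
  \<open>T\<close> is the tensor product of \<open>A\<close> with unit \<open>e\<close>, and \<open>S\<close> is the pairing of \<open>A\<close> and \<open>D\<close>.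

  The assumptions \<open>dl_null\<close>, \<open>dr_null\<close> and \<open>dr_unit\<close> do not follow from the other ones. They say
  that the distributivity maps are identities when an argument is 0, and that acting by \<open>e\<close> is the
  identity of \<open>D\<close> also as a linear map. They are needed for the pairing to be bilinear, where the
  distributivity maps are normalized in this way, and strictly unital in the multicategory of
  permutative categories. The arrow part of \<open>null_ten\<close> and \<open>ten_null\<close> corresponds to \<open>mar_null\<close>.
\<close>

locale tensor_action = A: permutative A + D: permutative D
  for A :: "('o, 'm) pcat" and D :: "('o, 'm) pcat" +
  fixes T :: "('o, 'm) pairing" and e :: 'o and S :: "('o, 'm) pairing"
  assumes ten_bifunctor: "bifunctor A D D (ten_ob S) (ten_ar S)"
    and unit_in: "e \<in> Ob A"
    and ten_ob_assoc: "\<lbrakk>a \<in> Ob A; b \<in> Ob A; d \<in> Ob D\<rbrakk>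
          \<Longrightarrow> (a \<otimes>\<^bsub>T\<^esub> b) \<otimes>\<^bsub>S\<^esub> d = a \<otimes>\<^bsub>S\<^esub> (b \<otimes>\<^bsub>S\<^esub> d)"
    and ten_ar_assoc: "\<lbrakk>f \<in> Ar A; g \<in> Ar A; h \<in> Ar D\<rbrakk>
          \<Longrightarrow> (f \<boxtimes>\<^bsub>T\<^esub> g) \<boxtimes>\<^bsub>S\<^esub> h = f \<boxtimes>\<^bsub>S\<^esub> (g \<boxtimes>\<^bsub>S\<^esub> h)"
    and unit_ten_ob: "d \<in> Ob D \<Longrightarrow> e \<otimes>\<^bsub>S\<^esub> d = d"
    and unit_ten_ar: "h \<in> Ar D \<Longrightarrow> ident A e \<boxtimes>\<^bsub>S\<^esub> h = h"
    and dl_in: "\<lbrakk>a \<in> Ob A; a' \<in> Ob A; d \<in> Ob D\<rbrakk>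
          \<Longrightarrow> dl S a a' d \<in> hom D ((a \<otimes>\<^bsub>S\<^esub> d) \<oplus>\<^bsub>D\<^esub> (a' \<otimes>\<^bsub>S\<^esub> d)) ((a \<oplus>\<^bsub>A\<^esub> a') \<otimes>\<^bsub>S\<^esub> d)"
    and dl_natural: "\<lbrakk>f \<in> Ar A; f' \<in> Ar A; h \<in> Ar D\<rbrakk>
          \<Longrightarrow> ((f \<boxplus>\<^bsub>A\<^esub> f') \<boxtimes>\<^bsub>S\<^esub> h) \<cdot>\<^bsub>D\<^esub> dl S (Dom A f) (Dom A f') (Dom D h)
              = dl S (Cod A f) (Cod A f') (Cod D h) \<cdot>\<^bsub>D\<^esub> ((f \<boxtimes>\<^bsub>S\<^esub> h) \<boxplus>\<^bsub>D\<^esub> (f' \<boxtimes>\<^bsub>S\<^esub> h))"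
    and dr_in: "\<lbrakk>a \<in> Ob A; d \<in> Ob D; d' \<in> Ob D\<rbrakk>
          \<Longrightarrow> dr S a d d' \<in> hom D ((a \<otimes>\<^bsub>S\<^esub> d) \<oplus>\<^bsub>D\<^esub> (a \<otimes>\<^bsub>S\<^esub> d')) (a \<otimes>\<^bsub>S\<^esub> (d \<oplus>\<^bsub>D\<^esub> d'))"
    and dr_natural: "\<lbrakk>f \<in> Ar A; h \<in> Ar D; h' \<in> Ar D\<rbrakk>
          \<Longrightarrow> (f \<boxtimes>\<^bsub>S\<^esub> (h \<boxplus>\<^bsub>D\<^esub> h')) \<cdot>\<^bsub>D\<^esub> dr S (Dom A f) (Dom D h) (Dom D h')
              = dr S (Cod A f) (Cod D h) (Cod D h') \<cdot>\<^bsub>D\<^esub> ((f \<boxtimes>\<^bsub>S\<^esub> h) \<boxplus>\<^bsub>D\<^esub> (f \<boxtimes>\<^bsub>S\<^esub> h'))"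
    and ten_null: "a \<in> Ob A \<Longrightarrow> a \<otimes>\<^bsub>S\<^esub> \<zero>\<^bsub>D\<^esub> = \<zero>\<^bsub>D\<^esub>"
          "f \<in> Ar A \<Longrightarrow> f \<boxtimes>\<^bsub>S\<^esub> ident D \<zero>\<^bsub>D\<^esub> = ident D \<zero>\<^bsub>D\<^esub>"
    and null_ten: "d \<in> Ob D \<Longrightarrow> \<zero>\<^bsub>A\<^esub> \<otimes>\<^bsub>S\<^esub> d = \<zero>\<^bsub>D\<^esub>"
          "h \<in> Ar D \<Longrightarrow> ident A \<zero>\<^bsub>A\<^esub> \<boxtimes>\<^bsub>S\<^esub> h = ident D \<zero>\<^bsub>D\<^esub>"
    and dl_null: "\<lbrakk>a \<in> Ob A; a' \<in> Ob A; d \<in> Ob D; a = \<zero>\<^bsub>A\<^esub> \<or> a' = \<zero>\<^bsub>A\<^esub> \<or> d = \<zero>\<^bsub>D\<^esub>\<rbrakk>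
          \<Longrightarrow> dl S a a' d = ident D ((a \<oplus>\<^bsub>A\<^esub> a') \<otimes>\<^bsub>S\<^esub> d)"
    and dr_null: "\<lbrakk>a \<in> Ob A; d \<in> Ob D; d' \<in> Ob D; a = \<zero>\<^bsub>A\<^esub> \<or> d = \<zero>\<^bsub>D\<^esub> \<or> d' = \<zero>\<^bsub>D\<^esub>\<rbrakk>
          \<Longrightarrow> dr S a d d' = ident D (a \<otimes>\<^bsub>S\<^esub> (d \<oplus>\<^bsub>D\<^esub> d'))"
    and dr_unit: "\<lbrakk>d \<in> Ob D; d' \<in> Ob D\<rbrakk> \<Longrightarrow> dr S e d d' = ident D (d \<oplus>\<^bsub>D\<^esub> d')"
    and dl_assoc: "\<lbrakk>a \<in> Ob A; a' \<in> Ob A; a'' \<in> Ob A; d \<in> Ob D\<rbrakk>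
          \<Longrightarrow> dl S (a \<oplus>\<^bsub>A\<^esub> a') a'' d \<cdot>\<^bsub>D\<^esub> (dl S a a' d \<boxplus>\<^bsub>D\<^esub> ident D (a'' \<otimes>\<^bsub>S\<^esub> d))
              = dl S a (a' \<oplus>\<^bsub>A\<^esub> a'') d \<cdot>\<^bsub>D\<^esub> (ident D (a \<otimes>\<^bsub>S\<^esub> d) \<boxplus>\<^bsub>D\<^esub> dl S a' a'' d)"
    and dr_assoc: "\<lbrakk>a \<in> Ob A; d \<in> Ob D; d' \<in> Ob D; d'' \<in> Ob D\<rbrakk>
          \<Longrightarrow> dr S a (d \<oplus>\<^bsub>D\<^esub> d') d'' \<cdot>\<^bsub>D\<^esub> (dr S a d d' \<boxplus>\<^bsub>D\<^esub> ident D (a \<otimes>\<^bsub>S\<^esub> d''))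
              = dr S a d (d' \<oplus>\<^bsub>D\<^esub> d'') \<cdot>\<^bsub>D\<^esub> (ident D (a \<otimes>\<^bsub>S\<^esub> d) \<boxplus>\<^bsub>D\<^esub> dr S a d' d'')"
    and dl_gam: "\<lbrakk>a \<in> Ob A; a' \<in> Ob A; d \<in> Ob D\<rbrakk>
          \<Longrightarrow> (\<gamma>\<^bsub>A\<^esub> a a' \<boxtimes>\<^bsub>S\<^esub> ident D d) \<cdot>\<^bsub>D\<^esub> dl S a a' d
              = dl S a' a d \<cdot>\<^bsub>D\<^esub> \<gamma>\<^bsub>D\<^esub> (a \<otimes>\<^bsub>S\<^esub> d) (a' \<otimes>\<^bsub>S\<^esub> d)"
    and dr_gam: "\<lbrakk>a \<in> Ob A; d \<in> Ob D; d' \<in> Ob D\<rbrakk>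
          \<Longrightarrow> (ident A a \<boxtimes>\<^bsub>S\<^esub> \<gamma>\<^bsub>D\<^esub> d d') \<cdot>\<^bsub>D\<^esub> dr S a d d'
              = dr S a d' d \<cdot>\<^bsub>D\<^esub> \<gamma>\<^bsub>D\<^esub> (a \<otimes>\<^bsub>S\<^esub> d) (a \<otimes>\<^bsub>S\<^esub> d')"
    and dl_ten: "\<lbrakk>a \<in> Ob A; a' \<in> Ob A; b \<in> Ob A; d \<in> Ob D\<rbrakk>
          \<Longrightarrow> dl S a a' (b \<otimes>\<^bsub>S\<^esub> d)
              = (dl T a a' b \<boxtimes>\<^bsub>S\<^esub> ident D d) \<cdot>\<^bsub>D\<^esub> dl S (a \<otimes>\<^bsub>T\<^esub> b) (a' \<otimes>\<^bsub>T\<^esub> b) d"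
    and dr_ten: "\<lbrakk>a \<in> Ob A; b \<in> Ob A; d \<in> Ob D; d' \<in> Ob D\<rbrakk>
          \<Longrightarrow> dr S (a \<otimes>\<^bsub>T\<^esub> b) d d'
              = (ident A a \<boxtimes>\<^bsub>S\<^esub> dr S b d d') \<cdot>\<^bsub>D\<^esub> dr S a (b \<otimes>\<^bsub>S\<^esub> d) (b \<otimes>\<^bsub>S\<^esub> d')"
    and dr_dl: "\<lbrakk>a \<in> Ob A; b \<in> Ob A; b' \<in> Ob A; d \<in> Ob D\<rbrakk>
          \<Longrightarrow> (dr T a b b' \<boxtimes>\<^bsub>S\<^esub> ident D d) \<cdot>\<^bsub>D\<^esub> dl S (a \<otimes>\<^bsub>T\<^esub> b) (a \<otimes>\<^bsub>T\<^esub> b') d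
              = (ident A a \<boxtimes>\<^bsub>S\<^esub> dl S b b' d) \<cdot>\<^bsub>D\<^esub> dr S a (b \<otimes>\<^bsub>S\<^esub> d) (b' \<otimes>\<^bsub>S\<^esub> d)"
    and dl_dr: "\<lbrakk>a \<in> Ob A; a' \<in> Ob A; d \<in> Ob D; d' \<in> Ob D\<rbrakk>
          \<Longrightarrow> dl S a a' (d \<oplus>\<^bsub>D\<^esub> d') \<cdot>\<^bsub>D\<^esub> (dr S a d d' \<boxplus>\<^bsub>D\<^esub> dr S a' d d')
              = dr S (a \<oplus>\<^bsub>A\<^esub> a') d d' \<cdot>\<^bsub>D\<^esub> (dl S a a' d \<boxplus>\<^bsub>D\<^esub> dl S a a' d')
                \<cdot>\<^bsub>D\<^esub> (ident D (a \<otimes>\<^bsub>S\<^esub> d) \<boxplus>\<^bsub>D\<^esub> \<gamma>\<^bsub>D\<^esub> (a \<otimes>\<^bsub>S\<^esub> d') (a' \<otimes>\<^bsub>S\<^esub> d)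
                    \<boxplus>\<^bsub>D\<^esub> ident D (a' \<otimes>\<^bsub>S\<^esub> d'))"

text \<open>As \<open>dr_unit\<close> above, \<open>dl_unit\<close> is the linear part of the strictness of the unit.\<close>

locale associative_category = tensor_action A A T e T
  for A :: "('o, 'm) pcat" and T :: "('o, 'm) pairing" and e :: 'o +
  assumes ten_unit_ob: "a \<in> Ob A \<Longrightarrow> a \<otimes>\<^bsub>T\<^esub> e = a"
    and ten_unit_ar: "f \<in> Ar A \<Longrightarrow> f \<boxtimes>\<^bsub>T\<^esub> ident A e = f"
    and dl_unit: "\<lbrakk>a \<in> Ob A; a' \<in> Ob A\<rbrakk> \<Longrightarrow> dl T a a' e = ident A (a \<oplus>\<^bsub>A\<^esub> a')"

locale left_module = tensor_action A D T e S
  for A :: "('o, 'm) pcat" and T :: "('o, 'm) pairing" and e :: 'o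
    and D :: "('o, 'm) pcat" and S :: "('o, 'm) pairing" +
  assumes ten_ob_ext: "\<not> (a \<in> Ob A \<and> d \<in> Ob D) \<Longrightarrow> a \<otimes>\<^bsub>S\<^esub> d = undefined"
    and ten_ar_ext: "\<not> (f \<in> Ar A \<and> h \<in> Ar D) \<Longrightarrow> f \<boxtimes>\<^bsub>S\<^esub> h = undefined"
    and dl_ext: "\<not> (a \<in> Ob A \<and> a' \<in> Ob A \<and> d \<in> Ob D) \<Longrightarrow> dl S a a' d = undefined"
    and dr_ext: "\<not> (a \<in> Ob A \<and> d \<in> Ob D \<and> d' \<in> Ob D) \<Longrightarrow> dr S a d d' = undefined"

section \<open>The structure map of an associative category\<close>

definition ten_list :: "('o, 'm) pairing \<Rightarrow> 'o \<Rightarrow> 'o list \<Rightarrow> 'o" where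
  "ten_list T e as = foldr (ten_ob T) as e"

definition ten_list_ar :: "('o, 'm) pcat \<Rightarrow> ('o, 'm) pairing \<Rightarrow> 'o \<Rightarrow> 'm list \<Rightarrow> 'm" where
  "ten_list_ar A T e fs = foldr (ten_ar T) fs (ident A e)"

text \<open>
  If \<open>x\<close> and \<open>y\<close> are the products of the factors before and after the \<open>i\<close>-th variable, then
  $\delta_i$ is the composite of the maps \<open>dl\<close> and \<open>dr\<close> from
  \<open>(x \<otimes> a\<^sub>i \<otimes> y) \<oplus> (x \<otimes> a\<^sub>i' \<otimes> y)\<close> through \<open>((x \<otimes> a\<^sub>i) \<oplus> (x \<otimes> a\<^sub>i')) \<otimes> y\<close> to \<open>x \<otimes> (a\<^sub>i \<oplus> a\<^sub>i') \<otimes> y\<close>.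
\<close>

definition structure_op ::
    "('o, 'm) pcat \<Rightarrow> ('o, 'm) pairing \<Rightarrow> 'o \<Rightarrow> nat \<Rightarrow> (nat \<Rightarrow> nat) \<Rightarrow> ('o, 'm) mlin" where
  "structure_op A T e k \<sigma> = (let Cs = replicate k A in
     \<lparr>msrc = Cs, mtgt = A,
      mob = (\<lambda>as\<in>Ob (prod_cat Cs). ten_list T e (permute_list (inv \<sigma>) as)),
      mar = (\<lambda>fs\<in>Ar (prod_cat Cs). ten_list_ar A T e (permute_list (inv \<sigma>) fs)),
      mdel = (\<lambda>i as a'.
        if i < k \<and> as \<in> Ob (prod_cat Cs) \<and> a' \<in> Ob A then
          let bs = permute_list (inv \<sigma>) as;
              x = ten_list T e (take (\<sigma> i) bs); y = ten_list T e (drop (Suc (\<sigma> i)) bs)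
          in (dr T x (as ! i) a' \<boxtimes>\<^bsub>T\<^esub> ident A y) \<cdot>\<^bsub>A\<^esub> dl T (x \<otimes>\<^bsub>T\<^esub> as ! i) (x \<otimes>\<^bsub>T\<^esub> a') y
        else undefined)\<rparr>)"

definition structure_map :: "('o, 'm) pcat \<Rightarrow> ('o, 'm) pairing \<Rightarrow> 'o
    \<Rightarrow> (unit, unit cperm, unit cperm, ('o, 'm) pcat, ('o, 'm) mlin, ('o, 'm) mtrans) mfun" where
  "structure_map A T e =
     \<lparr>on_color = (\<lambda>_. A),
      on_ob = (\<lambda>(us, u, \<sigma>)\<in>Ob (ops Sigma_operad). structure_op A T e (length us) \<sigma>),
      on_ar = (\<lambda>(us, u, \<sigma>)\<in>Ar (ops Sigma_operad).
                 ident mlin_cat (structure_op A T e (length us) \<sigma>))\<rparr>"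

section \<open>The pairing of a bilinear map\<close>

definition pairing_of :: "('o, 'm) mlin \<Rightarrow> ('o, 'm) pairing" where
  "pairing_of f =
     \<lparr>ten_ob = (\<lambda>a d. mob f [a, d]), ten_ar = (\<lambda>g h. mar f [g, h]),
      dl = (\<lambda>a a' d. mdel f 0 [a, d] a'), dr = (\<lambda>a d d'. mdel f 1 [a, d] d')\<rparr>"

end

theory Submission
  imports Defs
begin

text \<open>
  The operations of \<open>lM\<close> are generated by very little. Up to the action of a permutation,
  an operation is a word: either $A \dots A$ with value in $A$, or $A \dots A\,M$ with value in $M$
  (\<open>Ob_lM\<close>). The words with value in $M$ are multiproducts of the binary operation $A\,M$ with
  words in $A$ and units. Hence a multifunctor that extends the structure map of $A$ is determined
  by the bilinear map that it assigns to this one binary operation (\<open>multifunctor_determined\<close>).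

  That bilinear map is a module structure, because the module conditions are equations between
  multilinear maps that hold already in \<open>lM\<close> (\<open>left_module_pair_op\<close>). The ternary operation
  $A\,A\,M$ is obtained in two ways, as $(a \otimes b) \otimes d$ and as $a \otimes (b \otimes d)$.
  The equality of their images contains the associativity of the action on objects and arrows, and,
  in its three variables, the conditions \<open>dl_ten\<close>, \<open>dr_dl\<close> and \<open>dr_ten\<close>. Inserting the nullary
  operation gives the conditions on the unit, and what is left of the definition of a module says
  that the pairing is bilinear.

  Conversely, a module structure assigns to a word an iterated tensor product, which is built by
  the step from a multilinear map $h$ to $(a, x) \mapsto a \otimes h(x)$. The step preserves
  multilinearity (\<open>multilinear_cons_op\<close>). It starts from the constant $e$ for words with value in
  $A$, where it yields the structure map (\<open>structure_op_eq\<close>), and from the identity of $D$ for words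
  with value in $M$. Two facts make the assignment a multifunctor. One is associativity: the
  multiproduct of iterated tensor products is the iterated tensor product of the concatenated word
  (\<open>mlin_Gam_cons_pow\<close>). The other one is the equivariance of the multiproduct of multilinear maps
  (\<open>mlin_Gam_act\<close>), by which permutations can be moved to the outside; this is mostly
  the combinatorics of a list that is cut into blocks.
\<close>

section \<open>Permutations of lists that are cut into blocks\<close>

lemma block_start_simps [simp]:
  "block_start js 0 = 0" "block_start [] i = 0"
  "block_start (j # js) (Suc i) = j + block_start js i"
  by (auto simp: block_start_def)

lemma block_of_Cons:
  assumes "n < j + sum_list js"
  shows "block_of (j # js) n = (if n < j then 0 else Suc (block_of js (n - j)))"
proof (cases "n < j")
  case True
  then show ?thesis by (auto simp: block_of_def intro: Least_equality)
next
  case False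
  have "n < block_start (j # js) (Suc (length js))"
    using assms by (simp add: block_start_def)
  moreover have "\<not> n < block_start (j # js) (Suc 0)" using False by simp
  ultimately have "block_of (j # js) n = Suc (LEAST m. n < block_start (j # js) (Suc (Suc m)))"
    unfolding block_of_def
    by (rule Least_Suc[where P = "\<lambda>i. n < block_start (j # js) (Suc i)"])
  also have "(\<lambda>m. n < block_start (j # js) (Suc (Suc m))) = (\<lambda>m. n - j < block_start js (Suc m))"
    using False by (auto simp del: block_start_simps(2) simp: fun_eq_iff)
  finally show ?thesis using False by (simp add: block_of_def)
qed

lemma block_of_start:
  assumes "p < length js" "q < js ! p"
  shows "block_of js (block_start js p + q) = p" "block_start js p + q < sum_list js"
proof -
  have "block_of js (block_start js p + q) = p \<and> block_start js p + q < sum_list js"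
    using assms
  proof (induction js arbitrary: p)
    case (Cons j js)
    show ?case
    proof (cases p)
      case 0
      then show ?thesis using Cons.prems by (simp add: block_of_Cons)
    next
      case (Suc p')
      then show ?thesis using Cons.IH[of p'] Cons.prems by (simp add: block_of_Cons add.assoc)
    qed
  qed simp
  then show "block_of js (block_start js p + q) = p" "block_start js p + q < sum_list js" by auto
qed

lemma block_position:
  assumes "n < sum_list js"
  obtains p q where "p < length js" "q < js ! p" "n = block_start js p + q"
proof -
  have "\<exists>p q. p < length js \<and> q < js ! p \<and> n = block_start js p + q"
    using assms
  proof (induction js arbitrary: n)
    case (Cons j js)
    show ?case
    proof (cases "n < j")
      case True
      then show ?thesis by (intro exI[of _ 0] exI[of _ n]) simp
    next
      case False
      then have "n - j < sum_list js" using Cons.prems by simp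
      from Cons.IH[OF this] obtain p q
        where "p < length js" "q < js ! p" "n - j = block_start js p + q" by blast
      then show ?thesis using False by (intro exI[of _ "Suc p"] exI[of _ q]) simp
    qed
  qed simp
  then show ?thesis using that by blast
qed

lemma nth_concat_block:
  "\<lbrakk>p < length xss; q < length (xss ! p)\<rbrakk>
    \<Longrightarrow> concat xss ! (block_start (map length xss) p + q) = xss ! p ! q"
proof (induction xss arbitrary: p)
  case (Cons xs xss)
  then show ?case by (cases p) (auto simp: nth_append add.assoc)
qed simp

lemma length_blocks [simp]: "length (blocks js xs) = length js"
  by (induction js xs rule: blocks.induct) auto

lemma map_length_blocks:
  "length xs = sum_list js \<Longrightarrow> map length (blocks js xs) = js"
  by (induction js xs rule: blocks.induct) auto

lemma concat_blocks:
  "length xs = sum_list js \<Longrightarrow> concat (blocks js xs) = xs"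
  by (induction js xs rule: blocks.induct) auto

lemma blocks_concat: "blocks (map length xss) (concat xss) = xss"
  by (induction xss) auto

lemma blocks_update:
  assumes "length xs = sum_list js" "p < length js" "q < js ! p"
  shows "blocks js (xs[block_start js p + q := x]) = (blocks js xs)[p := (blocks js xs ! p)[q := x]]"
  using assms
proof (induction js xs arbitrary: p rule: blocks.induct)
  case (2 j js xs)
  show ?case
  proof (cases p)
    case 0
    then show ?thesis using 2 by (simp add: take_update_swap)
  next
    case (Suc p')
    then show ?thesis using 2 by (simp add: drop_update_swap add.assoc)
  qed
qed simp

lemma inv_permutes_lt:
  assumes "\<sigma> permutes {..<n}" "i < n"
  shows "\<sigma> i < n" "inv \<sigma> i < n" "\<sigma> (inv \<sigma> i) = i" "inv \<sigma> (\<sigma> i) = i"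
  using assms permutes_in_image[OF assms(1)] permutes_in_image[OF permutes_inv[OF assms(1)]]
    permutes_inverses[OF assms(1)] by auto

lemma nth_permute_inv:
  assumes "\<sigma> permutes {..<length xs}" "i < length xs"
  shows "permute_list (inv \<sigma>) xs ! i = xs ! inv \<sigma> i"
    and "permute_list (inv \<sigma>) xs ! \<sigma> i = xs ! i"
    and "permute_list \<sigma> xs ! i = xs ! \<sigma> i"
  using assms inv_permutes_lt[OF assms] by (simp_all add: permute_list_nth permutes_inv)

lemma permute_list_cancel:
  assumes "\<sigma> permutes {..<length xs}"
  shows "permute_list \<sigma> (permute_list (inv \<sigma>) xs) = xs"
    and "permute_list (inv \<sigma>) (permute_list \<sigma> xs) = xs"
  using assms
  by (simp_all add: permute_list_compose[symmetric] permutes_inv permutes_inv_o)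

lemma permute_list_inv_update:
  assumes "\<sigma> permutes {..<length xs}" "i < length xs"
  shows "permute_list (inv \<sigma>) (xs[i := x]) = (permute_list (inv \<sigma>) xs)[\<sigma> i := x]"
proof (rule nth_equalityI)
  fix p assume "p < length (permute_list (inv \<sigma>) (xs[i := x]))"
  then have p: "p < length xs" by simp
  have "inv \<sigma> p = i \<longleftrightarrow> p = \<sigma> i"
    using assms(1) permutes_inverses[OF assms(1)] by metis
  then show "permute_list (inv \<sigma>) (xs[i := x]) ! p = (permute_list (inv \<sigma>) xs)[\<sigma> i := x] ! p"
    using assms p inv_permutes_lt[OF assms(1) p]
    by (auto simp: nth_permute_inv nth_list_update permute_list_nth permutes_inv)
qed simp

text \<open>
  The permutation $\Gamma(\sigma; \phi_1, \dots, \phi_k)$ of the operad of symmetric groups.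
\<close>

abbreviation Gamma_perm :: "(nat \<Rightarrow> nat) \<Rightarrow> nat list \<Rightarrow> (nat \<Rightarrow> nat) list \<Rightarrow> nat \<Rightarrow> nat" where
  "Gamma_perm \<sigma> js \<phi>s \<equiv> block_perm \<sigma> js \<circ> perm_sum js \<phi>s"

text \<open>
  All other properties of \<open>Gamma_perm\<close> follow from this formula in the coordinates of a position:
  the block \<open>p\<close> that contains it and its place \<open>q\<close> in the block.
\<close>

lemma Gamma_perm_block:
  assumes "length \<phi>s = length js" "p < length js" "q < js ! p" "(\<phi>s ! p) permutes {..<js ! p}"
  shows "Gamma_perm \<sigma> js \<phi>s (block_start js p + q)
       = block_start (permute_list (inv \<sigma>) js) (\<sigma> p) + (\<phi>s ! p) q"
proof -
  have q': "(\<phi>s ! p) q < js ! p" using inv_permutes_lt[OF assms(4,3)] by simp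
  have "perm_sum js \<phi>s (block_start js p + q) = block_start js p + (\<phi>s ! p) q"
    using block_of_start[OF assms(2,3)] by (simp add: perm_sum_def)
  then show ?thesis using block_of_start[OF assms(2) q'] by (simp add: block_perm_def)
qed

lemma sum_list_permute:
  assumes "\<sigma> permutes {..<length js}"
  shows "sum_list (permute_list (inv \<sigma>) js) = sum_list (js :: nat list)"
  using assms by (metis permutes_inv mset_permute_list sum_mset_sum_list)

lemma Gamma_perm_permutes:
  assumes \<sigma>: "\<sigma> permutes {..<length js}" and len: "length \<phi>s = length js"
    and \<phi>: "\<And>p. p < length js \<Longrightarrow> (\<phi>s ! p) permutes {..<js ! p}"
  shows "Gamma_perm \<sigma> js \<phi>s permutes {..<sum_list js}"
proof (rule bij_imp_permutes)
  let ?\<rho> = "Gamma_perm \<sigma> js \<phi>s" and ?ks = "permute_list (inv \<sigma>) js"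
  have lt: "\<sigma> p < length ?ks \<and> (\<phi>s ! p) q < ?ks ! \<sigma> p" if "p < length js" "q < js ! p" for p q
    using that inv_permutes_lt[OF \<sigma> that(1)] inv_permutes_lt[OF \<phi> that(2)]
    by (simp add: nth_permute_inv \<sigma>)
  have inj: "inj_on ?\<rho> {..<sum_list js}"
  proof (rule inj_onI)
    fix n n' assume "n \<in> {..<sum_list js}" "n' \<in> {..<sum_list js}" and eq: "?\<rho> n = ?\<rho> n'"
    then obtain p q p' q' where p: "p < length js" "q < js ! p" "n = block_start js p + q"
      and p': "p' < length js" "q' < js ! p'" "n' = block_start js p' + q'"
      by (metis block_position lessThan_iff)
    have e: "block_start ?ks (\<sigma> p) + (\<phi>s ! p) q = block_start ?ks (\<sigma> p') + (\<phi>s ! p') q'"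
      using eq p p' Gamma_perm_block[OF len] \<phi> by metis
    then have "\<sigma> p = \<sigma> p'"
      using block_of_start(1)[of "\<sigma> p" ?ks] block_of_start(1)[of "\<sigma> p'" ?ks]
        lt[OF p(1,2)] lt[OF p'(1,2)] by metis
    then have "p = p'" using \<sigma> by (metis permutes_inverses(2))
    moreover from this have "q = q'" using e \<phi>[OF p(1)] by (metis add_left_cancel permutes_inverses(2))
    ultimately show "n = n'" using p p' by simp
  qed
  have "?\<rho> n < sum_list js" if "n < sum_list js" for n
  proof -
    obtain p q where p: "p < length js" "q < js ! p" "n = block_start js p + q"
      using block_position[OF \<open>n < sum_list js\<close>] .
    then show ?thesis
      using Gamma_perm_block[OF len p(1,2) \<phi>[OF p(1)], of \<sigma>]
        block_of_start(2)[of "\<sigma> p" ?ks "(\<phi>s ! p) q"] lt[OF p(1,2)] sum_list_permute[OF \<sigma>]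
      by simp
  qed
  then have "?\<rho> ` {..<sum_list js} \<subseteq> {..<sum_list js}" by auto
  then show "bij_betw ?\<rho> {..<sum_list js} {..<sum_list js}"
    using inj endo_inj_surj[OF _ _ inj] by (auto simp: bij_betw_def)
  show "?\<rho> n = n" if "n \<notin> {..<sum_list js}" for n
    using that by (simp add: perm_sum_def block_perm_def)
qed

abbreviation permute_blocks :: "(nat \<Rightarrow> nat) list \<Rightarrow> 'a list list \<Rightarrow> 'a list list" where
  "permute_blocks \<phi>s xss \<equiv> map2 (\<lambda>\<phi>. permute_list (inv \<phi>)) \<phi>s xss"

text \<open>
  This reduces \<open>Gamma_perm\<close> to permutations of a list of blocks. It holds because entry
  \<open>Gamma_perm _ _ \<phi>s n\<close> of either side is entry \<open>n\<close> of the concatenation, by \<open>Gamma_perm_block\<close>.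
\<close>

lemma permute_list_Gamma_perm:
  assumes \<sigma>: "\<sigma> permutes {..<length xss}" and len: "length \<phi>s = length xss"
    and \<phi>: "\<And>p. p < length xss \<Longrightarrow> (\<phi>s ! p) permutes {..<length (xss ! p)}"
  shows "permute_list (inv (Gamma_perm \<sigma> (map length xss) \<phi>s)) (concat xss)
       = concat (permute_list (inv \<sigma>) (permute_blocks \<phi>s xss))"
    (is "permute_list (inv ?\<rho>) _ = concat (permute_list _ ?L)")
proof -
  let ?js = "map length xss"
  define yss where "yss = permute_list (inv \<sigma>) ?L"
  have \<rho>: "?\<rho> permutes {..<length (concat xss)}"
    using Gamma_perm_permutes[of \<sigma> ?js \<phi>s] assms by (simp add: length_concat)
  have lenL: "length ?L = length xss" using len by simp
  have "map length ?L = ?js"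
    using len by (auto intro: nth_equalityI)
  then have lens: "map length yss = permute_list (inv \<sigma>) ?js"
    unfolding yss_def using \<sigma> lenL by (simp add: permute_list_map[symmetric] permutes_inv)
  then have lenY: "length (concat yss) = length (concat xss)"
    using sum_list_permute[of \<sigma> ?js] \<sigma> by (simp add: length_concat)
  have nth: "concat yss ! ?\<rho> n = concat xss ! n" if "n < length (concat xss)" for n
  proof -
    from that have "n < sum_list ?js" by (simp add: length_concat)
    then obtain p q where p: "p < length ?js" "q < ?js ! p" and n: "n = block_start ?js p + q"
      by (rule block_position)
    have p': "p < length xss" "q < length (xss ! p)" using p by auto
    have yp: "yss ! \<sigma> p = permute_list (inv (\<phi>s ! p)) (xss ! p)"
      unfolding yss_def using nth_permute_inv(2)[of \<sigma> ?L p] \<sigma> lenL p' len by simp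
    have "?\<rho> n = block_start (map length yss) (\<sigma> p) + (\<phi>s ! p) q"
      unfolding lens n using Gamma_perm_block[of \<phi>s ?js p q \<sigma>] len p \<phi>[OF p'(1)] p'(1) by simp
    moreover have "\<sigma> p < length yss" "(\<phi>s ! p) q < length (yss ! \<sigma> p)"
      using inv_permutes_lt[OF \<sigma> p'(1)] inv_permutes_lt[OF \<phi> p'(2)] p'(1) lenL
      unfolding yp by (simp_all add: yss_def)
    ultimately have "concat yss ! ?\<rho> n = yss ! \<sigma> p ! (\<phi>s ! p) q"
      using nth_concat_block[of "\<sigma> p" yss "(\<phi>s ! p) q"] by simp
    also have "\<dots> = xss ! p ! q"
      unfolding yp using nth_permute_inv(2)[OF \<phi> p'(2)] p'(1) by simp
    also have "\<dots> = concat xss ! n"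
      unfolding n using nth_concat_block[OF p'] by simp
    finally show ?thesis .
  qed
  have "permute_list (inv ?\<rho>) (concat xss) = concat yss"
  proof (rule nth_equalityI)
    fix m assume "m < length (permute_list (inv ?\<rho>) (concat xss))"
    then have m: "m < length (concat xss)" by simp
    show "permute_list (inv ?\<rho>) (concat xss) ! m = concat yss ! m"
      using nth[of "inv ?\<rho> m"] inv_permutes_lt[OF \<rho> m] nth_permute_inv(1)[OF \<rho> m] by simp
  qed (simp add: lenY)
  then show ?thesis by (simp add: yss_def)
qed

lemma Gamma_perm_id:
  assumes "length \<phi>s = length js" "\<And>p. p < length js \<Longrightarrow> \<phi>s ! p = id"
  shows "Gamma_perm id js \<phi>s = id"
proof
  fix n
  show "Gamma_perm id js \<phi>s n = id n"
  proof (cases "n < sum_list js")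
    case True
    then obtain p q where p: "p < length js" "q < js ! p" "n = block_start js p + q"
      by (rule block_position)
    then show ?thesis
      using Gamma_perm_block[of \<phi>s js p q id] assms by (simp add: permutes_id)
  next
    case False
    then show ?thesis by (simp add: perm_sum_def block_perm_def)
  qed
qed

section \<open>Categories and tuples\<close>

context category
begin

lemma ident_simps [simp]:
  assumes "a \<in> Ob C"
  shows "ident C a \<in> Ar C" "Dom C (ident C a) = a" "Cod C (ident C a) = a"
  using ident_in[OF assms] by (auto simp: hom_def)

lemma Comp_simps [simp]:
  assumes "f \<in> Ar C" "g \<in> Ar C" "Dom C g = Cod C f"
  shows "g \<cdot> f \<in> Ar C" "Dom C (g \<cdot> f) = Dom C f" "Cod C (g \<cdot> f) = Cod C g"
  using Comp_in[of f "Dom C f" "Cod C f" g "Cod C g"] assms by (auto simp: hom_def)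

lemma Comp_ident_simps [simp]:
  "f \<in> Ar C \<Longrightarrow> Dom C f = a \<Longrightarrow> f \<cdot> ident C a = f"
  "f \<in> Ar C \<Longrightarrow> Cod C f = a \<Longrightarrow> ident C a \<cdot> f = f"
  using Comp_ident ident_Comp by (auto simp: hom_def)

lemma assoc:
  assumes "f \<in> Ar C" "g \<in> Ar C" "h \<in> Ar C" "Dom C g = Cod C f" "Dom C h = Cod C g"
  shows "h \<cdot> g \<cdot> f = h \<cdot> (g \<cdot> f)"
  using Comp_assoc[of f "Dom C f" "Dom C g" g "Dom C h" h "Cod C h"] assms by (auto simp: hom_def)

end

context permutative
begin

lemma sum_ob_in [simp]: "\<lbrakk>a \<in> Ob C; b \<in> Ob C\<rbrakk> \<Longrightarrow> a \<oplus> b \<in> Ob C"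
  using sum_bifunctor by (simp add: bifunctor_def)

lemma sum_ar_simps [simp]:
  assumes "f \<in> Ar C" "g \<in> Ar C"
  shows "f \<boxplus> g \<in> Ar C" "Dom C (f \<boxplus> g) = Dom C f \<oplus> Dom C g" "Cod C (f \<boxplus> g) = Cod C f \<oplus> Cod C g"
  using sum_bifunctor assms by (auto simp: bifunctor_def hom_def)

lemma sum_ident [simp]: "\<lbrakk>a \<in> Ob C; b \<in> Ob C\<rbrakk> \<Longrightarrow> ident C a \<boxplus> ident C b = ident C (a \<oplus> b)"
  using sum_bifunctor by (simp add: bifunctor_def)

lemma sum_Comp:
  assumes "f \<in> Ar C" "f' \<in> Ar C" "g \<in> Ar C" "g' \<in> Ar C" "Dom C f' = Cod C f" "Dom C g' = Cod C g"
  shows "(f' \<cdot> f) \<boxplus> (g' \<cdot> g) = (f' \<boxplus> g') \<cdot> (f \<boxplus> g)"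
  using sum_bifunctor assms unfolding bifunctor_def by blast

lemma gam_simps [simp]:
  assumes "a \<in> Ob C" "b \<in> Ob C"
  shows "\<gamma> a b \<in> Ar C" "Dom C (\<gamma> a b) = a \<oplus> b" "Cod C (\<gamma> a b) = b \<oplus> a"
  using gam_in[OF assms] by (auto simp: hom_def)

declare Dom_in [simp] Cod_in [simp] null_in [simp]

end

lemma listset_iff: "xs \<in> listset As \<longleftrightarrow> list_all2 (\<in>) xs As"
  by (induction As arbitrary: xs) (auto simp: set_Cons_def list_all2_Cons2)

abbreviation obs :: "('o, 'm, 'z) cat_scheme list \<Rightarrow> 'o list set" where
  "obs Cs \<equiv> Ob (prod_cat Cs)"

abbreviation ars :: "('o, 'm, 'z) cat_scheme list \<Rightarrow> 'm list set" where
  "ars Cs \<equiv> Ar (prod_cat Cs)"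

lemma Ob_prod_cat: "xs \<in> obs Cs \<longleftrightarrow> list_all2 (\<lambda>x C. x \<in> Ob C) xs Cs"
  and Ar_prod_cat: "fs \<in> ars Cs \<longleftrightarrow> list_all2 (\<lambda>f C. f \<in> Ar C) fs Cs"
  by (simp_all add: prod_cat_def listset_iff list_all2_map2)

lemma prod_cat_simps:
  "Dom (prod_cat Cs) = map2 Dom Cs" "Cod (prod_cat Cs) = map2 Cod Cs"
  "ident (prod_cat Cs) = map2 ident Cs"
  "Comp (prod_cat Cs) gs fs = map2 (\<lambda>C (g, f). g \<cdot>\<^bsub>C\<^esub> f) Cs (zip gs fs)"
  by (simp_all add: prod_cat_def)

lemma length_tuple:
  "xs \<in> obs Cs \<Longrightarrow> length xs = length Cs"
  "fs \<in> ars Cs \<Longrightarrow> length fs = length Cs"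
  by (auto simp: Ob_prod_cat Ar_prod_cat list_all2_lengthD)

lemma tuple_nth:
  "\<lbrakk>xs \<in> obs Cs; i < length Cs\<rbrakk> \<Longrightarrow> xs ! i \<in> Ob (Cs ! i)"
  "\<lbrakk>fs \<in> ars Cs; i < length Cs\<rbrakk> \<Longrightarrow> fs ! i \<in> Ar (Cs ! i)"
  by (auto simp: Ob_prod_cat Ar_prod_cat list_all2_conv_all_nth)

lemma tuple_update:
  "\<lbrakk>xs \<in> obs Cs; x \<in> Ob (Cs ! i)\<rbrakk> \<Longrightarrow> xs[i := x] \<in> obs Cs"
  "\<lbrakk>fs \<in> ars Cs; f \<in> Ar (Cs ! i)\<rbrakk> \<Longrightarrow> fs[i := f] \<in> ars Cs"
  by (auto simp: Ob_prod_cat Ar_prod_cat intro: list_all2_update_cong[where ys = Cs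
    and y = "Cs ! i" and i = i, simplified])

lemma prod_cat_closed:
  assumes "\<And>C. C \<in> set Cs \<Longrightarrow> category C"
  shows "fs \<in> ars Cs \<Longrightarrow> Dom (prod_cat Cs) fs \<in> obs Cs"
    and "fs \<in> ars Cs \<Longrightarrow> Cod (prod_cat Cs) fs \<in> obs Cs"
    and "cs \<in> obs Cs \<Longrightarrow> ident (prod_cat Cs) cs \<in> ars Cs"
    and "\<lbrakk>fs \<in> ars Cs; gs \<in> ars Cs;
          Dom (prod_cat Cs) gs = Cod (prod_cat Cs) fs\<rbrakk>
        \<Longrightarrow> Comp (prod_cat Cs) gs fs \<in> ars Cs"
proof -
  have C: "category (Cs ! i)" if "i < length Cs" for i using assms that by simp
  show "fs \<in> ars Cs \<Longrightarrow> Dom (prod_cat Cs) fs \<in> obs Cs"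
    "fs \<in> ars Cs \<Longrightarrow> Cod (prod_cat Cs) fs \<in> obs Cs"
    "cs \<in> obs Cs \<Longrightarrow> ident (prod_cat Cs) cs \<in> ars Cs"
    by (auto simp: Ob_prod_cat Ar_prod_cat list_all2_conv_all_nth prod_cat_simps
        category.Dom_in category.Cod_in category.ident_simps C)
  assume *: "fs \<in> ars Cs" "gs \<in> ars Cs"
    "Dom (prod_cat Cs) gs = Cod (prod_cat Cs) fs"
  have len: "length fs = length Cs" "length gs = length Cs" using * by (simp_all add: length_tuple)
  have "Dom (Cs ! i) (gs ! i) = Cod (Cs ! i) (fs ! i)" if "i < length Cs" for i
    using arg_cong[OF *(3), of "\<lambda>xs. xs ! i"] that len by (simp add: prod_cat_simps)
  then show "Comp (prod_cat Cs) gs fs \<in> ars Cs"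
    using * by (auto simp: Ar_prod_cat list_all2_conv_all_nth prod_cat_simps
        category.Comp_simps C)
qed

lemma tuple_permute:
  assumes "\<sigma> permutes {..<length Cs}"
  shows "xs \<in> obs (permute_list \<sigma> Cs) \<Longrightarrow> permute_list (inv \<sigma>) xs \<in> obs Cs"
    and "fs \<in> ars (permute_list \<sigma> Cs) \<Longrightarrow> permute_list (inv \<sigma>) fs \<in> ars Cs"
proof -
  have *: "list_all2 P (permute_list (inv \<sigma>) xs) Cs"
    if "list_all2 P xs (permute_list \<sigma> Cs)" for P :: "'x \<Rightarrow> _ \<Rightarrow> bool" and xs
    using that list_all2_permute_list_iff[of "inv \<sigma>" xs P "permute_list \<sigma> Cs"] assms
    by (simp add: permute_list_cancel permutes_inv list_all2_lengthD)
  show "xs \<in> obs (permute_list \<sigma> Cs) \<Longrightarrow> permute_list (inv \<sigma>) xs \<in> obs Cs"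
    by (simp add: Ob_prod_cat *)
  show "fs \<in> ars (permute_list \<sigma> Cs) \<Longrightarrow> permute_list (inv \<sigma>) fs \<in> ars Cs"
    by (simp add: Ar_prod_cat *)
qed

lemma permute_map2:
  assumes "\<sigma> permutes {..<length xs}" "length ys = length xs"
  shows "permute_list \<sigma> (map2 h xs ys) = map2 h (permute_list \<sigma> xs) (permute_list \<sigma> ys)"
  using assms by (simp add: permute_list_map permute_list_zip)

lemma Ob_prod_Cons: "xs \<in> obs (C # Cs) \<longleftrightarrow> (\<exists>c cs. xs = c # cs \<and> c \<in> Ob C \<and> cs \<in> obs Cs)"
  and Ar_prod_Cons: "fs \<in> ars (C # Cs) \<longleftrightarrow> (\<exists>f gs. fs = f # gs \<and> f \<in> Ar C \<and> gs \<in> ars Cs)"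
  by (auto simp: Ob_prod_cat Ar_prod_cat list_all2_Cons2)

lemma prod_Nil [simp]: "xs \<in> obs [] \<longleftrightarrow> xs = []" "fs \<in> ars [] \<longleftrightarrow> fs = []"
  by (auto simp: Ob_prod_cat Ar_prod_cat)

lemma prod_Cons_simps [simp]:
  "c # cs \<in> obs (C # Cs) \<longleftrightarrow> c \<in> Ob C \<and> cs \<in> obs Cs"
  "f # fs \<in> ars (C # Cs) \<longleftrightarrow> f \<in> Ar C \<and> fs \<in> ars Cs"
  "Dom (prod_cat (C # Cs)) (f # fs) = Dom C f # Dom (prod_cat Cs) fs"
  "Cod (prod_cat (C # Cs)) (f # fs) = Cod C f # Cod (prod_cat Cs) fs"
  "ident (prod_cat (C # Cs)) (c # cs) = ident C c # ident (prod_cat Cs) cs"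
  "(g # gs) \<cdot>\<^bsub>prod_cat (C # Cs)\<^esub> (f # fs) = (g \<cdot>\<^bsub>C\<^esub> f) # (gs \<cdot>\<^bsub>prod_cat Cs\<^esub> fs)"
  by (simp_all add: Ob_prod_cat Ar_prod_cat prod_cat_simps)

lemma prod_append:
  "us \<in> obs Cs \<Longrightarrow> us @ vs \<in> obs (Cs @ Ds) \<longleftrightarrow> vs \<in> obs Ds"
  "fs \<in> ars Cs \<Longrightarrow> fs @ gs \<in> ars (Cs @ Ds) \<longleftrightarrow> gs \<in> ars Ds"
  by (auto simp: Ob_prod_cat Ar_prod_cat list_all2_append list_all2_lengthD)

lemma prod_appendE:
  "xs \<in> obs (Cs @ Ds) \<Longrightarrow> \<exists>us vs. xs = us @ vs \<and> us \<in> obs Cs \<and> vs \<in> obs Ds"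
  "fs \<in> ars (Cs @ Ds) \<Longrightarrow> \<exists>us vs. fs = us @ vs \<and> us \<in> ars Cs \<and> vs \<in> ars Ds"
  by (auto simp: Ob_prod_cat Ar_prod_cat list_all2_append2)

lemma prod_single:
  "xs \<in> obs [C] \<longleftrightarrow> (\<exists>c. xs = [c] \<and> c \<in> Ob C)"
  "fs \<in> ars [C] \<longleftrightarrow> (\<exists>f. fs = [f] \<and> f \<in> Ar C)"
  by (auto simp: Ob_prod_Cons Ar_prod_Cons)

lemma prod_Nil_simps [simp]:
  "Dom (prod_cat []) fs = []" "Cod (prod_cat []) fs = []" "ident (prod_cat []) xs = []"
  "gs \<cdot>\<^bsub>prod_cat []\<^esub> fs = []"
  by (simp_all add: prod_cat_simps)

lemma prod_cat_update:
  assumes "length fs = length Cs"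
  shows "Dom (prod_cat Cs) (fs[k := g]) = (Dom (prod_cat Cs) fs)[k := Dom (Cs ! k) g]"
    and "Cod (prod_cat Cs) (fs[k := g]) = (Cod (prod_cat Cs) fs)[k := Cod (Cs ! k) g]"
  using assms
  by (cases "k < length Cs";
      auto intro!: nth_equalityI simp: prod_cat_simps nth_list_update list_update_beyond)+

lemma prod_cat_ident:
  assumes "\<And>C. C \<in> set Cs \<Longrightarrow> category C" "cs \<in> obs Cs"
  shows "Dom (prod_cat Cs) (ident (prod_cat Cs) cs) = cs"
    and "Cod (prod_cat Cs) (ident (prod_cat Cs) cs) = cs"
    and "length (ident (prod_cat Cs) cs) = length Cs"
  using assms length_tuple(1)[OF assms(2)] tuple_nth(1)[OF assms(2)]
  by (auto intro!: nth_equalityI simp: prod_cat_simps category.ident_simps)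

section \<open>Multilinear maps and the action of permutations\<close>

text \<open>
  Two multilinear maps that agree on all arguments of the right type are equal only because their
  components are \<open>undefined\<close> on all other arguments.
\<close>

definition mlin_ext :: "('o, 'm) mlin \<Rightarrow> bool" where
  "mlin_ext f \<longleftrightarrow> mob f \<in> extensional (obs (msrc f))
     \<and> mar f \<in> extensional (ars (msrc f))
     \<and> (\<forall>i cs c'. \<not> (i < length (msrc f) \<and> cs \<in> obs (msrc f) \<and> c' \<in> Ob (msrc f ! i))
          \<longrightarrow> mdel f i cs c' = undefined)"

lemma mlin_eqI:
  assumes "mlin_ext f" "mlin_ext g" and s: "msrc f = msrc g" and "mtgt f = mtgt g"
    and o: "\<And>cs. cs \<in> obs (msrc g) \<Longrightarrow> mob f cs = mob g cs"
    and a: "\<And>fs. fs \<in> ars (msrc g) \<Longrightarrow> mar f fs = mar g fs"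
    and d: "\<And>i cs c'. \<lbrakk>i < length (msrc g); cs \<in> obs (msrc g); c' \<in> Ob (msrc g ! i)\<rbrakk>
          \<Longrightarrow> mdel f i cs c' = mdel g i cs c'"
  shows "f = g"
proof -
  have "mob f = mob g" "mar f = mar g"
    using assms by (auto simp: mlin_ext_def intro: extensionalityI)
  moreover have "mdel f = mdel g"
  proof (intro ext)
    show "mdel f i cs c' = mdel g i cs c'" for i cs c'
      using d assms(1-3) unfolding mlin_ext_def by metis
  qed
  ultimately show ?thesis using assms(3,4) by simp
qed

lemma (in multilinear) mlin_ext: "mlin_ext f"
  using mob_ext mar_ext mdel_ext by (simp add: mlin_ext_def msrc_eq)

lemma mlin_ext_act [simp]: "mlin_ext (mlin_act \<sigma> f)"
  by (simp add: mlin_ext_def mlin_act_def Let_def)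

lemma mlin_ext_Gam [simp]: "mlin_ext (mlin_Gam g fs)"
  by (simp add: mlin_ext_def mlin_Gam_def Let_def)

lemma mlin_act_simps [simp]:
  "msrc (mlin_act \<sigma> f) = permute_list \<sigma> (msrc f)" "mtgt (mlin_act \<sigma> f) = mtgt f"
  by (simp_all add: mlin_act_def Let_def)

lemma mlin_act_apply:
  "xs \<in> obs (permute_list \<sigma> (msrc f))
    \<Longrightarrow> mob (mlin_act \<sigma> f) xs = mob f (permute_list (inv \<sigma>) xs)"
  "fs \<in> ars (permute_list \<sigma> (msrc f))
    \<Longrightarrow> mar (mlin_act \<sigma> f) fs = mar f (permute_list (inv \<sigma>) fs)"
  "\<lbrakk>i < length (msrc f); xs \<in> obs (permute_list \<sigma> (msrc f));
    x' \<in> Ob (permute_list \<sigma> (msrc f) ! i)\<rbrakk>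
    \<Longrightarrow> mdel (mlin_act \<sigma> f) i xs x' = mdel f (\<sigma> i) (permute_list (inv \<sigma>) xs) x'"
  by (simp_all add: mlin_act_def Let_def)

lemma mlin_act_id: "mlin_ext f \<Longrightarrow> mlin_act id f = f"
  by (rule mlin_eqI) (auto simp: mlin_act_apply)

lemma mlin_act_act:
  assumes "\<sigma> permutes {..<length (msrc f)}" "\<tau> permutes {..<length (msrc f)}"
  shows "mlin_act \<tau> (mlin_act \<sigma> f) = mlin_act (\<sigma> \<circ> \<tau>) f"
proof (rule mlin_eqI)
  note perm = permutes_compose[OF assms(2,1)]
  have src: "permute_list (\<sigma> \<circ> \<tau>) (msrc f) = permute_list \<tau> (permute_list \<sigma> (msrc f))"
    using assms by (simp add: permute_list_compose)
  then show "msrc (mlin_act \<tau> (mlin_act \<sigma> f)) = msrc (mlin_act (\<sigma> \<circ> \<tau>) f)" by simp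
  have inv: "permute_list (inv (\<sigma> \<circ> \<tau>)) xs = permute_list (inv \<sigma>) (permute_list (inv \<tau>) xs)"
    if "length xs = length (msrc f)" for xs :: "'x list"
    using that assms
    by (simp add: o_inv_distrib permutes_bij permute_list_compose permutes_inv)
  have \<tau>: "\<tau> permutes {..<length (permute_list \<sigma> (msrc f))}" using assms by simp
  show "mob (mlin_act \<tau> (mlin_act \<sigma> f)) cs = mob (mlin_act (\<sigma> \<circ> \<tau>) f) cs"
    if "cs \<in> obs (msrc (mlin_act (\<sigma> \<circ> \<tau>) f))" for cs
    using that tuple_permute(1)[OF \<tau>, of cs] length_tuple(1)[OF that]
    by (simp add: mlin_act_apply inv src)
  show "mar (mlin_act \<tau> (mlin_act \<sigma> f)) cs = mar (mlin_act (\<sigma> \<circ> \<tau>) f) cs"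
    if "cs \<in> ars (msrc (mlin_act (\<sigma> \<circ> \<tau>) f))" for cs
    using that tuple_permute(2)[OF \<tau>, of cs] length_tuple(2)[OF that]
    by (simp add: mlin_act_apply inv src)
  show "mdel (mlin_act \<tau> (mlin_act \<sigma> f)) i cs c' = mdel (mlin_act (\<sigma> \<circ> \<tau>) f) i cs c'"
    if "i < length (msrc (mlin_act (\<sigma> \<circ> \<tau>) f))" "cs \<in> obs (msrc (mlin_act (\<sigma> \<circ> \<tau>) f))"
      "c' \<in> Ob (msrc (mlin_act (\<sigma> \<circ> \<tau>) f) ! i)" for i cs c'
    using that tuple_permute(1)[OF \<tau>, of cs] length_tuple(1)[OF that(2)] \<tau>
      inv_permutes_lt(1)[OF assms(2), of i]
    by (simp add: mlin_act_apply inv src nth_permute_inv(3))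
qed simp_all

text \<open>
  Each axiom for $\sigma^* f$ in the variable \<open>i\<close> is the same axiom for \<open>f\<close> in the variable \<open>\<sigma> i\<close>.
\<close>

lemma multilinear_mlin_act:
  fixes D :: "('o, 'm) pcat" (structure)
  assumes "multilinear Cs D f" and \<sigma>: "\<sigma> permutes {..<length Cs}"
  shows "multilinear (permute_list \<sigma> Cs) D (mlin_act \<sigma> f)"
proof -
  interpret f: multilinear Cs D f by fact
  let ?f = "mlin_act \<sigma> f" and ?Cs = "permute_list \<sigma> Cs" and ?p = "\<lambda>xs. permute_list (inv \<sigma>) xs"
  have src: "msrc f = Cs" by (rule f.msrc_eq)
  have i: "\<sigma> i < length Cs" "?Cs ! i = Cs ! \<sigma> i" if "i < length Cs" for i
    using that inv_permutes_lt(1)[OF \<sigma>] nth_permute_inv(3)[OF \<sigma>] by auto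
  have obj: "?p xs \<in> obs Cs" "length xs = length Cs"
    "i < length Cs \<Longrightarrow> ?p xs ! \<sigma> i = xs ! i"
    "i < length Cs \<Longrightarrow> ?p (xs[i := x]) = (?p xs)[\<sigma> i := x]"
    "x \<in> Ob (Cs ! \<sigma> i) \<Longrightarrow> i < length Cs \<Longrightarrow> xs[i := x] \<in> obs ?Cs"
    "i < length Cs \<Longrightarrow> xs ! i \<in> Ob (Cs ! \<sigma> i)"
    if "xs \<in> obs ?Cs" for xs i x
    using that tuple_permute(1)[OF \<sigma>, of xs] length_tuple(1)[OF that] \<sigma> tuple_nth(1)[OF that, of i]
    by (auto simp: nth_permute_inv permute_list_inv_update i tuple_update permutes_inverses[OF \<sigma>])
  have arr: "?p xs \<in> ars Cs" "length xs = length Cs"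
    "i < length Cs \<Longrightarrow> ?p xs ! \<sigma> i = xs ! i"
    "i < length Cs \<Longrightarrow> ?p (xs[i := x]) = (?p xs)[\<sigma> i := x]"
    "x \<in> Ar (Cs ! \<sigma> i) \<Longrightarrow> i < length Cs \<Longrightarrow> xs[i := x] \<in> ars ?Cs"
    "i < length Cs \<Longrightarrow> xs ! i \<in> Ar (Cs ! \<sigma> i)"
    if "xs \<in> ars ?Cs" for xs i x
    using that tuple_permute(2)[OF \<sigma>, of xs] length_tuple(2)[OF that] \<sigma> tuple_nth(2)[OF that, of i]
    by (auto simp: nth_permute_inv permute_list_inv_update i tuple_update permutes_inverses[OF \<sigma>])
  have m2: "?p (map2 h ?Cs xs) = map2 h Cs (?p xs)" if "length xs = length Cs" for h and xs :: "'x list"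
    using that \<sigma> permutes_inv[OF \<sigma>] by (simp add: permute_map2 permute_list_cancel)
  have Cs: "\<And>C. C \<in> set Cs \<Longrightarrow> category C" "\<And>C. C \<in> set ?Cs \<Longrightarrow> category C"
    using f.src_permutative \<sigma> by (auto intro: permutative.axioms(1))
  note closed = prod_cat_closed[OF Cs(1)] prod_cat_closed[OF Cs(2)]
  have perm_simps:
    "?p (Dom (prod_cat ?Cs) fs) = Dom (prod_cat Cs) (?p fs)"
    "?p (Cod (prod_cat ?Cs) fs) = Cod (prod_cat Cs) (?p fs)"
    "length gs = length Cs \<Longrightarrow>
      ?p (Comp (prod_cat ?Cs) gs fs) = Comp (prod_cat Cs) (?p gs) (?p fs)"
    if "length fs = length Cs" for fs gs
    using that permutes_inv[OF \<sigma>] permute_list_zip[OF permutes_inv[OF \<sigma>], of gs fs]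
    by (simp_all add: prod_cat_simps m2)
  have perm_ident: "?p (ident (prod_cat ?Cs) xs) = ident (prod_cat Cs) (?p xs)"
    if "length xs = length Cs" for xs
    using that by (simp add: prod_cat_simps m2)
  note S = mlin_act_apply src obj arr closed perm_simps perm_ident i
  show ?thesis
  proof (rule multilinear.intro)
    show "preserves_cat (prod_cat ?Cs) D (mob ?f) (mar ?f)"
      unfolding preserves_cat_def
    proof (intro conjI ballI impI)
      fix fs gs assume *: "fs \<in> ars ?Cs" "gs \<in> ars ?Cs"
        and dc: "Dom (prod_cat ?Cs) gs = Cod (prod_cat ?Cs) fs"
      have "Dom (prod_cat Cs) (?p gs) = Cod (prod_cat Cs) (?p fs)"
        using arg_cong[OF dc, of ?p] arr(2)[OF *(1)] arr(2)[OF *(2)] by (simp add: perm_simps)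
      then show "mar ?f (gs \<cdot>\<^bsub>prod_cat ?Cs\<^esub> fs)
          = mar ?f gs \<cdot> mar ?f fs"
        using f.functorial * dc by (simp add: S preserves_cat_def)
    qed (use f.functorial in \<open>simp_all add: S preserves_cat_def\<close>)
  next
    fix xs i assume "xs \<in> obs ?Cs" "i < length ?Cs"
    then have xs: "xs \<in> obs ?Cs" and il: "i < length Cs" by auto
    note S = S xs il
    show "mob ?f xs = \<zero>" if "xs ! i = \<zero>\<^bsub>?Cs ! i\<^esub>"
      using that f.mob_null[of "?p xs" "\<sigma> i"] by (simp add: S)
    fix c' assume "c' \<in> Ob (?Cs ! i)"
    then have c': "c' \<in> Ob (Cs ! \<sigma> i)" using i il by simp
    have p: "permutative (Cs ! \<sigma> i)" using i(1)[OF il] f.src_permutative by simp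
    note S = S c' permutative.sum_ob_in[OF p] permutative.gam_simps[OF p]
      category.ident_simps[OF permutative.axioms(1)[OF p]]
    show "mdel ?f i xs c' \<in> hom D (mob ?f xs \<oplus> mob ?f (xs[i := c']))
         (mob ?f (xs[i := xs ! i \<oplus>\<^bsub>?Cs ! i\<^esub> c']))"
      using f.mdel_in[of "?p xs" "\<sigma> i" c'] by (simp add: S)
    show "mdel ?f i xs c' = ident D (mob ?f (xs[i := xs ! i \<oplus>\<^bsub>?Cs ! i\<^esub> c']))"
      if "c' = \<zero>\<^bsub>?Cs ! i\<^esub> \<or> (\<exists>j<length ?Cs. xs ! j = \<zero>\<^bsub>?Cs ! j\<^esub>)"
    proof -
      have "c' = \<zero>\<^bsub>Cs ! \<sigma> i\<^esub> \<or> (\<exists>j<length Cs. ?p xs ! j = \<zero>\<^bsub>Cs ! j\<^esub>)"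
        using that i xs il obj(3)[OF xs] by (metis length_permute_list)
      then show ?thesis
        using f.mdel_null[of "?p xs" "\<sigma> i" c'] by (simp add: S)
    qed
    show "mar ?f ((ident (prod_cat ?Cs) xs)[i := \<gamma>\<^bsub>?Cs ! i\<^esub> (xs ! i) c']) \<cdot> mdel ?f i xs c'
        = mdel ?f i (xs[i := c']) (xs ! i) \<cdot> \<gamma> (mob ?f xs) (mob ?f (xs[i := c']))"
      using f.mdel_gam[of "?p xs" "\<sigma> i" c'] by (simp add: S)
    fix c'' assume "c'' \<in> Ob (?Cs ! i)"
    then have c'': "c'' \<in> Ob (Cs ! \<sigma> i)" using i il by simp
    show "mdel ?f i (xs[i := xs ! i \<oplus>\<^bsub>?Cs ! i\<^esub> c']) c''
          \<cdot> (mdel ?f i xs c' \<boxplus> ident D (mob ?f (xs[i := c''])))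
          = mdel ?f i xs (c' \<oplus>\<^bsub>?Cs ! i\<^esub> c'')
          \<cdot> (ident D (mob ?f xs) \<boxplus> mdel ?f i (xs[i := c']) c'')"
      using f.mdel_assoc[of "?p xs" "\<sigma> i" c' c''] by (simp add: S c'')
  next
    fix fs i assume "fs \<in> ars ?Cs" "i < length ?Cs"
    then have fs: "fs \<in> ars ?Cs" and il: "i < length Cs" by auto
    note S = S fs il
    have p: "permutative (Cs ! \<sigma> i)" using i(1)[OF il] f.src_permutative by simp
    show "mar ?f fs = ident D \<zero>" if "fs ! i = ident (?Cs ! i) \<zero>\<^bsub>?Cs ! i\<^esub>"
      using that f.mar_null[of "?p fs" "\<sigma> i"] by (simp add: S)
    fix f' assume "f' \<in> Ar (?Cs ! i)"
    then have f': "f' \<in> Ar (Cs ! \<sigma> i)" using i il by simp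
    show "mar ?f (fs[i := fs ! i \<boxplus>\<^bsub>?Cs ! i\<^esub> f'])
          \<cdot> mdel ?f i (Dom (prod_cat ?Cs) fs) (Dom (?Cs ! i) f')
          = mdel ?f i (Cod (prod_cat ?Cs) fs) (Cod (?Cs ! i) f')
          \<cdot> (mar ?f fs \<boxplus> mar ?f (fs[i := f']))"
      using f.mdel_natural[of "?p fs" "\<sigma> i" f']
      by (simp add: S f' permutative.sum_ar_simps[OF p] category.Dom_in category.Cod_in
        permutative.axioms(1)[OF p])
  next
    fix xs i j ci' cj' assume "xs \<in> obs ?Cs" "i < length ?Cs" "j < length ?Cs" "i \<noteq> j"
      "ci' \<in> Ob (?Cs ! i)" "cj' \<in> Ob (?Cs ! j)"
    then have *: "xs \<in> obs ?Cs" "i < length Cs" "j < length Cs"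
       "i \<noteq> j" "j \<noteq> i" "ci' \<in> Ob (Cs ! \<sigma> i)" "cj' \<in> Ob (Cs ! \<sigma> j)" using i by auto
    have p: "permutative (Cs ! \<sigma> i)" "permutative (Cs ! \<sigma> j)"
      using i(1) * f.src_permutative by auto
    have ne: "\<sigma> i \<noteq> \<sigma> j" "\<sigma> j \<noteq> \<sigma> i" using *(4) \<sigma> by (metis permutes_inverses(2))+
    show "mdel ?f j (xs[i := xs ! i \<oplus>\<^bsub>?Cs ! i\<^esub> ci']) cj'
          \<cdot> (mdel ?f i xs ci' \<boxplus> mdel ?f i (xs[j := cj']) ci')
          = mdel ?f i (xs[j := xs ! j \<oplus>\<^bsub>?Cs ! j\<^esub> cj']) ci'
          \<cdot> (mdel ?f j xs cj' \<boxplus> mdel ?f j (xs[i := ci']) cj')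
          \<cdot> (ident D (mob ?f xs)
          \<boxplus> \<gamma> (mob ?f (xs[i := ci'])) (mob ?f (xs[j := cj']))
          \<boxplus> ident D (mob ?f (xs[i := ci', j := cj'])))"
      using f.mdel_mdel[of "?p xs" "\<sigma> i" "\<sigma> j" ci' cj'] ne
      by (simp add: S * p[THEN permutative.sum_ob_in] del: permutes_inverses)
  next
    show "mdel ?f i cs c' = undefined"
      if "\<not> (i < length ?Cs \<and> cs \<in> obs ?Cs \<and> c' \<in> Ob (?Cs ! i))" for i cs c'
      using that by (auto simp: mlin_act_def Let_def src)
  qed (use \<sigma> in \<open>simp_all add: f.src_permutative f.tgt_permutative src f.mtgt_eq mlin_act_def Let_def\<close>)
qed

section \<open>The multiproduct of multilinear maps\<close>

context multilinear
begin

lemma mob_in: "cs \<in> obs Cs \<Longrightarrow> mob f cs \<in> Ob D"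
  and mar_in: "fs \<in> ars Cs \<Longrightarrow> mar f fs \<in> Ar D"
  and mar_Dom: "fs \<in> ars Cs \<Longrightarrow> Dom D (mar f fs) = mob f (Dom (prod_cat Cs) fs)"
  and mar_Cod: "fs \<in> ars Cs \<Longrightarrow> Cod D (mar f fs) = mob f (Cod (prod_cat Cs) fs)"
  and mar_ident: "cs \<in> obs Cs \<Longrightarrow> mar f (ident (prod_cat Cs) cs) = ident D (mob f cs)"
  and mar_Comp: "\<lbrakk>fs \<in> ars Cs; gs \<in> ars Cs;
         Dom (prod_cat Cs) gs = Cod (prod_cat Cs) fs\<rbrakk>
       \<Longrightarrow> mar f (gs \<cdot>\<^bsub>prod_cat Cs\<^esub> fs) = mar f gs \<cdot>\<^bsub>D\<^esub> mar f fs"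
  using functorial by (simp_all add: preserves_cat_def hom_def)

lemma mdel_simps:
  assumes "cs \<in> obs Cs" "i < length Cs" "c' \<in> Ob (Cs ! i)"
  shows "mdel f i cs c' \<in> Ar D"
    and "Dom D (mdel f i cs c') = mob f cs \<oplus>\<^bsub>D\<^esub> mob f (cs[i := c'])"
    and "Cod D (mdel f i cs c') = mob f (cs[i := cs ! i \<oplus>\<^bsub>Cs ! i\<^esub> c'])"
  using mdel_in[OF assms] by (auto simp: hom_def)

end

lemma tuple_blocks:
  "xs \<in> obs (concat Css)
    \<Longrightarrow> list_all2 (\<lambda>b Cs. b \<in> obs Cs) (blocks (map length Css) xs) Css"
  "fs \<in> ars (concat Css)
    \<Longrightarrow> list_all2 (\<lambda>b Cs. b \<in> ars Cs) (blocks (map length Css) fs) Css"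
proof (induction Css arbitrary: xs fs)
  case (Cons Cs Css)
  { case 1
    then obtain ys zs where "xs = ys @ zs" "ys \<in> obs Cs" "zs \<in> obs (concat Css)"
      by (auto simp: Ob_prod_cat list_all2_append2)
    then show ?case using Cons.IH(1)[of zs] by (simp add: length_tuple) }
  { case 2
    then obtain ys zs where "fs = ys @ zs" "ys \<in> ars Cs" "zs \<in> ars (concat Css)"
      by (auto simp: Ar_prod_cat list_all2_append2)
    then show ?case using Cons.IH(2)[of zs] by (simp add: length_tuple) }
qed simp_all

lemma mlin_Gam_simps [simp]:
  "msrc (mlin_Gam g fs) = concat (map msrc fs)" "mtgt (mlin_Gam g fs) = mtgt g"
  by (simp_all add: mlin_Gam_def Let_def)

lemma mlin_Gam_apply:
  "xs \<in> obs (concat (map msrc fs)) \<Longrightarrow>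
    mob (mlin_Gam g fs) xs = mob g (map2 mob fs (blocks (map (length \<circ> msrc) fs) xs))"
  "as \<in> ars (concat (map msrc fs)) \<Longrightarrow>
    mar (mlin_Gam g fs) as = mar g (map2 mar fs (blocks (map (length \<circ> msrc) fs) as))"
  by (simp_all add: mlin_Gam_def Let_def)

lemma nth_concat_src:
  assumes "p < length fs" "q < length (msrc (fs ! p))"
  shows "concat (map msrc fs) ! (block_start (map (length \<circ> msrc) fs) p + q) = msrc (fs ! p) ! q"
    and "block_start (map (length \<circ> msrc) fs) p + q < length (concat (map msrc fs))"
  using assms nth_concat_block[of p "map msrc fs" q] block_of_start(2)[of p "map (length \<circ> msrc) fs" q]
  by (simp_all add: length_concat)

text \<open>
  The formula of the definition with the variable given by its coordinates: it is variable \<open>q\<close> of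
  the \<open>p\<close>-th inner map.
\<close>

lemma mlin_Gam_mdel:
  assumes "p < length fs" "q < length (msrc (fs ! p))" "xs \<in> obs (concat (map msrc fs))"
    "x' \<in> Ob (msrc (fs ! p) ! q)" and bs: "bs = blocks (map (length \<circ> msrc) fs) xs"
    and n: "n = block_start (map (length \<circ> msrc) fs) p + q"
  shows "mdel (mlin_Gam g fs) n xs x'
     = mar g ((ident (prod_cat (msrc g)) (map2 mob fs bs))[p := mdel (fs ! p) q (bs ! p) x'])
       \<cdot>\<^bsub>mtgt g\<^esub> mdel g p (map2 mob fs bs) (mob (fs ! p) ((bs ! p)[q := x']))"
  using assms block_of_start(1)[of p "map (length \<circ> msrc) fs" q] nth_concat_src[OF assms(1,2)]
  by (simp add: mlin_Gam_def Let_def)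

lemma blocks_Gamma_perm:
  assumes "length xs = sum_list js" "\<sigma> permutes {..<length js}" "length \<phi>s = length js"
    and "\<And>p. p < length js \<Longrightarrow> (\<phi>s ! p) permutes {..<js ! p}"
  shows "blocks (permute_list (inv \<sigma>) js) (permute_list (inv (Gamma_perm \<sigma> js \<phi>s)) xs)
       = permute_list (inv \<sigma>) (permute_blocks \<phi>s (blocks js xs))"
proof -
  let ?bs = "blocks js xs" and ?L = "permute_blocks \<phi>s (blocks js xs)"
  have js: "map length ?bs = js" and xs: "concat ?bs = xs"
    using assms(1) by (simp_all add: map_length_blocks concat_blocks)
  have L: "length (?bs ! p) = js ! p" if "p < length js" for p
    using that js by (metis length_blocks nth_map)
  have "map length ?L = js" using assms(3) L by (auto intro!: nth_equalityI)
  then have "permute_list (inv \<sigma>) js = map length (permute_list (inv \<sigma>) ?L)"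
    using assms(2,3) by (simp add: permute_list_map[symmetric] permutes_inv)
  moreover have "permute_list (inv (Gamma_perm \<sigma> js \<phi>s)) xs = concat (permute_list (inv \<sigma>) ?L)"
    using permute_list_Gamma_perm[of \<sigma> ?bs \<phi>s] assms(2-4) L unfolding js xs by simp
  ultimately show ?thesis using blocks_concat by simp
qed

text \<open>
  Equivariance of the multiproduct, in the form that moves all permutations to the outside. The
  \<open>p\<close>-th inner map feeds variable \<open>\<sigma> p\<close> of \<open>g\<close>, so without the permutations the inner maps have to
  be listed in the order \<open>permute_list (inv \<sigma>) fs\<close>. After \<open>blocks_Gamma_perm\<close> both sides apply the
  same maps to the same blocks.
\<close>

lemma mlin_Gam_act:
  assumes \<sigma>: "\<sigma> permutes {..<length (msrc g)}" and len: "length fs = length (msrc g)"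
    and \<phi>len: "length \<phi>s = length fs"
    and \<phi>: "\<And>p. p < length fs \<Longrightarrow> (\<phi>s ! p) permutes {..<length (msrc (fs ! p))}"
    and ml: "\<And>p. p < length fs \<Longrightarrow> multilinear (msrc (fs ! p)) (msrc g ! \<sigma> p) (fs ! p)"
    and g: "multilinear (msrc g) (mtgt g) g"
  shows "mlin_Gam (mlin_act \<sigma> g) (map2 mlin_act \<phi>s fs)
       = mlin_act (Gamma_perm \<sigma> (map (length \<circ> msrc) fs) \<phi>s) (mlin_Gam g (permute_list (inv \<sigma>) fs))"
    (is "mlin_Gam _ ?fs = mlin_act ?\<rho> (mlin_Gam g ?hs)")
proof -
  define js where "js = map (length \<circ> msrc) fs"
  define \<rho> where "\<rho> = Gamma_perm \<sigma> js \<phi>s"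
  define Css where "Css = map msrc ?fs"
  have js_len: "length js = length fs" "\<And>p. p < length fs \<Longrightarrow> js ! p = length (msrc (fs ! p))"
    by (simp_all add: js_def)
  have \<sigma>f: "\<sigma> permutes {..<length fs}" using \<sigma> len by simp
  note \<sigma>i = permutes_inv[OF \<sigma>f]
  have Css: "length Css = length fs" "Css ! p = permute_list (\<phi>s ! p) (msrc (fs ! p))"
    if "p < length fs" for p
    using that \<phi>len by (simp_all add: Css_def)
  have lenCss: "length Css = length fs" using \<phi>len by (simp add: Css_def)
  have jsC: "map length Css = js" and jsF: "map (length \<circ> msrc) ?fs = js"
    using \<phi>len by (auto intro!: nth_equalityI simp: Css_def js_def)
  have jsH: "map (length \<circ> msrc) ?hs = permute_list (inv \<sigma>) js"
    unfolding js_def using \<sigma>i by (simp add: permute_list_map)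
  have \<rho>: "\<rho> permutes {..<sum_list js}"
    unfolding \<rho>_def
    by (rule Gamma_perm_permutes) (use \<sigma>f \<phi>len \<phi> js_len in auto)
  have lenC: "length (concat Css) = sum_list js" by (simp add: length_concat jsC)
  have lenH: "length (concat (map msrc ?hs)) = sum_list js"
    using sum_list_permute[of \<sigma> js] \<sigma>f by (simp add: length_concat jsH js_len)
  have hs: "?hs ! \<sigma> p = fs ! p" if "p < length fs" for p
    using that nth_permute_inv(2)[OF \<sigma>f] by simp
  have "permute_list (inv \<rho>) (concat Css)
      = concat (permute_list (inv \<sigma>) (permute_blocks \<phi>s Css))"
    unfolding \<rho>_def jsC[symmetric]
    by (rule permute_list_Gamma_perm) (use \<sigma>f \<phi>len \<phi> Css lenCss in auto)
  also have "permute_blocks \<phi>s Css = map msrc fs"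
    by (rule nth_equalityI) (use \<phi>len \<phi> Css lenCss in \<open>auto simp: permute_list_cancel\<close>)
  also have "concat (permute_list (inv \<sigma>) (map msrc fs)) = concat (map msrc ?hs)"
    using \<sigma>i by (simp add: permute_list_map)
  finally have "permute_list \<rho> (concat (map msrc ?hs)) = permute_list \<rho> (permute_list (inv \<rho>) (concat Css))"
    by simp
  then have src: "permute_list \<rho> (concat (map msrc ?hs)) = concat Css"
    using \<rho> lenC by (simp add: permute_list_cancel)
  \<comment> \<open>The blocks of a permuted tuple have the right types, and the inner maps on the left take on the
    blocks of \<open>xs\<close> the values that the maps \<open>fs\<close> take on the permuted blocks.\<close>
  have mlf: "multilinear (Css ! p) (permute_list \<sigma> (msrc g) ! p) (?fs ! p)" if "p < length fs" for p
    using multilinear_mlin_act[OF ml[OF that] \<phi>[OF that]] that len \<phi>len \<sigma>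
    by (simp add: Css nth_permute_inv(3))
  have perm_ob: "permute_list (inv \<rho>) xs \<in> obs (concat (map msrc ?hs))"
    if "xs \<in> obs (concat Css)" for xs
    using tuple_permute(1)[of \<rho> "concat (map msrc ?hs)" xs] \<rho> lenH that src by simp
  have perm_ar: "permute_list (inv \<rho>) xs \<in> ars (concat (map msrc ?hs))"
    if "xs \<in> ars (concat Css)" for xs
    using tuple_permute(2)[of \<rho> "concat (map msrc ?hs)" xs] \<rho> lenH that src by simp
  have blocks_perm: "blocks (permute_list (inv \<sigma>) js) (permute_list (inv \<rho>) xs)
      = permute_list (inv \<sigma>) (permute_blocks \<phi>s (blocks js xs))"
    if "length xs = sum_list js" for xs :: "'x list"
    unfolding \<rho>_def by (rule blocks_Gamma_perm) (use that \<sigma>f \<phi>len \<phi> js_len in auto)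
  have map_perm: "map2 h ?hs (permute_list (inv \<sigma>) (permute_blocks \<phi>s bs))
      = permute_list (inv \<sigma>) (map2 h fs (permute_blocks \<phi>s bs))"
    if "length bs = length fs" for h :: "_ \<Rightarrow> 'x list \<Rightarrow> 'y" and bs
    by (rule permute_map2[symmetric]) (use that \<sigma>i \<phi>len in auto)
  have bl_ob: "blocks js xs ! p \<in> obs (Css ! p)"
    if "xs \<in> obs (concat Css)" "p < length fs" for xs p
    using tuple_blocks(1)[OF that(1)] that(2) lenCss by (auto simp: jsC list_all2_conv_all_nth)
  have bl_ar: "blocks js xs ! p \<in> ars (Css ! p)"
    if "xs \<in> ars (concat Css)" "p < length fs" for xs p
    using tuple_blocks(2)[OF that(1)] that(2) lenCss by (auto simp: jsC list_all2_conv_all_nth)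
  have val_ob: "map2 mob fs (permute_blocks \<phi>s (blocks js xs)) = map2 mob ?fs (blocks js xs)"
    and ys: "map2 mob ?fs (blocks js xs) \<in> obs (permute_list \<sigma> (msrc g))"
    if "xs \<in> obs (concat Css)" for xs
    using bl_ob[OF that] \<phi>len js_len(1) len multilinear.mob_in[OF mlf]
    by (auto intro!: nth_equalityI simp: mlin_act_apply Css Ob_prod_cat[of _
      "permute_list \<sigma> (msrc g)"] list_all2_conv_all_nth)
  have val_ar: "map2 mar fs (permute_blocks \<phi>s (blocks js xs)) = map2 mar ?fs (blocks js xs)"
    and ysr: "map2 mar ?fs (blocks js xs) \<in> ars (permute_list \<sigma> (msrc g))"
    if "xs \<in> ars (concat Css)" for xs
    using bl_ar[OF that] \<phi>len js_len(1) len multilinear.mar_in[OF mlf]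
    by (auto intro!: nth_equalityI simp: mlin_act_apply Css Ar_prod_cat[of _
      "permute_list \<sigma> (msrc g)"] list_all2_conv_all_nth)
  have Gob: "mob (mlin_Gam h ?fs) xs = mob h (map2 mob ?fs (blocks js xs))"
    if "xs \<in> obs (concat Css)" for h xs
    using mlin_Gam_apply(1)[OF that[unfolded Css_def], of h, unfolded jsF] .
  have Gar: "mar (mlin_Gam h ?fs) xs = mar h (map2 mar ?fs (blocks js xs))"
    if "xs \<in> ars (concat Css)" for h xs
    using mlin_Gam_apply(2)[OF that[unfolded Css_def], of h, unfolded jsF] .
  let ?lhs = "mlin_Gam (mlin_act \<sigma> g) ?fs" and ?rhs = "mlin_act \<rho> (mlin_Gam g ?hs)"
  show ?thesis
    unfolding js_def[symmetric] \<rho>_def[symmetric]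
  proof (rule mlin_eqI)
    show srcs: "msrc ?lhs = msrc ?rhs"
      using src by (simp add: Css_def)
    note src' = src[symmetric, unfolded Css_def]
    show "mob ?lhs xs = mob ?rhs xs"
      if "xs \<in> obs (msrc ?rhs)" for xs
    proof -
      have xs: "xs \<in> obs (concat Css)" using that src by simp
      then have lx: "length xs = sum_list js" using length_tuple(1) lenC by metis
      show ?thesis
        using that xs perm_ob[OF xs] ys[OF xs] blocks_perm[OF lx] src
        by (simp add: Gob Gar mlin_Gam_apply mlin_act_apply jsH jsF Css_def[symmetric] map_perm
          val_ob js_len)
    qed
    show "mar ?lhs xs = mar ?rhs xs"
      if "xs \<in> ars (msrc ?rhs)" for xs
    proof -
      have xs: "xs \<in> ars (concat Css)" using that src by simp
      then have lx: "length xs = sum_list js" using length_tuple(2) lenC by metis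
      show ?thesis
        using that xs perm_ar[OF xs] ysr[OF xs] blocks_perm[OF lx] src
        by (simp add: Gob Gar mlin_Gam_apply mlin_act_apply jsH jsF Css_def[symmetric] map_perm
          val_ar js_len)
    qed
    show "mdel ?lhs n xs x' = mdel ?rhs n xs x'"
      if "n < length (msrc ?rhs)"
         "xs \<in> obs (msrc ?rhs)"
         "x' \<in> Ob (msrc ?rhs ! n)" for n xs x'
    proof -
      have xs: "xs \<in> obs (concat Css)" using that src by simp
      then have lx: "length xs = sum_list js" using length_tuple(1) lenC by metis
      have "n < sum_list js" using that(1) lenH by simp
      then obtain p q where p: "p < length js" "q < js ! p" and n: "n = block_start js p + q"
        by (rule block_position)
      have pf: "p < length fs" "q < length (msrc (fs ! p))" using p by (auto simp: js_len)
      have q: "q < length (msrc (?fs ! p))" using pf \<phi>len by simp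
      define bs where "bs = blocks js xs"
      define ws where "ws = permute_list (inv \<sigma>) (permute_blocks \<phi>s bs)"
      \<comment> \<open>Variable \<open>n = (p, q)\<close> on the left is variable \<open>\<rho> n = (\<sigma> p, (\<phi>s ! p) q)\<close> on the right;
        there the block \<open>bs ! p\<close> has become \<open>ws ! \<sigma> p\<close>.\<close>
      have x': "x' \<in> Ob (msrc (?fs ! p) ! q)"
        using that(3) nth_concat_src(1)[of p ?fs q] pf q \<phi>len src jsF n by (simp add: Css_def)
      have x'f: "x' \<in> Ob (msrc (fs ! p) ! (\<phi>s ! p) q)"
        using x' pf \<phi>len \<phi>[OF pf(1)] by (simp add: nth_permute_inv)
      have \<phi>q: "(\<phi>s ! p) q < length (msrc (fs ! p))" using inv_permutes_lt(1)[OF \<phi>[OF pf(1)] pf(2)] .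
      have \<sigma>p: "\<sigma> p < length fs" using inv_permutes_lt(1)[OF \<sigma>f pf(1)] .
      have \<rho>n: "\<rho> n = block_start (permute_list (inv \<sigma>) js) (\<sigma> p) + (\<phi>s ! p) q"
        unfolding n \<rho>_def using Gamma_perm_block[of \<phi>s js p q \<sigma>] \<phi>len js_len p \<phi>[OF pf(1)] by simp
      have bp: "bs ! p \<in> obs (Css ! p)" unfolding bs_def by (rule bl_ob[OF xs pf(1)])
      have ws: "ws ! \<sigma> p = permute_list (inv (\<phi>s ! p)) (bs ! p)"
        unfolding ws_def using nth_permute_inv(2)[of \<sigma> "permute_blocks \<phi>s bs" p]
          \<sigma>f \<phi>len pf js_len by (simp add: bs_def)
      have len_bs: "length bs = length fs" by (simp add: bs_def js_len)
      have len_bp: "length (bs ! p) = length (msrc (fs ! p))"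
        using length_tuple(1)[OF bp] pf by (simp add: Css)
      define ys where "ys = map2 mob ?fs bs"
      have ysO: "ys \<in> obs (permute_list \<sigma> (msrc g))" unfolding ys_def bs_def by (rule ys[OF xs])
      have vw: "map2 mob ?hs ws = permute_list (inv \<sigma>) ys"
        unfolding ws_def ys_def using map_perm[OF len_bs, of mob] val_ob[OF xs] bs_def by simp
      interpret fp: multilinear "Css ! p" "permute_list \<sigma> (msrc g) ! p" "?fs ! p" by (rule mlf[OF pf(1)])
      interpret g: multilinear "msrc g" "mtgt g" g by (rule g)
      have x'C: "x' \<in> Ob ((Css ! p) ! q)" "q < length (Css ! p)" using x' q by (simp_all add: fp.msrc_eq)
      define y' where "y' = mob (?fs ! p) ((bs ! p)[q := x'])"
      have up: "(bs ! p)[q := x'] \<in> obs (Css ! p)" by (rule tuple_update(1)[OF bp x'C(1)])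
      have y'O: "y' \<in> Ob (permute_list \<sigma> (msrc g) ! p)" unfolding y'_def by (rule fp.mob_in[OF up])
      have y'f: "y' = mob (fs ! p) ((permute_list (inv (\<phi>s ! p)) (bs ! p))[(\<phi>s ! p) q := x'])"
        unfolding y'_def using up pf \<phi>len \<phi>[OF pf(1)] len_bp
        by (simp add: mlin_act_apply Css permute_list_inv_update)
      define d where "d = mdel (?fs ! p) q (bs ! p) x'"
      have dA: "d \<in> Ar (permute_list \<sigma> (msrc g) ! p)" unfolding d_def
        by (rule fp.mdel_simps[OF bp x'C(2,1)])
      have df: "d = mdel (fs ! p) ((\<phi>s ! p) q) (permute_list (inv (\<phi>s ! p)) (bs ! p)) x'"
        unfolding d_def using bp pf \<phi>len x' by (simp add: mlin_act_apply Css)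
      define ids where "ids = ident (prod_cat (permute_list \<sigma> (msrc g))) ys"
      have C: "category C" if "C \<in> set (permute_list \<sigma> (msrc g))" for C
        using that \<sigma> g.src_permutative by (auto intro: permutative.axioms(1))
      have idsA: "ids \<in> ars (permute_list \<sigma> (msrc g))"
        unfolding ids_def by (rule prod_cat_closed(3)[OF C ysO])
      have idp: "permute_list (inv \<sigma>) ids = ident (prod_cat (msrc g)) (permute_list (inv \<sigma>) ys)"
        unfolding ids_def prod_cat_simps using length_tuple(1)[OF ysO] permutes_inv[OF \<sigma>] \<sigma>
        by (simp add: permute_map2 permute_list_cancel)
      have "mdel ?lhs n xs x'
          = mar (mlin_act \<sigma> g) (ids[p := d]) \<cdot>\<^bsub>mtgt g\<^esub> mdel (mlin_act \<sigma> g) p ys y'"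
        using mlin_Gam_mdel[of p ?fs q xs x' bs n "mlin_act \<sigma> g"] pf q \<phi>len xs x' n jsF
        by (simp add: Css_def bs_def ids_def ys_def d_def y'_def)
      also have "\<dots> = mar g ((permute_list (inv \<sigma>) ids)[\<sigma> p := d])
          \<cdot>\<^bsub>mtgt g\<^esub> mdel g (\<sigma> p) (permute_list (inv \<sigma>) ys) y'"
        using tuple_update(2)[OF idsA dA] ysO y'O pf len \<sigma> length_tuple(2)[OF idsA]
        by (simp add: mlin_act_apply permute_list_inv_update)
      also have "\<dots> = mdel (mlin_Gam g ?hs) (\<rho> n) (permute_list (inv \<rho>) xs) x'"
        using mlin_Gam_mdel[of "\<sigma> p" ?hs "(\<phi>s ! p) q" "permute_list (inv \<rho>) xs" x' ws "\<rho> n" g]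
          \<sigma>p \<phi>q perm_ob[OF xs] x'f hs[OF pf(1)] \<rho>n blocks_perm[OF lx] jsH vw ws y'f df idp
        by (simp add: ws_def bs_def)
      also have "\<dots> = mdel ?rhs n xs x'"
        using that by (simp add: mlin_act_apply)
      finally show ?thesis .
    qed
  qed simp_all
qed

lemma mlin_unit_simps [simp]:
  "msrc (mlin_unit C) = [C]" "mtgt (mlin_unit C) = C"
  "c \<in> Ob C \<Longrightarrow> mob (mlin_unit C) [c] = c"
  "f \<in> Ar C \<Longrightarrow> mar (mlin_unit C) [f] = f"
  "c \<in> Ob C \<Longrightarrow> c' \<in> Ob C \<Longrightarrow> mdel (mlin_unit C) 0 [c] c' = ident C (c \<oplus>\<^bsub>C\<^esub> c')"
  by (simp_all add: mlin_unit_def)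

lemma mlin_ext_unit [simp]: "mlin_ext (mlin_unit C)"
  by (auto simp: mlin_ext_def mlin_unit_def)

lemma multilinear_unit:
  fixes C :: "('o, 'm) pcat"
  assumes "permutative C"
  shows "multilinear [C] C (mlin_unit C)"
proof -
  interpret permutative C by fact
  have ext: "mlin_ext (mlin_unit C)" by simp
  show ?thesis
    by (rule multilinear.intro)
       (use assms ext in \<open>auto simp: prod_single preserves_cat_def hom_def sum_ob_assoc sum_ob_null
         mlin_ext_def\<close>)
qed

definition nullary_op :: "('o, 'm) pcat \<Rightarrow> 'o \<Rightarrow> ('o, 'm) mlin" where
  "nullary_op C c =
     \<lparr>msrc = [], mtgt = C, mob = (\<lambda>xs\<in>{[]}. c), mar = (\<lambda>fs\<in>{[]}. ident C c),
      mdel = (\<lambda>i xs x'. undefined)\<rparr>"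

lemma nullary_op_simps [simp]:
  "msrc (nullary_op C c) = []" "mtgt (nullary_op C c) = C"
  "mob (nullary_op C c) [] = c" "mar (nullary_op C c) [] = ident C c"
  by (simp_all add: nullary_op_def)

lemma mlin_ext_nullary [simp]: "mlin_ext (nullary_op C c)"
  by (auto simp: mlin_ext_def nullary_op_def extensional_def)

lemma multilinear_nullary:
  fixes C :: "('o, 'm) pcat"
  assumes "permutative C" "c \<in> Ob C"
  shows "multilinear [] C (nullary_op C c)"
proof -
  interpret permutative C by fact
  have ext: "mlin_ext (nullary_op C c)" by simp
  show ?thesis
    by (rule multilinear.intro)
       (use assms ext in \<open>auto simp: preserves_cat_def hom_def mlin_ext_def\<close>)
qed

lemma mlin_Gam_unit:
  assumes "multilinear Cs D f"
  shows "mlin_Gam (mlin_unit D) [f] = f"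
proof -
  interpret f: multilinear Cs D f by fact
  interpret D: permutative D by (rule f.tgt_permutative)
  note [simp] = f.msrc_eq f.mtgt_eq f.mob_in f.mar_in f.mdel_simps tuple_update
  show ?thesis
  proof (rule mlin_eqI)
    show "mob (mlin_Gam (mlin_unit D) [f]) xs = mob f xs" if "xs \<in> obs (msrc f)" for xs
      using that length_tuple(1)[OF that] by (simp add: mlin_Gam_apply)
    show "mar (mlin_Gam (mlin_unit D) [f]) xs = mar f xs" if "xs \<in> ars (msrc f)" for xs
      using that length_tuple(2)[OF that] by (simp add: mlin_Gam_apply)
    show "mdel (mlin_Gam (mlin_unit D) [f]) i xs x' = mdel f i xs x'"
      if "i < length (msrc f)" "xs \<in> obs (msrc f)" "x' \<in> Ob (msrc f ! i)" for i xs x'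
      using mlin_Gam_mdel[of 0 "[f]" i xs x' "[xs]" i "mlin_unit D"] that length_tuple(1)[OF that(2)]
      by simp
  qed (simp_all add: f.mlin_ext)
qed

lemma mlin_Gam_nullary: "mlin_Gam (nullary_op C c) [] = nullary_op C c"
  by (rule mlin_eqI) (auto simp: mlin_Gam_apply)

section \<open>Identity transformations\<close>

text \<open>
  The arrows of \<open>lM\<close> are identities, so a multifunctor on \<open>lM\<close> assigns to them identity
  transformations. It preserves the structure on arrows because identity transformations are closed
  under composition, action and multiproduct.
\<close>

lemma mlin_cat_simps [simp]:
  "f \<in> Ob mlin_cat \<longleftrightarrow> multilinear (msrc f) (mtgt f) f"
  "\<phi> \<in> Ar mlin_cat \<longleftrightarrow> multilinear_trans (msrc (tdom \<phi>)) (mtgt (tdom \<phi>)) \<phi>"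
  "Dom mlin_cat = tdom" "Cod mlin_cat = tcod"
  "tdom (ident mlin_cat f) = f" "tcod (ident mlin_cat f) = f"
  by (simp_all add: mlin_cat_def)

lemma tcomp_ident:
  "cs \<in> obs (msrc f) \<Longrightarrow> tcomp (ident mlin_cat f) cs = ident (mtgt f) (mob f cs)"
  by (simp add: mlin_cat_def)

lemma mtrans_eqI:
  assumes "tdom \<phi> = tdom \<psi>" "tcod \<phi> = tcod \<psi>" "msrc (tdom \<psi>) = Cs"
    and "tcomp \<phi> \<in> extensional (obs Cs)" "tcomp \<psi> \<in> extensional (obs Cs)"
    and "\<And>cs. cs \<in> obs Cs \<Longrightarrow> tcomp \<phi> cs = tcomp \<psi> cs"
  shows "\<phi> = (\<psi> :: ('o, 'm) mtrans)"
  using assms extensionalityI[of "tcomp \<phi>" "obs Cs" "tcomp \<psi>"]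
  by (auto intro: mtrans.equality)

lemma tcomp_ident_ext: "tcomp (ident mlin_cat f) \<in> extensional (obs (msrc f))"
  by (simp add: mlin_cat_def)

lemma (in multilinear) multilinear_trans_ident: "multilinear_trans Cs D (ident mlin_cat f)"
proof -
  interpret D: permutative D by (rule tgt_permutative)
  have f: "multilinear Cs D f" by unfold_locales
  have C: "category C" if "C \<in> set Cs" for C using permutative.axioms(1)[OF src_permutative[OF that]] .
  note [simp] = mlin_cat_def msrc_eq mtgt_eq mob_in mar_in mar_Dom mar_Cod mdel_simps
    tuple_update tuple_nth prod_cat_closed[OF C]
  show ?thesis
  proof (intro multilinear_trans.intro multilinear_trans_axioms.intro)
    show "multilinear Cs D (tdom (ident mlin_cat f))" "multilinear Cs D (tcod (ident mlin_cat f))"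
      using f by simp_all
    fix cs i c' assume *: "cs \<in> obs Cs" "i < length Cs" "c' \<in> Ob (Cs ! i)"
    have "permutative (Cs ! i)" using * src_permutative by simp
    note [simp] = permutative.sum_ob_in[OF this]
    show "tcomp (ident mlin_cat f) (cs[i := cs ! i \<oplus>\<^bsub>Cs ! i\<^esub> c']) \<cdot>\<^bsub>D\<^esub> mdel (tdom (ident mlin_cat f)) i cs c'
        = mdel (tcod (ident mlin_cat f)) i cs c'
          \<cdot>\<^bsub>D\<^esub> (tcomp (ident mlin_cat f) cs \<boxplus>\<^bsub>D\<^esub> tcomp (ident mlin_cat f) (cs[i := c']))"
      using * by simp
  qed (simp_all add: D.ident_in)
qed

lemma Comp_ident_mlin:
  assumes "multilinear (msrc f) (mtgt f) f"
  shows "ident mlin_cat f \<cdot>\<^bsub>mlin_cat\<^esub> ident mlin_cat f = ident mlin_cat f"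
proof -
  interpret f: multilinear "msrc f" "mtgt f" f by fact
  interpret D: permutative "mtgt f" by (rule f.tgt_permutative)
  show ?thesis by (simp add: mlin_cat_def f.mob_in cong: restrict_cong)
qed

lemma mtrans_act_ident:
  assumes "\<sigma> permutes {..<length (msrc f)}"
  shows "mtrans_act \<sigma> (ident mlin_cat f) = ident mlin_cat (mlin_act \<sigma> f)"
  by (rule mtrans_eqI[where Cs = "permute_list \<sigma> (msrc f)"])
     (simp_all add: mtrans_act_def mlin_cat_def mlin_act_apply tuple_permute assms)

lemma mtrans_Gam_ident:
  assumes g: "multilinear (msrc g) (mtgt g) g" and len: "length fs = length (msrc g)"
    and ml: "\<And>p. p < length fs \<Longrightarrow> multilinear (msrc (fs ! p)) (msrc g ! p) (fs ! p)"
  shows "mtrans_Gam (ident mlin_cat g) (map (ident mlin_cat) fs) = ident mlin_cat (mlin_Gam g fs)"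
proof -
  interpret g: multilinear "msrc g" "mtgt g" g by fact
  interpret D: permutative "mtgt g" by (rule g.tgt_permutative)
  have C: "category C" if "C \<in> set (msrc g)" for C
    using permutative.axioms(1)[OF g.src_permutative[OF that]] .
  have td: "map tdom (map (ident mlin_cat) fs) = fs" "map tcod (map (ident mlin_cat) fs) = fs"
    by (simp_all add: map_idI)
  show ?thesis
  proof (rule mtrans_eqI)
    show "tdom (mtrans_Gam (ident mlin_cat g) (map (ident mlin_cat) fs))
      = tdom (ident mlin_cat (mlin_Gam g fs))"
      "tcod (mtrans_Gam (ident mlin_cat g) (map (ident mlin_cat) fs))
        = tcod (ident mlin_cat (mlin_Gam g fs))"
      unfolding mtrans_Gam_def td by (simp_all add: Let_def)
    show "msrc (tdom (ident mlin_cat (mlin_Gam g fs))) = concat (map msrc fs)" by simp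
    show "tcomp (ident mlin_cat (mlin_Gam g fs)) \<in> extensional (obs (concat (map msrc fs)))"
      using tcomp_ident_ext[of "mlin_Gam g fs"] by simp
    show "tcomp (mtrans_Gam (ident mlin_cat g) (map (ident mlin_cat) fs))
        \<in> extensional (obs (concat (map msrc fs)))"
      unfolding mtrans_Gam_def td by (simp add: Let_def)
    fix xs assume xs: "xs \<in> obs (concat (map msrc fs))"
    define bs where "bs = blocks (map (length \<circ> msrc) fs) xs"
    have bs: "length bs = length fs" "\<And>p. p < length fs \<Longrightarrow> bs ! p \<in> obs (msrc (fs ! p))"
      using tuple_blocks(1)[OF xs] by (auto simp: bs_def list_all2_conv_all_nth)
    define ys where "ys = map2 mob fs bs"
    have ys: "ys \<in> obs (msrc g)"
      using bs len multilinear.mob_in[OF ml] by (simp add: ys_def Ob_prod_cat list_all2_conv_all_nth)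
    have "map2 tcomp (map (ident mlin_cat) fs) bs = ident (prod_cat (msrc g)) ys"
      using bs len multilinear.mtgt_eq[OF ml]
      by (auto intro!: nth_equalityI simp: ys_def prod_cat_simps tcomp_ident)
    then show "tcomp (mtrans_Gam (ident mlin_cat g) (map (ident mlin_cat) fs)) xs
        = tcomp (ident mlin_cat (mlin_Gam g fs)) xs"
      unfolding mtrans_Gam_def td using xs ys
      by (simp add: Let_def bs_def[symmetric] ys_def[symmetric] tcomp_ident g.mar_ident
          mlin_Gam_apply g.mob_in)
  qed
qed

section \<open>Tensor products of multilinear maps\<close>

text \<open>
  The map $(x, y) \mapsto f(x) \otimes h(y)$. If \<open>S\<close> is the pairing of a bilinear map \<open>m\<close>, this is
  the multiproduct of \<open>m\<close> with \<open>f\<close> and \<open>h\<close> (\<open>mlin_Gam_bilinear\<close> below). Only the operations of \<open>S\<close>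
  enter, so that it can be formed before \<open>S\<close> is known to be bilinear.
\<close>

definition tens_op :: "('o, 'm) pairing \<Rightarrow> ('o, 'm) mlin \<Rightarrow> ('o, 'm) mlin \<Rightarrow> ('o, 'm) mlin" where
  "tens_op S f h = (let Cs = msrc f @ msrc h; k = length (msrc f); A = mtgt f; D = mtgt h in
     \<lparr>msrc = Cs, mtgt = D,
      mob = (\<lambda>xs\<in>obs Cs. mob f (take k xs) \<otimes>\<^bsub>S\<^esub> mob h (drop k xs)),
      mar = (\<lambda>xs\<in>ars Cs. mar f (take k xs) \<boxtimes>\<^bsub>S\<^esub> mar h (drop k xs)),
      mdel = (\<lambda>i xs x'.
        if i < length Cs \<and> xs \<in> obs Cs \<and> x' \<in> Ob (Cs ! i) then
          let us = take k xs; vs = drop k xs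
          in if i < k
          then (mdel f i us x' \<boxtimes>\<^bsub>S\<^esub> ident D (mob h vs))
          \<cdot>\<^bsub>D\<^esub> dl S (mob f us) (mob f (us[i := x'])) (mob h vs)
          else (ident A (mob f us) \<boxtimes>\<^bsub>S\<^esub> mdel h (i - k) vs x')
          \<cdot>\<^bsub>D\<^esub> dr S (mob f us) (mob h vs) (mob h (vs[i - k := x']))
        else undefined)\<rparr>)"

lemma mlin_ext_tens_op [simp]: "mlin_ext (tens_op S f h)"
  by (simp add: mlin_ext_def tens_op_def Let_def)

lemma tens_op_simps [simp]:
  "msrc (tens_op S f h) = msrc f @ msrc h" "mtgt (tens_op S f h) = mtgt h"
  by (simp_all add: tens_op_def Let_def)

lemma tens_op_apply:
  "\<lbrakk>us \<in> obs (msrc f); vs \<in> obs (msrc h)\<rbrakk>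
    \<Longrightarrow> mob (tens_op S f h) (us @ vs) = mob f us \<otimes>\<^bsub>S\<^esub> mob h vs"
  "\<lbrakk>fs \<in> ars (msrc f); gs \<in> ars (msrc h)\<rbrakk>
    \<Longrightarrow> mar (tens_op S f h) (fs @ gs) = mar f fs \<boxtimes>\<^bsub>S\<^esub> mar h gs"
  "\<lbrakk>us \<in> obs (msrc f); vs \<in> obs (msrc h); i < length (msrc f); x' \<in> Ob (msrc f ! i)\<rbrakk>
    \<Longrightarrow> mdel (tens_op S f h) i (us @ vs) x' = (mdel f i us x' \<boxtimes>\<^bsub>S\<^esub> ident (mtgt h) (mob h vs))
          \<cdot>\<^bsub>mtgt h\<^esub> dl S (mob f us) (mob f (us[i := x'])) (mob h vs)"
  "\<lbrakk>us \<in> obs (msrc f); vs \<in> obs (msrc h); i < length (msrc h); x' \<in> Ob (msrc h ! i)\<rbrakk>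
    \<Longrightarrow> mdel (tens_op S f h) (length (msrc f) + i) (us @ vs) x'
        = (ident (mtgt f) (mob f us) \<boxtimes>\<^bsub>S\<^esub> mdel h i vs x')
          \<cdot>\<^bsub>mtgt h\<^esub> dr S (mob f us) (mob h vs) (mob h (vs[i := x']))"
  by (simp_all add: tens_op_def Let_def prod_append length_tuple nth_append)

text \<open>
  The diagrams below live in \<open>D\<close>, which is therefore the structure meant by symbols without index.
\<close>

locale left_tensor = tensor_action A D T e S
  for A :: "('o, 'm) pcat" and D :: "('o, 'm) pcat" (structure) and T :: "('o, 'm) pairing" and e :: 'o
    and S :: "('o, 'm) pairing"
begin

lemma ten_ob_in [simp]: "\<lbrakk>a \<in> Ob A; d \<in> Ob D\<rbrakk> \<Longrightarrow> a \<otimes>\<^bsub>S\<^esub> d \<in> Ob D"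
  using ten_bifunctor by (simp add: bifunctor_def)

lemma ten_ar_simps [simp]:
  assumes "f \<in> Ar A" "h \<in> Ar D"
  shows "f \<boxtimes>\<^bsub>S\<^esub> h \<in> Ar D" "Dom D (f \<boxtimes>\<^bsub>S\<^esub> h) = Dom A f \<otimes>\<^bsub>S\<^esub> Dom D h"
    "Cod D (f \<boxtimes>\<^bsub>S\<^esub> h) = Cod A f \<otimes>\<^bsub>S\<^esub> Cod D h"
  using ten_bifunctor assms by (auto simp: bifunctor_def hom_def)

lemma ten_ident [simp]: "\<lbrakk>a \<in> Ob A; d \<in> Ob D\<rbrakk> \<Longrightarrow> ident A a \<boxtimes>\<^bsub>S\<^esub> ident D d = ident D (a \<otimes>\<^bsub>S\<^esub> d)"
  using ten_bifunctor by (simp add: bifunctor_def)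

lemma ten_Comp:
  assumes "f \<in> Ar A" "f' \<in> Ar A" "h \<in> Ar D" "h' \<in> Ar D" "Dom A f' = Cod A f" "Dom D h' = Cod D h"
  shows "(f' \<cdot>\<^bsub>A\<^esub> f) \<boxtimes>\<^bsub>S\<^esub> (h' \<cdot> h) = (f' \<boxtimes>\<^bsub>S\<^esub> h') \<cdot> (f \<boxtimes>\<^bsub>S\<^esub> h)"
  using ten_bifunctor assms unfolding bifunctor_def by blast

lemma ident_ten_Comp:
  assumes "a \<in> Ob A" "h \<in> Ar D" "h' \<in> Ar D" "Dom D h' = Cod D h"
  shows "ident A a \<boxtimes>\<^bsub>S\<^esub> (h' \<cdot> h) = (ident A a \<boxtimes>\<^bsub>S\<^esub> h') \<cdot> (ident A a \<boxtimes>\<^bsub>S\<^esub> h)"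
  using ten_Comp[of "ident A a" "ident A a" h h'] assms by simp

lemma Comp_ten_ident:
  assumes "d \<in> Ob D" "f \<in> Ar A" "f' \<in> Ar A" "Dom A f' = Cod A f"
  shows "(f' \<cdot>\<^bsub>A\<^esub> f) \<boxtimes>\<^bsub>S\<^esub> ident D d = (f' \<boxtimes>\<^bsub>S\<^esub> ident D d) \<cdot> (f \<boxtimes>\<^bsub>S\<^esub> ident D d)"
  using ten_Comp[of f f' "ident D d" "ident D d"] assms by simp

lemma dl_simps [simp]:
  assumes "a \<in> Ob A" "a' \<in> Ob A" "d \<in> Ob D"
  shows "dl S a a' d \<in> Ar D" "Dom D (dl S a a' d) = (a \<otimes>\<^bsub>S\<^esub> d) \<oplus> (a' \<otimes>\<^bsub>S\<^esub> d)"
    "Cod D (dl S a a' d) = (a \<oplus>\<^bsub>A\<^esub> a') \<otimes>\<^bsub>S\<^esub> d"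
  using dl_in[OF assms] by (auto simp: hom_def)

lemma dr_simps [simp]:
  assumes "a \<in> Ob A" "d \<in> Ob D" "d' \<in> Ob D"
  shows "dr S a d d' \<in> Ar D" "Dom D (dr S a d d') = (a \<otimes>\<^bsub>S\<^esub> d) \<oplus> (a \<otimes>\<^bsub>S\<^esub> d')"
    "Cod D (dr S a d d') = a \<otimes>\<^bsub>S\<^esub> (d \<oplus> d')"
  using dr_in[OF assms] by (auto simp: hom_def)

declare unit_in [simp]

text \<open>
  If \<open>\<delta>\<close> is a distributivity map $h(c) \oplus h(c') \to h(c \oplus c')$ with \<open>x\<close> $= h(c)$ and
  \<open>x'\<close> $= h(c')$, then \<open>ldel a x x' \<delta>\<close> is the distributivity map of $a \otimes h(-)$ in the same
  variable. The lemmas on \<open>ldel\<close> transfer the axioms for multilinear maps from $h$ to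
  $a \otimes h(-)$; their assumptions on \<open>\<delta>\<close> are these axioms for $h$.
\<close>

definition ldel :: "'o \<Rightarrow> 'o \<Rightarrow> 'o \<Rightarrow> 'm \<Rightarrow> 'm" where
  "ldel a x x' \<delta> = (ident A a \<boxtimes>\<^bsub>S\<^esub> \<delta>) \<cdot> dr S a x x'"

lemma ldel_simps [simp]:
  assumes "a \<in> Ob A" "x \<in> Ob D" "x' \<in> Ob D" "\<delta> \<in> Ar D" "Dom D \<delta> = x \<oplus> x'"
  shows "ldel a x x' \<delta> \<in> Ar D" "Dom D (ldel a x x' \<delta>) = (a \<otimes>\<^bsub>S\<^esub> x) \<oplus> (a \<otimes>\<^bsub>S\<^esub> x')"
    "Cod D (ldel a x x' \<delta>) = a \<otimes>\<^bsub>S\<^esub> Cod D \<delta>"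
  using assms by (simp_all add: ldel_def)

lemma ldel_natural:
  assumes "f \<in> Ar A" "k \<in> Ar D" "k' \<in> Ar D" "l \<in> Ar D" "\<delta> \<in> Ar D" "\<delta>' \<in> Ar D"
    and "Dom D \<delta> = Dom D k \<oplus> Dom D k'" "Dom D \<delta>' = Cod D k \<oplus> Cod D k'"
    and "Dom D l = Cod D \<delta>"
    and eq: "l \<cdot> \<delta> = \<delta>' \<cdot> (k \<boxplus> k')"
  shows "(f \<boxtimes>\<^bsub>S\<^esub> l) \<cdot> ldel (Dom A f) (Dom D k) (Dom D k') \<delta>
       = ldel (Cod A f) (Cod D k) (Cod D k') \<delta>' \<cdot> ((f \<boxtimes>\<^bsub>S\<^esub> k) \<boxplus> (f \<boxtimes>\<^bsub>S\<^esub> k'))"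
proof -
  let ?dr = "dr S (Dom A f) (Dom D k) (Dom D k')"
  have "(f \<boxtimes>\<^bsub>S\<^esub> l) \<cdot> ldel (Dom A f) (Dom D k) (Dom D k') \<delta>
      = (f \<boxtimes>\<^bsub>S\<^esub> l) \<cdot> (ident A (Dom A f) \<boxtimes>\<^bsub>S\<^esub> \<delta>) \<cdot> ?dr"
    using assms(1-9) by (simp add: ldel_def D.assoc)
  also have "(f \<boxtimes>\<^bsub>S\<^esub> l) \<cdot> (ident A (Dom A f) \<boxtimes>\<^bsub>S\<^esub> \<delta>) = f \<boxtimes>\<^bsub>S\<^esub> (\<delta>' \<cdot> (k \<boxplus> k'))"
    using ten_Comp[of "ident A (Dom A f)" f \<delta> l] assms by simp
  also have "\<dots> = (ident A (Cod A f) \<boxtimes>\<^bsub>S\<^esub> \<delta>') \<cdot> (f \<boxtimes>\<^bsub>S\<^esub> (k \<boxplus> k'))"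
    using ten_Comp[of f "ident A (Cod A f)" "k \<boxplus> k'" \<delta>'] assms by simp
  also have "\<dots> \<cdot> ?dr = (ident A (Cod A f) \<boxtimes>\<^bsub>S\<^esub> \<delta>') \<cdot> ((f \<boxtimes>\<^bsub>S\<^esub> (k \<boxplus> k')) \<cdot> ?dr)"
    using assms(1-9) by (simp add: D.assoc)
  also have "\<dots> = (ident A (Cod A f) \<boxtimes>\<^bsub>S\<^esub> \<delta>') \<cdot>
      (dr S (Cod A f) (Cod D k) (Cod D k') \<cdot> ((f \<boxtimes>\<^bsub>S\<^esub> k) \<boxplus> (f \<boxtimes>\<^bsub>S\<^esub> k')))"
    using dr_natural assms by simp
  finally show ?thesis using assms(1-9) by (simp add: ldel_def D.assoc)
qed

text \<open>
  Naturality of \<open>dr\<close> collects everything that happens inside the tensor product in one arrow and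
  leaves a composite of distributivity maps \<open>dr\<close>. After this reduction a condition on \<open>ldel\<close> splits
  into the same condition on \<open>\<delta>\<close> and the condition on \<open>dr\<close> alone.
\<close>

lemma ldel_lift:
  assumes "a \<in> Ob A" "\<delta> \<in> Ar D" "\<alpha> \<in> Ar D" "\<beta> \<in> Ar D" "u \<in> Ar D" "v \<in> Ar D"
    and "Cod D u = a \<otimes>\<^bsub>S\<^esub> Dom D \<alpha>" "Cod D v = a \<otimes>\<^bsub>S\<^esub> Dom D \<beta>"
    and "Dom D \<delta> = Cod D \<alpha> \<oplus> Cod D \<beta>"
  shows "ldel a (Cod D \<alpha>) (Cod D \<beta>) \<delta> \<cdot> (((ident A a \<boxtimes>\<^bsub>S\<^esub> \<alpha>) \<cdot> u) \<boxplus> ((ident A a \<boxtimes>\<^bsub>S\<^esub> \<beta>) \<cdot> v))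
       = (ident A a \<boxtimes>\<^bsub>S\<^esub> (\<delta> \<cdot> (\<alpha> \<boxplus> \<beta>))) \<cdot> (dr S a (Dom D \<alpha>) (Dom D \<beta>) \<cdot> (u \<boxplus> v))"
proof -
  let ?l = "ldel a (Cod D \<alpha>) (Cod D \<beta>) \<delta>" and ?i = "ident A a"
  have "?l \<cdot> (((?i \<boxtimes>\<^bsub>S\<^esub> \<alpha>) \<cdot> u) \<boxplus> ((?i \<boxtimes>\<^bsub>S\<^esub> \<beta>) \<cdot> v))
      = ?l \<cdot> ((?i \<boxtimes>\<^bsub>S\<^esub> \<alpha>) \<boxplus> (?i \<boxtimes>\<^bsub>S\<^esub> \<beta>)) \<cdot> (u \<boxplus> v)"
    using assms by (simp add: D.sum_Comp D.assoc)
  also have "?l \<cdot> ((?i \<boxtimes>\<^bsub>S\<^esub> \<alpha>) \<boxplus> (?i \<boxtimes>\<^bsub>S\<^esub> \<beta>))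
      = (?i \<boxtimes>\<^bsub>S\<^esub> (\<delta> \<cdot> (\<alpha> \<boxplus> \<beta>))) \<cdot> ldel a (Dom D \<alpha>) (Dom D \<beta>) (ident D (Dom D \<alpha> \<oplus> Dom D \<beta>))"
    using ldel_natural[of ?i \<alpha> \<beta> "\<delta> \<cdot> (\<alpha> \<boxplus> \<beta>)" "ident D (Dom D \<alpha> \<oplus> Dom D \<beta>)" \<delta>] assms by simp
  finally show ?thesis using assms by (simp add: ldel_def D.assoc)
qed

lemma ldel_assoc:
  assumes "a \<in> Ob A" "x \<in> Ob D" "x' \<in> Ob D" "x'' \<in> Ob D"
    and "\<delta>1 \<in> Ar D" "\<delta>2 \<in> Ar D" "\<delta>3 \<in> Ar D" "\<delta>4 \<in> Ar D"
    and "Dom D \<delta>1 = x \<oplus> x'" "Cod D \<delta>1 = y" "Dom D \<delta>2 = y \<oplus> x''"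
    and "Dom D \<delta>3 = x' \<oplus> x''" "Cod D \<delta>3 = y'" "Dom D \<delta>4 = x \<oplus> y'"
    and eq: "\<delta>2 \<cdot> (\<delta>1 \<boxplus> ident D x'') = \<delta>4 \<cdot> (ident D x \<boxplus> \<delta>3)"
  shows "ldel a y x'' \<delta>2 \<cdot> (ldel a x x' \<delta>1 \<boxplus> ident D (a \<otimes>\<^bsub>S\<^esub> x''))
       = ldel a x y' \<delta>4 \<cdot> (ident D (a \<otimes>\<^bsub>S\<^esub> x) \<boxplus> ldel a x' x'' \<delta>3)"
  using ldel_lift[of a \<delta>2 \<delta>1 "ident D x''" "dr S a x x'" "ident D (a \<otimes>\<^bsub>S\<^esub> x'')"]
    ldel_lift[of a \<delta>4 "ident D x" \<delta>3 "ident D (a \<otimes>\<^bsub>S\<^esub> x)" "dr S a x' x''"]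
    dr_assoc[of a x x' x''] assms
  by (simp add: ldel_def[of a x x'] ldel_def[of a x' x''])

lemma ldel_gam:
  assumes "a \<in> Ob A" "x \<in> Ob D" "x' \<in> Ob D" "\<delta> \<in> Ar D" "\<delta>' \<in> Ar D" "l \<in> Ar D"
    and "Dom D \<delta> = x \<oplus> x'" "Dom D \<delta>' = x' \<oplus> x" "Dom D l = Cod D \<delta>"
    and eq: "l \<cdot> \<delta> = \<delta>' \<cdot> \<gamma> x x'"
  shows "(ident A a \<boxtimes>\<^bsub>S\<^esub> l) \<cdot> ldel a x x' \<delta> = ldel a x' x \<delta>' \<cdot> \<gamma> (a \<otimes>\<^bsub>S\<^esub> x) (a \<otimes>\<^bsub>S\<^esub> x')"
proof -
  have "(ident A a \<boxtimes>\<^bsub>S\<^esub> l) \<cdot> ldel a x x' \<delta> = (ident A a \<boxtimes>\<^bsub>S\<^esub> (l \<cdot> \<delta>)) \<cdot> dr S a x x'"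
    using assms(1-9) by (simp add: ldel_def ident_ten_Comp D.assoc)
  also have "\<dots> = (ident A a \<boxtimes>\<^bsub>S\<^esub> \<delta>') \<cdot> ((ident A a \<boxtimes>\<^bsub>S\<^esub> \<gamma> x x') \<cdot> dr S a x x')"
    unfolding eq using assms(1-9) by (simp add: ident_ten_Comp D.assoc)
  finally show ?thesis using assms(1-9) by (simp add: dr_gam ldel_def D.assoc)
qed

text \<open>
  Distributing over four summands commutes with the exchange of the two in the middle. The composite
  of the maps \<open>dr\<close> can be bracketed by \<open>dr_assoc\<close> so that the two middle summands are distributed
  first, and for these the claim is \<open>dr_gam\<close>.
\<close>

lemma dr4_gam:
  assumes "a \<in> Ob A" "x \<in> Ob D" "y \<in> Ob D" "z \<in> Ob D" "w \<in> Ob D"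
  defines "R \<equiv> \<lambda>y z. dr S a (x \<oplus> y) (z \<oplus> w) \<cdot> (dr S a x y \<boxplus> dr S a z w)"
  shows "(ident A a \<boxtimes>\<^bsub>S\<^esub> (ident D x \<boxplus> \<gamma> y z \<boxplus> ident D w)) \<cdot> R y z
       = R z y \<cdot> (ident D (a \<otimes>\<^bsub>S\<^esub> x) \<boxplus> \<gamma> (a \<otimes>\<^bsub>S\<^esub> y) (a \<otimes>\<^bsub>S\<^esub> z) \<boxplus> ident D (a \<otimes>\<^bsub>S\<^esub> w))"
proof -
  let ?i = "\<lambda>x. ident D (a \<otimes>\<^bsub>S\<^esub> x)"
  have R: "R y z = dr S a x (y \<oplus> z \<oplus> w) \<cdot>
      (?i x \<boxplus> (dr S a (y \<oplus> z) w \<cdot> (dr S a y z \<boxplus> ?i w)))"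
    if yz: "y \<in> Ob D" "z \<in> Ob D" for y z
  proof -
    have "dr S a x y \<boxplus> dr S a z w = (dr S a x y \<boxplus> ?i (z \<oplus> w)) \<cdot> (?i x \<boxplus> (?i y \<boxplus> dr S a z w))"
      using D.sum_Comp[of "ident D ((a \<otimes>\<^bsub>S\<^esub> x) \<oplus> (a \<otimes>\<^bsub>S\<^esub> y))" "dr S a x y" "dr S a z w" "?i (z \<oplus> w)"]
        assms yz by (simp add: D.sum_ar_assoc[symmetric])
    then have "R y z = dr S a (x \<oplus> y) (z \<oplus> w) \<cdot> (dr S a x y \<boxplus> ?i (z \<oplus> w))
        \<cdot> (?i x \<boxplus> (?i y \<boxplus> dr S a z w))"
      using assms yz by (simp add: D.assoc D.sum_ob_assoc)
    also have "\<dots> = dr S a x (y \<oplus> (z \<oplus> w)) \<cdot> ((?i x \<boxplus> dr S a y (z \<oplus> w))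
        \<cdot> (?i x \<boxplus> (?i y \<boxplus> dr S a z w)))"
      using assms yz by (simp add: dr_assoc D.assoc D.sum_ob_assoc)
    also have "\<dots> = dr S a x (y \<oplus> (z \<oplus> w)) \<cdot> (?i x \<boxplus>
        (dr S a y (z \<oplus> w) \<cdot> (?i y \<boxplus> dr S a z w)))"
      using assms yz by (simp add: D.sum_Comp[symmetric])
    finally show ?thesis using assms yz by (simp add: dr_assoc[symmetric] D.sum_ob_assoc)
  qed
  let ?j = "ident A a" and ?g = "\<gamma> y z"
  have 1: "(?j \<boxtimes>\<^bsub>S\<^esub> (ident D x \<boxplus> (?g \<boxplus> ident D w))) \<cdot> dr S a x (y \<oplus> z \<oplus> w)
      = dr S a x (z \<oplus> y \<oplus> w) \<cdot> (?i x \<boxplus> (?j \<boxtimes>\<^bsub>S\<^esub> (?g \<boxplus> ident D w)))"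
    using dr_natural[of ?j "ident D x" "?g \<boxplus> ident D w"] assms by simp
  have 2: "(?j \<boxtimes>\<^bsub>S\<^esub> (?g \<boxplus> ident D w)) \<cdot> dr S a (y \<oplus> z) w
      = dr S a (z \<oplus> y) w \<cdot> ((?j \<boxtimes>\<^bsub>S\<^esub> ?g) \<boxplus> ?i w)"
    using dr_natural[of ?j ?g "ident D w"] assms by simp
  have 3: "((?j \<boxtimes>\<^bsub>S\<^esub> ?g) \<boxplus> ?i w) \<cdot> (dr S a y z \<boxplus> ?i w)
      = (dr S a z y \<boxplus> ?i w) \<cdot> (\<gamma> (a \<otimes>\<^bsub>S\<^esub> y) (a \<otimes>\<^bsub>S\<^esub> z) \<boxplus> ?i w)"
    using assms by (simp add: D.sum_Comp[symmetric] dr_gam)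
  let ?G = "\<gamma> (a \<otimes>\<^bsub>S\<^esub> y) (a \<otimes>\<^bsub>S\<^esub> z) \<boxplus> ?i w"
  have 4: "(?j \<boxtimes>\<^bsub>S\<^esub> (?g \<boxplus> ident D w)) \<cdot> (dr S a (y \<oplus> z) w \<cdot> (dr S a y z \<boxplus> ?i w))
      = dr S a (z \<oplus> y) w \<cdot> (dr S a z y \<boxplus> ?i w) \<cdot> ?G"
    using assms 3 by (simp add: D.assoc[symmetric] 2) (simp add: D.assoc)
  have "(?j \<boxtimes>\<^bsub>S\<^esub> (ident D x \<boxplus> ?g \<boxplus> ident D w)) \<cdot> R y z
      = dr S a x (z \<oplus> y \<oplus> w) \<cdot> ((?i x \<boxplus> (?j \<boxtimes>\<^bsub>S\<^esub> (?g \<boxplus> ident D w)))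
        \<cdot> (?i x \<boxplus> (dr S a (y \<oplus> z) w \<cdot> (dr S a y z \<boxplus> ?i w))))"
    using assms(1-5) 1 by (simp add: R D.sum_ar_assoc D.assoc[symmetric])
  also have "\<dots> = dr S a x (z \<oplus> y \<oplus> w) \<cdot> (?i x \<boxplus> (dr S a (z \<oplus> y) w \<cdot> (dr S a z y \<boxplus> ?i w) \<cdot> ?G))"
    using assms(1-5) 4 by (simp add: D.sum_Comp[symmetric])
  also have "\<dots> = R z y \<cdot> (?i x \<boxplus> ?G)"
    using assms(1-5) D.sum_Comp[of "?i x" "?i x" ?G "dr S a (z \<oplus> y) w \<cdot> (dr S a z y \<boxplus> ?i w)"]
    by (simp add: R D.assoc)
  finally show ?thesis using assms by (simp add: D.sum_ar_assoc)
qed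

text \<open>
  The exchange axiom for two variables of $h$ passes to $a \otimes h(-)$. The symmetry in it has to
  be moved across four distributed summands, which is \<open>dr4_gam\<close>.
\<close>

lemma ldel_mdel:
  assumes "a \<in> Ob A" "x1 \<in> Ob D" "x2 \<in> Ob D" "x3 \<in> Ob D" "x4 \<in> Ob D"
    and "di \<in> Ar D" "Dom D di = x1 \<oplus> x2" "Cod D di = p"
    and "di' \<in> Ar D" "Dom D di' = x3 \<oplus> x4" "Cod D di' = q"
    and "dj \<in> Ar D" "Dom D dj = p \<oplus> q"
    and "dj1 \<in> Ar D" "Dom D dj1 = x1 \<oplus> x3" "Cod D dj1 = r"
    and "dj2 \<in> Ar D" "Dom D dj2 = x2 \<oplus> x4" "Cod D dj2 = s"
    and "e' \<in> Ar D" "Dom D e' = r \<oplus> s"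
    and eq: "dj \<cdot> (di \<boxplus> di')
        = e' \<cdot> (dj1 \<boxplus> dj2) \<cdot> (ident D x1 \<boxplus> \<gamma> x2 x3 \<boxplus> ident D x4)"
  shows "ldel a p q dj \<cdot> (ldel a x1 x2 di \<boxplus> ldel a x3 x4 di')
       = ldel a r s e' \<cdot> (ldel a x1 x3 dj1 \<boxplus> ldel a x2 x4 dj2)
         \<cdot> (ident D (a \<otimes>\<^bsub>S\<^esub> x1) \<boxplus> \<gamma> (a \<otimes>\<^bsub>S\<^esub> x2) (a \<otimes>\<^bsub>S\<^esub> x3) \<boxplus> ident D (a \<otimes>\<^bsub>S\<^esub> x4))"
    (is "_ = _ \<cdot> ?G")
proof -
  let ?i = "ident A a" and ?g = "ident D x1 \<boxplus> \<gamma> x2 x3 \<boxplus> ident D x4"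
  let ?R = "\<lambda>y z. dr S a (x1 \<oplus> y) (z \<oplus> x4) \<cdot> (dr S a x1 y \<boxplus> dr S a z x4)"
  have o: "p \<in> Ob D" "q \<in> Ob D" "r \<in> Ob D" "s \<in> Ob D" using assms D.Cod_in by blast+
  note ty = assms(1-21) o
  have "ldel a p q dj \<cdot> (ldel a x1 x2 di \<boxplus> ldel a x3 x4 di')
      = (?i \<boxtimes>\<^bsub>S\<^esub> (dj \<cdot> (di \<boxplus> di'))) \<cdot> ?R x2 x3"
    using ldel_lift[of a dj di di' "dr S a x1 x2" "dr S a x3 x4"] ty
    by (simp add: ldel_def[of a x1 x2] ldel_def[of a x3 x4])
  also have "\<dots> = (?i \<boxtimes>\<^bsub>S\<^esub> (e' \<cdot> (dj1 \<boxplus> dj2))) \<cdot> ((?i \<boxtimes>\<^bsub>S\<^esub> ?g) \<cdot> ?R x2 x3)"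
    unfolding eq using ty by (simp add: D.assoc D.sum_ob_assoc ident_ten_Comp)
  also have "(?i \<boxtimes>\<^bsub>S\<^esub> ?g) \<cdot> ?R x2 x3 = ?R x3 x2 \<cdot> ?G"
    using dr4_gam[of a x1 x2 x3 x4] ty by simp
  also have "(?i \<boxtimes>\<^bsub>S\<^esub> (e' \<cdot> (dj1 \<boxplus> dj2))) \<cdot> (?R x3 x2 \<cdot> ?G)
      = (?i \<boxtimes>\<^bsub>S\<^esub> (e' \<cdot> (dj1 \<boxplus> dj2))) \<cdot> ?R x3 x2 \<cdot> ?G"
    using ty by (simp add: D.assoc D.sum_ob_assoc)
  also have "(?i \<boxtimes>\<^bsub>S\<^esub> (e' \<cdot> (dj1 \<boxplus> dj2))) \<cdot> ?R x3 x2
      = ldel a r s e' \<cdot> (ldel a x1 x3 dj1 \<boxplus> ldel a x2 x4 dj2)"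
    using ldel_lift[of a e' dj1 dj2 "dr S a x1 x3" "dr S a x2 x4"] ty
    by (simp add: ldel_def[of a x1 x3] ldel_def[of a x2 x4])
  finally show ?thesis .
qed

text \<open>
  The exchange axiom for the new variable and a variable of $h$, in both orders. The first one is
  \<open>dl_dr\<close>; in the other one the two middle summands have changed places, and it follows as the
  symmetry is an involution.
\<close>

lemma dl_ldel:
  assumes "a \<in> Ob A" "a' \<in> Ob A" "x \<in> Ob D" "x' \<in> Ob D" "\<delta> \<in> Ar D"
    "Dom D \<delta> = x \<oplus> x'" "Cod D \<delta> = y"
  shows "dl S a a' y \<cdot> (ldel a x x' \<delta> \<boxplus> ldel a' x x' \<delta>)
       = ldel (a \<oplus>\<^bsub>A\<^esub> a') x x' \<delta> \<cdot> (dl S a a' x \<boxplus> dl S a a' x')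
         \<cdot> (ident D (a \<otimes>\<^bsub>S\<^esub> x) \<boxplus> \<gamma> (a \<otimes>\<^bsub>S\<^esub> x') (a' \<otimes>\<^bsub>S\<^esub> x) \<boxplus> ident D (a' \<otimes>\<^bsub>S\<^esub> x'))"
    (is "_ = _ \<cdot> ?G")
    and "ldel (a \<oplus>\<^bsub>A\<^esub> a') x x' \<delta> \<cdot> (dl S a a' x \<boxplus> dl S a a' x')
       = dl S a a' y \<cdot> (ldel a x x' \<delta> \<boxplus> ldel a' x x' \<delta>)
         \<cdot> (ident D (a \<otimes>\<^bsub>S\<^esub> x) \<boxplus> \<gamma> (a' \<otimes>\<^bsub>S\<^esub> x) (a \<otimes>\<^bsub>S\<^esub> x') \<boxplus> ident D (a' \<otimes>\<^bsub>S\<^esub> x'))"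
    (is "_ = _ \<cdot> ?G'")
proof -
  have y: "y \<in> Ob D" using assms D.Cod_in by blast
  note ty = assms y
  have "dl S a a' y \<cdot> (ldel a x x' \<delta> \<boxplus> ldel a' x x' \<delta>)
      = dl S a a' y \<cdot> ((ident A a \<boxtimes>\<^bsub>S\<^esub> \<delta>) \<boxplus> (ident A a' \<boxtimes>\<^bsub>S\<^esub> \<delta>)) \<cdot> (dr S a x x' \<boxplus> dr S a' x x')"
    using ty by (simp add: ldel_def D.sum_Comp D.assoc)
  also have "dl S a a' y \<cdot> ((ident A a \<boxtimes>\<^bsub>S\<^esub> \<delta>) \<boxplus> (ident A a' \<boxtimes>\<^bsub>S\<^esub> \<delta>))
      = (ident A (a \<oplus>\<^bsub>A\<^esub> a') \<boxtimes>\<^bsub>S\<^esub> \<delta>) \<cdot> dl S a a' (x \<oplus> x')"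
    using dl_natural[of "ident A a" "ident A a'" \<delta>] ty by simp
  also have "\<dots> \<cdot> (dr S a x x' \<boxplus> dr S a' x x')
      = (ident A (a \<oplus>\<^bsub>A\<^esub> a') \<boxtimes>\<^bsub>S\<^esub> \<delta>) \<cdot> (dl S a a' (x \<oplus> x') \<cdot> (dr S a x x' \<boxplus> dr S a' x x'))"
    using ty by (simp add: D.assoc)
  finally show eq: "dl S a a' y \<cdot> (ldel a x x' \<delta> \<boxplus> ldel a' x x' \<delta>)
       = ldel (a \<oplus>\<^bsub>A\<^esub> a') x x' \<delta> \<cdot> (dl S a a' x \<boxplus> dl S a a' x') \<cdot> ?G"
    using ty by (simp add: dl_dr ldel_def D.assoc D.sum_ob_assoc)
  have GG: "?G \<cdot> ?G' = ident D ((a \<otimes>\<^bsub>S\<^esub> x) \<oplus> ((a' \<otimes>\<^bsub>S\<^esub> x) \<oplus> ((a \<otimes>\<^bsub>S\<^esub> x') \<oplus> (a' \<otimes>\<^bsub>S\<^esub> x'))))"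
    using ty by (simp add: D.sum_Comp[symmetric] D.gam_gam D.sum_ob_assoc)
  show "ldel (a \<oplus>\<^bsub>A\<^esub> a') x x' \<delta> \<cdot> (dl S a a' x \<boxplus> dl S a a' x')
       = dl S a a' y \<cdot> (ldel a x x' \<delta> \<boxplus> ldel a' x x' \<delta>) \<cdot> ?G'"
    unfolding eq using ty by (simp add: D.assoc D.sum_ob_assoc GG)
qed

abbreviation cons_op :: "('o, 'm) mlin \<Rightarrow> ('o, 'm) mlin" where
  "cons_op \<equiv> tens_op S (mlin_unit A)"

lemma cons_op_apply:
  assumes "multilinear Cs D h" "a \<in> Ob A" "vs \<in> obs Cs"
  shows "mob (cons_op h) (a # vs) = a \<otimes>\<^bsub>S\<^esub> mob h vs"
    and "a' \<in> Ob A \<Longrightarrow> mdel (cons_op h) 0 (a # vs) a' = dl S a a' (mob h vs)"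
    and "\<lbrakk>i < length Cs; x' \<in> Ob (Cs ! i)\<rbrakk>
        \<Longrightarrow> mdel (cons_op h) (Suc i) (a # vs) x'
          = ldel a (mob h vs) (mob h (vs[i := x'])) (mdel h i vs x')"
proof -
  interpret h: multilinear Cs D h by fact
  have a: "[a] \<in> obs (msrc (mlin_unit A))" using assms by simp
  have vs: "vs \<in> obs (msrc h)" using assms by (simp add: h.msrc_eq)
  show "mob (cons_op h) (a # vs) = a \<otimes>\<^bsub>S\<^esub> mob h vs"
    using tens_op_apply(1)[OF a vs, of S] assms by simp
  show "a' \<in> Ob A \<Longrightarrow> mdel (cons_op h) 0 (a # vs) a' = dl S a a' (mob h vs)"
    using tens_op_apply(3)[OF a vs, of 0 a' S] assms h.mob_in[OF assms(3)] by (simp add: h.mtgt_eq)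
  show "mdel (cons_op h) (Suc i) (a # vs) x' = ldel a (mob h vs) (mob h (vs[i := x'])) (mdel h i vs x')"
    if "i < length Cs" "x' \<in> Ob (Cs ! i)"
    using tens_op_apply(4)[OF a vs, of i x' S] assms that
    by (simp add: h.mtgt_eq h.msrc_eq ldel_def)
qed

lemma cons_op_mar:
  assumes "multilinear Cs D h" "f \<in> Ar A" "gs \<in> ars Cs"
  shows "mar (cons_op h) (f # gs) = f \<boxtimes>\<^bsub>S\<^esub> mar h gs"
  using tens_op_apply(2)[of "[f]" "mlin_unit A" gs h S] assms by (simp add: multilinear.msrc_eq)

lemma ldel_null:
  assumes "a \<in> Ob A" "x \<in> Ob D" "x' \<in> Ob D" "\<delta> \<in> Ar D" "Dom D \<delta> = x \<oplus> x'" "\<delta> = ident D y" "y \<in> Ob D"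
    and "x = \<zero> \<or> x' = \<zero>"
  shows "ldel a x x' \<delta> = ident D (a \<otimes>\<^bsub>S\<^esub> y)"
  using assms by (auto simp: ldel_def dr_null)

lemma ldel_zero:
  assumes "x \<in> Ob D" "x' \<in> Ob D" "\<delta> \<in> Ar D" "Dom D \<delta> = x \<oplus> x'"
  shows "ldel \<zero>\<^bsub>A\<^esub> x x' \<delta> = ident D \<zero>"
  using assms by (simp add: ldel_def dr_null null_ten)

text \<open>
  In the first variable the axioms are those for \<open>dl\<close>. In the other variables they are transferred
  from \<open>h\<close> by the lemmas on \<open>ldel\<close>.
\<close>

lemma multilinear_cons_op:
  assumes "multilinear Cs D h"
  shows "multilinear (A # Cs) D (cons_op h)"
proof -
  interpret h: multilinear Cs D h by fact
  have C: "category C" if "C \<in> set Cs" for C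
    using permutative.axioms(1)[OF h.src_permutative[OF that]] .
  note [simp] = cons_op_apply[OF assms] cons_op_mar[OF assms] h.mob_in h.mar_in h.mar_Dom h.mar_Cod
    h.mdel_simps h.mar_ident tuple_update tuple_nth prod_cat_closed[OF C]
  let ?c = "cons_op h" and ?Cs = "A # Cs"
  show ?thesis
  proof (rule multilinear.intro)
    show "permutative C" if "C \<in> set ?Cs" for C
      using that h.src_permutative A.permutative_axioms by auto
    show "permutative D" by (rule h.tgt_permutative)
    show "preserves_cat (prod_cat ?Cs) D (mob ?c) (mar ?c)"
      unfolding preserves_cat_def
      by (auto simp: Ob_prod_Cons Ar_prod_Cons hom_def h.mar_Comp ten_Comp)
  next
    fix xs i assume xs: "xs \<in> obs ?Cs" and i: "i < length ?Cs"
    from xs obtain a vs where [simp]: "xs = a # vs" "a \<in> Ob A" "vs \<in> obs Cs"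
      by (auto simp: Ob_prod_Cons)
    have [simp]: "length vs = length Cs" using length_tuple(1)[of vs Cs] by simp
    show "mob ?c xs = \<zero>" if "xs ! i = \<zero>\<^bsub>?Cs ! i\<^esub>"
      using i that h.mob_null[of vs "i - 1"] by (cases i) (auto simp: null_ten ten_null)
    fix c' assume c': "c' \<in> Ob (?Cs ! i)"
    have S: "c' \<in> Ob (Cs ! k)" "permutative (Cs ! k)" "k < length Cs" "vs ! k \<in> Ob (Cs ! k)"
      if "i = Suc k" for k
      using that i c' h.src_permutative by auto
    show "mdel ?c i xs c' \<in> hom D (mob ?c xs \<oplus> mob ?c (xs[i := c']))
         (mob ?c (xs[i := xs ! i \<oplus>\<^bsub>?Cs ! i\<^esub> c']))"
      using c' S by (cases i) (auto simp: hom_def permutative.sum_ob_in)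
    show "mdel ?c i xs c' = ident D (mob ?c (xs[i := xs ! i \<oplus>\<^bsub>?Cs ! i\<^esub> c']))"
      if "c' = \<zero>\<^bsub>?Cs ! i\<^esub> \<or> (\<exists>j<length ?Cs. xs ! j = \<zero>\<^bsub>?Cs ! j\<^esub>)"
    proof -
      have alt: "c' = \<zero>\<^bsub>?Cs ! i\<^esub> \<or> a = \<zero>\<^bsub>A\<^esub> \<or> (\<exists>j<length Cs. vs ! j = \<zero>\<^bsub>Cs ! j\<^esub>)"
        using that by (auto simp: less_Suc_eq_0_disj)
      have vs0: "mob h vs = \<zero>" if "\<exists>j<length Cs. vs ! j = \<zero>\<^bsub>Cs ! j\<^esub>"
        using that h.mob_null[of vs] by auto
      show ?thesis
      proof (cases i)
        case 0
        then have "a = \<zero>\<^bsub>A\<^esub> \<or> c' = \<zero>\<^bsub>A\<^esub> \<or> mob h vs = \<zero>" using alt vs0 by auto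
        then show ?thesis using 0 c' dl_null[of a c' "mob h vs"] by simp
      next
        case (Suc k)
        note [simp] = S[OF Suc] permutative.sum_ob_in
        have dn: "mdel h k vs c' = ident D (mob h (vs[k := vs ! k \<oplus>\<^bsub>Cs ! k\<^esub> c']))"
          if "c' = \<zero>\<^bsub>Cs ! k\<^esub> \<or> (\<exists>j<length Cs. vs ! j = \<zero>\<^bsub>Cs ! j\<^esub>)"
          by (rule h.mdel_null[OF _ _ _ that]) simp_all
        have ln: "ldel a (mob h vs) (mob h (vs[k := c'])) (mdel h k vs c')
          = ident D (a \<otimes>\<^bsub>S\<^esub> mob h (vs[k := vs ! k \<oplus>\<^bsub>Cs ! k\<^esub> c']))"
          if "c' = \<zero>\<^bsub>Cs ! k\<^esub> \<or> (\<exists>j<length Cs. vs ! j = \<zero>\<^bsub>Cs ! j\<^esub>)"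
          "mob h vs = \<zero> \<or> mob h (vs[k := c']) = \<zero>"
          by (rule ldel_null[OF _ _ _ _ _ dn[OF that(1)] _ that(2)]) simp_all
        consider "a = \<zero>\<^bsub>A\<^esub>" | "c' = \<zero>\<^bsub>Cs ! k\<^esub>" | "\<exists>j<length Cs. vs ! j = \<zero>\<^bsub>Cs ! j\<^esub>"
          using alt Suc by auto
        then show ?thesis
        proof cases
          case 1
          then show ?thesis by (simp add: Suc ldel_zero null_ten)
        next
          case 2
          have "vs[k := c'] \<in> obs Cs" "vs[k := c'] ! k = c'" by simp_all
          then have "mob h (vs[k := c']) = \<zero>" using 2 by (intro h.mob_null[of _ k]) simp_all
          then show ?thesis using ln[OF disjI1[OF 2]] by (simp add: Suc)
        next
          case 3
          then show ?thesis using ln[OF disjI2[OF 3] disjI1[OF vs0[OF 3]]] by (simp add: Suc)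
        qed
      qed
    qed
    show "mar ?c ((ident (prod_cat ?Cs) xs)[i := \<gamma>\<^bsub>?Cs ! i\<^esub> (xs ! i) c']) \<cdot> mdel ?c i xs c'
        = mdel ?c i (xs[i := c']) (xs ! i) \<cdot> \<gamma> (mob ?c xs) (mob ?c (xs[i := c']))"
    proof (cases i)
      case 0
      then show ?thesis using c' dl_gam[of a c' "mob h vs"] by simp
    next
      case (Suc k)
      note [simp] = S[OF Suc] permutative.sum_ob_in permutative.gam_simps
      show ?thesis
        using ldel_gam[of a "mob h vs" "mob h (vs[k := c'])" "mdel h k vs c'"
          "mdel h k (vs[k := c']) (vs ! k)"
          "mar h ((ident (prod_cat Cs) vs)[k := \<gamma>\<^bsub>Cs ! k\<^esub> (vs ! k) c'])"] h.mdel_gam[of vs k c']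
        by (simp add: Suc prod_cat_update prod_cat_ident[OF C])
    qed
    fix c'' assume c'': "c'' \<in> Ob (?Cs ! i)"
    show "mdel ?c i (xs[i := xs ! i \<oplus>\<^bsub>?Cs ! i\<^esub> c']) c''
          \<cdot> (mdel ?c i xs c' \<boxplus> ident D (mob ?c (xs[i := c''])))
          = mdel ?c i xs (c' \<oplus>\<^bsub>?Cs ! i\<^esub> c'')
          \<cdot> (ident D (mob ?c xs) \<boxplus> mdel ?c i (xs[i := c']) c'')"
    proof (cases i)
      case 0
      then show ?thesis using c' c'' dl_assoc[of a c' c'' "mob h vs"] by simp
    next
      case (Suc k)
      have c2: "c'' \<in> Ob (Cs ! k)" using c'' Suc by simp
      note [simp] = S[OF Suc] c2 permutative.sum_ob_in
      show ?thesis
        using ldel_assoc[of a "mob h vs" "mob h (vs[k := c'])" "mob h (vs[k := c''])" "mdel h k vs c'"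
          "mdel h k (vs[k := vs ! k \<oplus>\<^bsub>Cs ! k\<^esub> c']) c''" "mdel h k (vs[k := c']) c''"
          "mdel h k vs (c' \<oplus>\<^bsub>Cs ! k\<^esub> c'')",
          OF _ _ _ _ _ _ _ _ _ refl _ _ refl]
          h.mdel_assoc[of vs k c' c'']
        by (simp add: Suc)
    qed
  next
    fix fs i assume "fs \<in> ars ?Cs" and i: "i < length ?Cs"
    then obtain f gs where [simp]: "fs = f # gs" "f \<in> Ar A" "gs \<in> ars Cs"
      by (auto simp: Ar_prod_Cons)
    have [simp]: "length gs = length Cs" using length_tuple(2)[of gs Cs] by simp
    show "mar ?c fs = ident D \<zero>" if "fs ! i = ident (?Cs ! i) \<zero>\<^bsub>?Cs ! i\<^esub>"
      using that i by (cases i) (auto simp: null_ten ten_null h.mar_null)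
    fix f' assume f': "f' \<in> Ar (?Cs ! i)"
    show "mar ?c (fs[i := fs ! i \<boxplus>\<^bsub>?Cs ! i\<^esub> f'])
          \<cdot> mdel ?c i (Dom (prod_cat ?Cs) fs) (Dom (?Cs ! i) f')
          = mdel ?c i (Cod (prod_cat ?Cs) fs) (Cod (?Cs ! i) f')
          \<cdot> (mar ?c fs \<boxplus> mar ?c (fs[i := f']))"
    proof (cases i)
      case 0
      then show ?thesis using f' dl_natural[of f f' "mar h gs"] by simp
    next
      case (Suc k)
      have "f' \<in> Ar (Cs ! k)" "permutative (Cs ! k)" "k < length Cs" "gs ! k \<in> Ar (Cs ! k)"
        using Suc i f' h.src_permutative by auto
      note [simp] = this permutative.sum_ar_simps permutative.axioms(1) category.Dom_in category.Cod_in
      have dk: "Dom (prod_cat Cs) gs ! k = Dom (Cs ! k) (gs ! k)" "Cod (prod_cat Cs) gs ! k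
        = Cod (Cs ! k) (gs ! k)"
        by (simp_all add: prod_cat_simps)
      show ?thesis
        using ldel_natural[of f "mar h gs" "mar h (gs[k := f'])" "mar h (gs[k := gs ! k \<boxplus>\<^bsub>Cs ! k\<^esub> f'])"
          "mdel h k (Dom (prod_cat Cs) gs) (Dom (Cs ! k) f')"
          "mdel h k (Cod (prod_cat Cs) gs) (Cod (Cs ! k) f')"]
          h.mdel_natural[of gs k f']
        by (simp add: Suc prod_cat_update dk)
    qed
  next
    fix xs i j ci' cj' assume xs: "xs \<in> obs ?Cs"
      and ij: "i < length ?Cs" "j < length ?Cs" "i \<noteq> j"
      and ci': "ci' \<in> Ob (?Cs ! i)" and cj': "cj' \<in> Ob (?Cs ! j)"
    from xs obtain a vs where [simp]: "xs = a # vs" "a \<in> Ob A" "vs \<in> obs Cs"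
      by (auto simp: Ob_prod_Cons)
    have [simp]: "length vs = length Cs" using length_tuple(1)[of vs Cs] by simp
    have si: "ci' \<in> Ob (Cs ! k)" "permutative (Cs ! k)" "k < length Cs" "vs ! k \<in> Ob (Cs ! k)"
      if "i = Suc k" for k using that ij ci' h.src_permutative by auto
    have sj: "cj' \<in> Ob (Cs ! k)" "permutative (Cs ! k)" "k < length Cs" "vs ! k \<in> Ob (Cs ! k)"
      if "j = Suc k" for k using that ij cj' h.src_permutative by auto
    show "mdel ?c j (xs[i := xs ! i \<oplus>\<^bsub>?Cs ! i\<^esub> ci']) cj'
          \<cdot> (mdel ?c i xs ci' \<boxplus> mdel ?c i (xs[j := cj']) ci')
          = mdel ?c i (xs[j := xs ! j \<oplus>\<^bsub>?Cs ! j\<^esub> cj']) ci'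
          \<cdot> (mdel ?c j xs cj' \<boxplus> mdel ?c j (xs[i := ci']) cj')
          \<cdot> (ident D (mob ?c xs)
          \<boxplus> \<gamma> (mob ?c (xs[i := ci'])) (mob ?c (xs[j := cj']))
          \<boxplus> ident D (mob ?c (xs[i := ci', j := cj'])))"
    proof (cases i)
      case 0
      then obtain k where j: "j = Suc k" using ij by (cases j) auto
      note [simp] = sj[OF j] permutative.sum_ob_in
      show ?thesis
        using dl_ldel(2)[of a ci' "mob h vs" "mob h (vs[k := cj'])"
          "mdel h k vs cj'", OF _ _ _ _ _ _ refl] 0 j ci'
        by simp
    next
      case (Suc k)
      note i = this
      note [simp] = si[OF i] permutative.sum_ob_in
      show ?thesis
      proof (cases j)
        case 0
        then show ?thesis
          using dl_ldel(1)[of a cj' "mob h vs" "mob h (vs[k := ci'])"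
          "mdel h k vs ci'", OF _ _ _ _ _ _ refl] i cj'
          by simp
      next
        case (Suc l)
        note [simp] = sj[OF Suc]
        have kl: "k \<noteq> l" "l \<noteq> k" using ij i Suc by auto
        let ?h = "\<lambda>ws. mob h ws" and ?x = "vs ! k \<oplus>\<^bsub>Cs ! k\<^esub> ci'" and ?y = "vs ! l \<oplus>\<^bsub>Cs ! l\<^esub> cj'"
        have tw: "vs[l := y, k := x] = vs[k := x, l := y]" for x y using kl by (simp add: list_update_swap)
        show ?thesis
          using ldel_mdel[of a "?h vs" "?h (vs[k := ci'])" "?h (vs[l := cj'])" "?h (vs[k := ci', l := cj'])"
          "mdel h k vs ci'" "?h (vs[k := ?x])" "mdel h k (vs[l := cj']) ci'" "?h (vs[k := ?x, l := cj'])"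
          "mdel h l (vs[k := ?x]) cj'" "mdel h l vs cj'" "?h (vs[l := ?y])"
          "mdel h l (vs[k := ci']) cj'" "?h (vs[k := ci', l := ?y])"  "mdel h k (vs[l := ?y]) ci'"]
          h.mdel_mdel[of vs k l ci' cj'] kl
          by (simp add: i Suc tw)
      qed
    qed
  next
    have ext: "mlin_ext ?c" by simp
    show "mob ?c \<in> extensional (obs ?Cs)"
      "mar ?c \<in> extensional (ars ?Cs)"
      using ext by (simp_all add: mlin_ext_def h.msrc_eq)
    show "mdel ?c i cs c' = undefined"
      if "\<not> (i < length ?Cs \<and> cs \<in> obs ?Cs \<and> c' \<in> Ob (?Cs ! i))" for i cs c'
      using ext that unfolding mlin_ext_def by (simp add: h.msrc_eq)
  qed (simp_all add: h.msrc_eq h.mtgt_eq)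
qed

end

section \<open>Iterated tensor products\<close>

text \<open>
  An associative category acts on itself. Through this instance every result on modules below also
  applies to the operations of \<open>A\<close>.
\<close>

sublocale associative_category \<subseteq> left_tensor A A T e T ..

locale left_action = R: associative_category A T e + M: left_tensor A D T e S
  for A :: "('o, 'm) pcat" and T :: "('o, 'm) pairing" and e :: 'o
    and D :: "('o, 'm) pcat" (structure) and S :: "('o, 'm) pairing"
begin

abbreviation "cons_T \<equiv> tens_op T (mlin_unit A)"
abbreviation "cons_S \<equiv> tens_op S (mlin_unit A)"

lemma tens_op_nullary:
  assumes "multilinear Cs D h"
  shows "tens_op S (nullary_op A e) h = h"
proof -
  interpret h: multilinear Cs D h by fact
  note [simp] = h.msrc_eq h.mtgt_eq h.mob_in h.mar_in h.mdel_simps tuple_update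
  show ?thesis
  proof (rule mlin_eqI)
    show "mob (tens_op S (nullary_op A e) h) xs = mob h xs" if "xs \<in> obs (msrc h)" for xs
      using that tens_op_apply(1)[of "[]" "nullary_op A e" xs h S] by (simp add: M.unit_ten_ob)
    show "mar (tens_op S (nullary_op A e) h) xs = mar h xs" if "xs \<in> ars (msrc h)" for xs
      using that tens_op_apply(2)[of "[]" "nullary_op A e" xs h S] by (simp add: M.unit_ten_ar)
    show "mdel (tens_op S (nullary_op A e) h) i xs x' = mdel h i xs x'"
      if "i < length (msrc h)" "xs \<in> obs (msrc h)" "x' \<in> Ob (msrc h ! i)" for i xs x'
      using that tens_op_apply(4)[of "[]" "nullary_op A e" xs h i x' S]
      by (simp add: M.unit_ten_ar M.dr_unit)
  qed (simp_all add: h.mlin_ext)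
qed

text \<open>
  The distributivity maps of $(a \otimes f(x)) \otimes h(y)$ and $a \otimes (f(x) \otimes h(y))$ in a
  variable of \<open>f\<close>; this is where \<open>dr_dl\<close> is needed. The next lemma is the case of a variable of \<open>h\<close>.
\<close>

lemma ldel_ten:
  assumes "a \<in> Ob A" "x \<in> Ob A" "x' \<in> Ob A" "\<delta> \<in> Ar A" "Dom A \<delta> = x \<oplus>\<^bsub>A\<^esub> x'" "d \<in> Ob D"
  shows "(R.ldel a x x' \<delta> \<boxtimes>\<^bsub>S\<^esub> ident D d) \<cdot> dl S (a \<otimes>\<^bsub>T\<^esub> x) (a \<otimes>\<^bsub>T\<^esub> x') d
       = M.ldel a (x \<otimes>\<^bsub>S\<^esub> d) (x' \<otimes>\<^bsub>S\<^esub> d) ((\<delta> \<boxtimes>\<^bsub>S\<^esub> ident D d) \<cdot> dl S x x' d)"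
proof -
  let ?i = "ident A a" and ?d = "ident D d"
  have "(R.ldel a x x' \<delta> \<boxtimes>\<^bsub>S\<^esub> ?d) \<cdot> dl S (a \<otimes>\<^bsub>T\<^esub> x) (a \<otimes>\<^bsub>T\<^esub> x') d
      = (?i \<boxtimes>\<^bsub>S\<^esub> (\<delta> \<boxtimes>\<^bsub>S\<^esub> ?d)) \<cdot> ((dr T a x x' \<boxtimes>\<^bsub>S\<^esub> ?d) \<cdot> dl S (a \<otimes>\<^bsub>T\<^esub> x) (a \<otimes>\<^bsub>T\<^esub> x') d)"
    using assms by (simp add: R.ldel_def M.Comp_ten_ident M.D.assoc M.ten_ar_assoc M.ten_ob_assoc)
  also have "\<dots> = (?i \<boxtimes>\<^bsub>S\<^esub> (\<delta> \<boxtimes>\<^bsub>S\<^esub> ?d)) \<cdot> ((?i \<boxtimes>\<^bsub>S\<^esub> dl S x x' d) \<cdot> dr S a (x \<otimes>\<^bsub>S\<^esub> d) (x' \<otimes>\<^bsub>S\<^esub> d))"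
    using assms by (simp add: M.dr_dl)
  finally show ?thesis
    using assms by (simp add: M.ldel_def M.ident_ten_Comp M.D.assoc)
qed

lemma ldel_ten_right:
  assumes "a \<in> Ob A" "x \<in> Ob A" "y \<in> Ob D" "y' \<in> Ob D" "\<delta> \<in> Ar D" "Dom D \<delta> = y \<oplus> y'"
  shows "M.ldel (a \<otimes>\<^bsub>T\<^esub> x) y y' \<delta> = M.ldel a (x \<otimes>\<^bsub>S\<^esub> y) (x \<otimes>\<^bsub>S\<^esub> y') (M.ldel x y y' \<delta>)"
proof -
  have "ident A (a \<otimes>\<^bsub>T\<^esub> x) \<boxtimes>\<^bsub>S\<^esub> \<delta> = ident A a \<boxtimes>\<^bsub>S\<^esub> (ident A x \<boxtimes>\<^bsub>S\<^esub> \<delta>)"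
    using M.ten_ar_assoc[of "ident A a" "ident A x" \<delta>] assms by simp
  then show ?thesis
    using assms by (simp add: M.ldel_def M.dr_ten M.ident_ten_Comp M.D.assoc M.ten_ob_assoc)
qed

text \<open>
  Associativity as an equation between multilinear maps. The distributivity maps in the first
  variable, in the variables of \<open>f\<close> and in those of \<open>h\<close> agree by \<open>dl_ten\<close>, \<open>dr_dl\<close> and \<open>dr_ten\<close>.
\<close>

lemma tens_op_cons:
  assumes "multilinear Cs A f" "multilinear Ds D h" and fh: "multilinear (Cs @ Ds) D (tens_op S f h)"
  shows "tens_op S (cons_T f) h = cons_S (tens_op S f h)"
proof -
  interpret f: multilinear Cs A f by fact
  interpret h: multilinear Ds D h by fact
  note [simp] = h.msrc_eq h.mtgt_eq h.mob_in h.mar_in h.mdel_simps tuple_update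
    f.msrc_eq f.mtgt_eq f.mob_in f.mar_in f.mdel_simps prod_append
    M.cons_op_apply[OF fh] M.cons_op_mar[OF fh] R.cons_op_apply[OF assms(1)] R.cons_op_mar[OF assms(1)]
  have f_ob: "mob (tens_op S f h) (us @ vs) = mob f us \<otimes>\<^bsub>S\<^esub> mob h vs"
    if "us \<in> obs Cs" "vs \<in> obs Ds" for us vs
    using tens_op_apply(1)[of us f vs h S] that by simp
  have f_ar: "mar (tens_op S f h) (us @ vs) = mar f us \<boxtimes>\<^bsub>S\<^esub> mar h vs"
    if "us \<in> ars Cs" "vs \<in> ars Ds" for us vs
    using tens_op_apply(2)[of us f vs h S] that by simp
  let ?lhs = "tens_op S (cons_T f) h" and ?rhs = "cons_S (tens_op S f h)"
  show ?thesis
  proof (rule mlin_eqI)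
    show "mob ?lhs xs = mob ?rhs xs"
      if "xs \<in> obs (msrc ?rhs)" for xs
    proof -
      from that obtain a us vs where "xs = a # us @ vs" "a \<in> Ob A" "us \<in> obs Cs" "vs \<in> obs Ds"
        by (auto simp: Ob_prod_Cons dest!: prod_appendE(1))
      then show ?thesis using tens_op_apply(1)[of "a # us" "cons_T f" vs h S]
        by (simp add: M.ten_ob_assoc f_ob)
    qed
    show "mar ?lhs xs = mar ?rhs xs"
      if "xs \<in> ars (msrc ?rhs)" for xs
    proof -
      from that obtain a us vs where "xs = a # us @ vs" "a \<in> Ar A" "us \<in> ars Cs" "vs \<in> ars Ds"
        by (auto simp: Ar_prod_Cons dest!: prod_appendE(2))
      then show ?thesis using tens_op_apply(2)[of "a # us" "cons_T f" vs h S]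
        by (simp add: M.ten_ar_assoc f_ar)
    qed
    show "mdel ?lhs i xs x' = mdel ?rhs i xs x'"
      if i: "i < length (msrc ?rhs)"
        and xs: "xs \<in> obs (msrc ?rhs)"
        and x': "x' \<in> Ob (msrc ?rhs ! i)" for i xs x'
    proof -
      from xs obtain a us vs where [simp]: "xs = a # us @ vs" "a \<in> Ob A" "us \<in> obs Cs" "vs \<in> obs Ds"
        by (auto simp: Ob_prod_Cons dest!: prod_appendE(1))
      have [simp]: "length us = length Cs" using length_tuple(1)[of us Cs] by simp
      have "i = 0 \<or> (\<exists>j. i = Suc j \<and> j < length Cs) \<or> (\<exists>j. i = Suc (length Cs + j) \<and> j < length Ds)"
      proof -
        have "i < Suc (length Cs + length Ds)" using i by simp
        then show ?thesis by presburger
      qed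
      then consider "i = 0" | j where "i = Suc j" "j < length Cs" | j
        where "i = Suc (length Cs + j)" "j < length Ds"
        by blast
      then show ?thesis
      proof cases
        case 1
        then show ?thesis
          using tens_op_apply(3)[of "a # us" "cons_T f" vs h 0 x' S] x' M.dl_ten[of a x'
          "mob f us" "mob h vs"]
          by (simp add: f_ob)
      next
        case 2
        have [simp]: "x' \<in> Ob (Cs ! j)" "j < length Cs" using x' 2 by (simp_all add: nth_append)
        show ?thesis
          using tens_op_apply(3)[of "a # us" "cons_T f" vs h i x' S] tens_op_apply(3)[of us f vs h j x' S]
          ldel_ten[of a "mob f us" "mob f (us[j := x'])" "mdel f j us x'" "mob h vs"]
          by (simp add: 2 f_ob list_update_append nth_append trans_less_add1)
      next
        case 3
        have [simp]: "x' \<in> Ob (Ds ! j)" "j < length Ds" using x' 3 by (simp_all add: nth_append)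
        show ?thesis
          using tens_op_apply(4)[of "a # us" "cons_T f" vs h j x' S] tens_op_apply(4)[of us f vs h j x' S]
          ldel_ten_right[of a "mob f us" "mob h vs" "mob h (vs[j := x'])" "mdel h j vs x'"]
          by (simp add: 3 f_ob list_update_append nth_append M.ldel_def[symmetric])
      qed
    qed
  qed simp_all
qed

lemma multilinear_cons_pow:
  assumes "multilinear Cs D h"
  shows "multilinear (replicate n A @ Cs) D ((cons_S ^^ n) h)"
  by (induction n) (use assms M.multilinear_cons_op in auto)

end

context associative_category
begin

abbreviation word_T :: "nat \<Rightarrow> ('o, 'm) mlin" where
  "word_T k \<equiv> (tens_op T (mlin_unit A) ^^ k) (nullary_op A e)"

lemma left_action_self: "left_action A T e A T"
  by (intro left_action.intro associative_category_axioms left_tensor_axioms)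

lemma multilinear_word_T: "multilinear (replicate k A) A (word_T k)"
  using left_action.multilinear_cons_pow[OF left_action_self multilinear_nullary, of e k]
  by (simp add: A.permutative_axioms)

end

context left_action
begin

text \<open>
  Associativity, applied to the factors one after the other; the strict unit \<open>e\<close> at the end of the
  product is absorbed by \<open>h\<close>.
\<close>

lemma tens_op_cons_pow:
  assumes "multilinear Cs D h"
  shows "tens_op S (R.word_T n) h = (cons_S ^^ n) h"
proof (induction n)
  case 0
  show ?case using tens_op_nullary[OF assms] by simp
next
  case (Suc n)
  have "multilinear (replicate n A @ Cs) D (tens_op S (R.word_T n) h)"
    unfolding Suc.IH by (rule multilinear_cons_pow) fact
  from tens_op_cons[OF R.multilinear_word_T assms this] show ?case using Suc.IH by simp
qed

text \<open>
  The recursion that computes a multiproduct of iterated tensor products: the first inner map splits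
  off as a tensor factor.
\<close>

lemma mlin_Gam_cons_op:
  assumes "multilinear Gs D g" "multilinear Cs A f" and len: "length fs = length Gs"
    and ml: "\<And>p. p < length fs \<Longrightarrow> multilinear (msrc (fs ! p)) (Gs ! p) (fs ! p)"
  shows "mlin_Gam (cons_S g) (f # fs) = tens_op S f (mlin_Gam g fs)"
proof -
  interpret g: multilinear Gs D g by fact
  interpret f: multilinear Cs A f by fact
  note [simp] = g.msrc_eq g.mtgt_eq g.mob_in g.mar_in g.mdel_simps tuple_update
    f.msrc_eq f.mtgt_eq f.mob_in f.mar_in f.mdel_simps prod_append
    M.cons_op_apply[OF assms(1)] M.cons_op_mar[OF assms(1)]
  let ?js = "map (length \<circ> msrc) fs"
  let ?ys = "\<lambda>vs. map2 mob fs (blocks ?js vs)"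
  have C: "category C" if "C \<in> set Gs" for C
    using permutative.axioms(1)[OF g.src_permutative[OF that]] .
  have bo: "\<And>p. p < length fs \<Longrightarrow> blocks ?js vs ! p \<in> obs (msrc (fs ! p))"
    if "vs \<in> obs (concat (map msrc fs))" for vs
    using tuple_blocks(1)[OF that] by (auto simp: list_all2_conv_all_nth)
  have ba: "\<And>p. p < length fs \<Longrightarrow> blocks ?js vs ! p \<in> ars (msrc (fs ! p))"
    if "vs \<in> ars (concat (map msrc fs))" for vs
    using tuple_blocks(2)[OF that] by (auto simp: list_all2_conv_all_nth)
  have ys: "?ys vs \<in> obs Gs" if "vs \<in> obs (concat (map msrc fs))" for vs
    using bo[OF that] len multilinear.mob_in[OF ml] by (simp add: Ob_prod_cat list_all2_conv_all_nth)
  have yr: "map2 mar fs (blocks ?js vs) \<in> ars Gs" if "vs \<in> ars (concat (map msrc fs))" for vs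
    using ba[OF that] len multilinear.mar_in[OF ml] by (simp add: Ar_prod_cat list_all2_conv_all_nth)
  let ?lhs = "mlin_Gam (cons_S g) (f # fs)" and ?rhs = "tens_op S f (mlin_Gam g fs)"
  show ?thesis
  proof (rule mlin_eqI)
    show "mob ?lhs xs = mob ?rhs xs"
      if "xs \<in> obs (msrc ?rhs)" for xs
    proof -
      from that obtain us vs where [simp]: "xs = us @ vs" "us \<in> obs Cs" "vs \<in> obs (concat (map msrc fs))"
        by (auto dest!: prod_appendE(1))
      have [simp]: "length us = length Cs" using length_tuple(1)[of us Cs] by simp
      show ?thesis
        using tens_op_apply(1)[of us f vs "mlin_Gam g fs" S] mlin_Gam_apply(1)[of vs fs g]
          mlin_Gam_apply(1)[of "us @ vs" "f # fs" "cons_S g"] ys[of vs] by simp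
    qed
    show "mar ?lhs xs = mar ?rhs xs"
      if "xs \<in> ars (msrc ?rhs)" for xs
    proof -
      from that obtain us vs where [simp]: "xs = us @ vs" "us \<in> ars Cs" "vs \<in> ars (concat (map msrc fs))"
        by (auto dest!: prod_appendE(2))
      have [simp]: "length us = length Cs" using length_tuple(2)[of us Cs] by simp
      show ?thesis
        using tens_op_apply(2)[of us f vs "mlin_Gam g fs" S] mlin_Gam_apply(2)[of vs fs g]
          mlin_Gam_apply(2)[of "us @ vs" "f # fs" "cons_S g"] yr[of vs] by simp
    qed
    show "mdel ?lhs n xs x' = mdel ?rhs n xs x'"
      if n: "n < length (msrc ?rhs)"
        and xs: "xs \<in> obs (msrc ?rhs)"
        and x': "x' \<in> Ob (msrc ?rhs ! n)" for n xs x'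
    proof -
      from xs obtain us vs where [simp]: "xs = us @ vs" "us \<in> obs Cs" "vs \<in> obs (concat (map msrc fs))"
        by (auto dest!: prod_appendE(1))
      have [simp]: "length us = length Cs" using length_tuple(1)[of us Cs] by simp
      have lv: "length vs = sum_list ?js" using length_tuple(1)[of vs "concat (map msrc fs)"]
        by (simp add: length_concat)
      note [simp] = ys[of vs] prod_cat_closed(3)[OF C]
      show ?thesis
      proof (cases "n < length Cs")
        case True
        have [simp]: "x' \<in> Ob (Cs ! n)" using x' True by (simp add: nth_append)
        show ?thesis
          using tens_op_apply(3)[of us f vs "mlin_Gam g fs" n x' S] mlin_Gam_apply(1)[of vs fs g] True
          mlin_Gam_mdel[of 0 "f # fs" n "us @ vs" x' "us # blocks ?js vs" n
          "cons_S g"] g.mar_ident[of "?ys vs"]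
          by simp
      next
        case False
        then have m: "n - length Cs < sum_list ?js" using n by (simp add: length_concat)
        then obtain p q where p: "p < length ?js" "q < ?js ! p"
          and m: "n - length Cs = block_start ?js p + q"
          by (rule block_position)
        have [simp]: "p < length fs" "q < length (msrc (fs ! p))" "p < length Gs" using p len by simp_all
        note src = nth_concat_src[of p fs q]
        have nn: "n = length Cs + (block_start ?js p + q)" using False m by simp
        have x2: "x' \<in> Ob (msrc (fs ! p) ! q)" using x' src by (simp add: nn nth_append)
        interpret fp: multilinear "msrc (fs ! p)" "Gs ! p" "fs ! p" by (rule ml) simp
        let ?z = "blocks ?js vs ! p"
        have z: "?z \<in> obs (msrc (fs ! p))" using bo[of vs] by simp
        let ?y' = "mob (fs ! p) (?z[q := x'])" and ?d = "mdel (fs ! p) q ?z x'"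
        have y': "?y' \<in> Ob (Gs ! p)" using fp.mob_in tuple_update(1)[OF z x2] by simp
        have d: "?d \<in> Ar (Gs ! p)" using fp.mdel_simps[OF z _ x2] by simp
        have upd: "?ys (vs[block_start ?js p + q := x']) = (?ys vs)[p := ?y']"
          using blocks_update[OF lv p] by (auto intro!: nth_equalityI simp: nth_list_update)
        have vu: "vs[block_start ?js p + q := x'] \<in> obs (concat (map msrc fs))"
          using src x2 by (intro tuple_update) simp_all
        let ?ids = "(ident (prod_cat Gs) (?ys vs))[p := ?d]"
        have ids: "?ids \<in> ars Gs" using prod_cat_closed(3)[OF C] d by (intro tuple_update) simp_all
        have Gm: "mdel (mlin_Gam g fs) (block_start ?js p + q) vs x' = mar g ?ids \<cdot> mdel g p (?ys vs) ?y'"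
          using mlin_Gam_mdel[of p fs q vs x' "blocks ?js vs" _ g] x2 by simp
        have "Dom D (mar g ?ids) = Cod D (mdel g p (?ys vs) ?y')"
          using g.mar_Dom[OF ids] g.mdel_simps(3)[of "?ys vs" p ?y'] y' fp.mdel_simps(2)[OF z _ x2]
          by (simp add: prod_cat_update prod_cat_ident[OF C])
        then show ?thesis
          using tens_op_apply(4)[of us f vs "mlin_Gam g fs"
          "block_start ?js p + q" x' S] mlin_Gam_apply(1)[of vs fs g]
          mlin_Gam_apply(1)[OF vu, of g] src x2 y' ids
          mlin_Gam_mdel[of "Suc p" "f # fs" q "us @ vs" x' "us # blocks ?js vs" n "cons_S g"]
          by (simp add: nn upd Gm M.ldel_def M.ident_ten_Comp M.D.assoc)
      qed
    qed
  qed simp_all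
qed

text \<open>
  By \<open>mlin_Gam_cons_op\<close> each of the first inner maps splits off as a tensor factor, and by
  \<open>tens_op_cons_pow\<close> \<open>word_T k\<close> contributes \<open>k\<close> factors; so words are multiplied by
  concatenation. The maps \<open>ls\<close> are inserted in the variables of \<open>b\<close>, which is the constant \<open>e\<close> or the
  identity of \<open>D\<close> in the applications.
\<close>

lemma mlin_Gam_cons_pow:
  assumes "multilinear Bs D b" "length ls = length Bs"
    and "\<And>p. p < length ls \<Longrightarrow> multilinear (msrc (ls ! p)) (Bs ! p) (ls ! p)"
    and G: "multilinear Cs D (mlin_Gam b ls)"
  shows "mlin_Gam ((cons_S ^^ length ks) b) (map R.word_T ks @ ls)
       = (cons_S ^^ sum_list ks) (mlin_Gam b ls)"
proof (induction ks)
  case (Cons k ks)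
  let ?W = "\<lambda>k. R.word_T k" and ?W' = "map R.word_T ks"
  note W = R.multilinear_word_T
  have "mlin_Gam (cons_S ((cons_S ^^ length ks) b)) (?W k # (?W' @ ls))
      = tens_op S (?W k) (mlin_Gam ((cons_S ^^ length ks) b) (?W' @ ls))"
  proof (rule mlin_Gam_cons_op[OF multilinear_cons_pow[OF assms(1)] W])
    fix p assume p: "p < length (?W' @ ls)"
    show "multilinear (msrc ((?W' @ ls) ! p)) ((replicate (length ks) A @ Bs) ! p) ((?W' @ ls) ! p)"
    proof (cases "p < length ks")
      case True
      then show ?thesis using W[of "ks ! p"] by (simp add: nth_append multilinear.msrc_eq[OF W])
    next
      case False
      then show ?thesis using assms(3)[of "p - length ks"] p by (simp add: nth_append)
    qed
  qed (use assms(2) in simp)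
  also have "\<dots> = (cons_S ^^ k) ((cons_S ^^ sum_list ks) (mlin_Gam b ls))"
    unfolding Cons.IH by (rule tens_op_cons_pow[OF multilinear_cons_pow[OF G]])
  finally show ?case by (simp add: funpow_add)
qed simp

end

context associative_category
begin

lemma ten_list_in: "set as \<subseteq> Ob A \<Longrightarrow> ten_list T e as \<in> Ob A"
  by (induction as) (auto simp: ten_list_def)

lemma ten_list_append:
  "\<lbrakk>set as \<subseteq> Ob A; set bs \<subseteq> Ob A\<rbrakk>
    \<Longrightarrow> ten_list T e (as @ bs) = ten_list T e as \<otimes>\<^bsub>T\<^esub> ten_list T e bs"
  using ten_list_in[of bs]
  by (induction as) (auto simp: ten_list_def ten_ob_assoc unit_ten_ob ten_list_in[unfolded ten_list_def])

lemma replicate_tuple: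
  "as \<in> obs (replicate k A) \<longleftrightarrow> length as = k \<and> set as \<subseteq> Ob A"
  "fs \<in> ars (replicate k A) \<longleftrightarrow> length fs = k \<and> set fs \<subseteq> Ar A"
  by (auto simp: Ob_prod_cat Ar_prod_cat list_all2_conv_all_nth set_conv_nth)

lemma word_T_mob: "set as \<subseteq> Ob A \<Longrightarrow> mob (word_T (length as)) as = ten_list T e as"
proof (induction as)
  case (Cons a as)
  then show ?case
    using cons_op_apply(1)[OF multilinear_word_T[of "length as"], of a as]
    by (simp add: replicate_tuple ten_list_def)
qed (simp add: ten_list_def)

lemma word_T_mar: "set fs \<subseteq> Ar A \<Longrightarrow> mar (word_T (length fs)) fs = ten_list_ar A T e fs"
proof (induction fs)
  case (Cons f fs)
  then show ?case
    using cons_op_mar[OF multilinear_word_T[of "length fs"], of f fs]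
    by (simp add: replicate_tuple ten_list_ar_def)
qed (simp add: ten_list_ar_def)

text \<open>
  The recursion takes the factors on the left out of the sum first, one after the other, and the
  product \<open>y\<close> of the factors on the right last. The formula of the structure map takes out \<open>y\<close> first
  and then the product \<open>x\<close> at once. They agree by \<open>ldel_ten\<close>, which exchanges the order of the two
  sides, and by \<open>dr_ten\<close>, which combines the factors on the left.
\<close>

lemma word_T_mdel:
  assumes "set as \<subseteq> Ob A" "a' \<in> Ob A" "i < length as"
  defines "x \<equiv> ten_list T e (take i as)" and "y \<equiv> ten_list T e (drop (Suc i) as)"
  shows "mdel (word_T (length as)) i as a'
       = (dr T x (as ! i) a' \<boxtimes>\<^bsub>T\<^esub> ident A y) \<cdot>\<^bsub>A\<^esub> dl T (x \<otimes>\<^bsub>T\<^esub> as ! i) (x \<otimes>\<^bsub>T\<^esub> a') y"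
  using assms(1-3) unfolding x_def y_def
proof (induction as arbitrary: i)
  case (Cons a as)
  have a: "a \<in> Ob A" and as: "set as \<subseteq> Ob A" using Cons.prems by auto
  have as': "as \<in> obs (replicate (length as) A)" using as by (simp add: replicate_tuple)
  note ap = cons_op_apply[OF multilinear_word_T a as']
  show ?case
  proof (cases i)
    case 0
    then show ?thesis
      using ap(2)[of a'] a as Cons.prems ten_list_in[OF as]
      by (simp add: word_T_mob dr_unit unit_ten_ob ten_list_def)
  next
    case (Suc j)
    then have j: "j < length as" using Cons.prems by simp
    let ?x = "ten_list T e (take j as)" and ?y = "ten_list T e (drop (Suc j) as)"
    have sub: "set (take j as) \<subseteq> Ob A" "set (drop (Suc j) as) \<subseteq> Ob A" "as ! j \<in> Ob A"
      using as j by (auto dest: in_set_takeD in_set_dropD)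
    note xy = ten_list_in[OF sub(1)] ten_list_in[OF sub(2)]
    have split: "ten_list T e (as[j := b]) = ?x \<otimes>\<^bsub>T\<^esub> b \<otimes>\<^bsub>T\<^esub> ?y" if "b \<in> Ob A" for b
    proof -
      have "as[j := b] = take j as @ b # drop (Suc j) as" using j by (simp add: upd_conv_take_nth_drop)
      then show ?thesis
        using ten_list_append[of "take j as" "b # drop (Suc j) as"] sub that xy
        by (simp add: ten_list_def ten_ob_assoc)
    qed
    have m1: "mob (word_T (length as)) as = ?x \<otimes>\<^bsub>T\<^esub> as ! j \<otimes>\<^bsub>T\<^esub> ?y"
      using split[OF sub(3)] as by (simp add: word_T_mob)
    have m2: "mob (word_T (length as)) (as[j := a']) = ?x \<otimes>\<^bsub>T\<^esub> a' \<otimes>\<^bsub>T\<^esub> ?y"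
      using split[OF Cons.prems(2)] word_T_mob[of "as[j := a']"] as Cons.prems(2)
      by (simp add: set_update_subsetI)
    have dr: "dr T (a \<otimes>\<^bsub>T\<^esub> ?x) (as ! j) a' = ldel a (?x \<otimes>\<^bsub>T\<^esub> as ! j) (?x \<otimes>\<^bsub>T\<^esub> a') (dr T ?x (as ! j) a')"
      using a xy sub Cons.prems by (simp add: ldel_def dr_ten)
    show ?thesis
      using ap(3)[of j a'] Cons.IH[OF as Cons.prems(2) j] m1 m2 j Cons.prems(2) xy sub(3) a
        left_action.ldel_ten[OF left_action_self a, of "?x \<otimes>\<^bsub>T\<^esub> as ! j" "?x \<otimes>\<^bsub>T\<^esub> a'"
          "dr T ?x (as ! j) a'" ?y] dr
      by (simp add: Suc ten_list_def ten_ob_assoc)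
  qed
qed simp

lemma permute_replicate: "permute_list \<sigma> (replicate k x) = replicate k x" if "\<sigma> permutes {..<k}"
  using inv_permutes_lt(1)[OF that] by (auto intro!: nth_equalityI simp: permute_list_nth that)

lemma structure_op_eq:
  assumes \<sigma>: "\<sigma> permutes {..<k}"
  shows "structure_op A T e k \<sigma> = mlin_act \<sigma> (word_T k)"
proof (rule mlin_eqI)
  have src: "msrc (word_T k) = replicate k A" "mtgt (word_T k) = A"
    using multilinear_word_T multilinear.msrc_eq multilinear.mtgt_eq by blast+
  note [simp] = src permute_replicate[OF \<sigma>] replicate_tuple
  have i\<sigma>: "inv \<sigma> permutes {..<k}" using \<sigma> by (rule permutes_inv)
  show "mlin_ext (structure_op A T e k \<sigma>)"
    by (auto simp: mlin_ext_def structure_op_def Let_def)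
  show "msrc (structure_op A T e k \<sigma>) = msrc (mlin_act \<sigma> (word_T k))"
    "mtgt (structure_op A T e k \<sigma>) = mtgt (mlin_act \<sigma> (word_T k))"
    by (simp_all add: structure_op_def Let_def)
  show "mob (structure_op A T e k \<sigma>) as = mob (mlin_act \<sigma> (word_T k)) as"
    if "as \<in> obs (msrc (mlin_act \<sigma> (word_T k)))" for as
    using that word_T_mob[of "permute_list (inv \<sigma>) as"] i\<sigma>
    by (simp add: structure_op_def Let_def mlin_act_apply)
  show "mar (structure_op A T e k \<sigma>) as = mar (mlin_act \<sigma> (word_T k)) as"
    if "as \<in> ars (msrc (mlin_act \<sigma> (word_T k)))" for as
    using that word_T_mar[of "permute_list (inv \<sigma>) as"] i\<sigma>
    by (simp add: structure_op_def Let_def mlin_act_apply)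
  show "mdel (structure_op A T e k \<sigma>) i as a' = mdel (mlin_act \<sigma> (word_T k)) i as a'"
    if "i < length (msrc (mlin_act \<sigma> (word_T k)))" "as \<in> obs (msrc (mlin_act \<sigma> (word_T k)))"
      "a' \<in> Ob (msrc (mlin_act \<sigma> (word_T k)) ! i)" for i as a'
    using that word_T_mdel[of "permute_list (inv \<sigma>) as" a' "\<sigma> i"] i\<sigma> inv_permutes_lt(1)[OF \<sigma>, of i]
      nth_permute_inv(2)[of \<sigma> as i] \<sigma>
    by (simp add: structure_op_def Let_def mlin_act_apply)
qed simp

end

section \<open>Operations of the two-coloured multicategory as permuted words\<close>

text \<open>
  The source of an operation with target \<open>c\<close> and \<open>n\<close> inputs of colour $A$, in the order in which
  the inputs are multiplied.
\<close>

definition word :: "lcolor \<Rightarrow> nat \<Rightarrow> lcolor list" where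
  "word c n = replicate n ColA @ (case c of ColA \<Rightarrow> [] | ColM \<Rightarrow> [ColM])"

lemma count_word [simp]: "count_list (word c n) ColA = n"
proof -
  have "count_list (replicate n x) x = n" for x :: lcolor by (induction n) auto
  then show ?thesis by (cases c) (simp_all add: word_def)
qed

lemma count_list_permute: "\<sigma> permutes {..<length xs} \<Longrightarrow> count_list (permute_list \<sigma> xs) x = count_list xs x"
  by (metis count_mset mset_permute_list)

lemma lM_simps [simp]:
  "colors lM = UNIV" "source lM = fst" "target lM = fst \<circ> snd" "unit_op lM c = ([c], c, id)"
  "act_ob lM = cperm_act" "act_ar lM = cperm_act" "Gam_ob lM = cperm_Gam" "Gam_ar lM = cperm_Gam"
  "Ar (ops lM) = Ob (ops lM)" "Dom (ops lM) x = x" "Cod (ops lM) x = x" "ident (ops lM) x = x"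
  "x \<cdot>\<^bsub>ops lM\<^esub> y = x"
  by (simp_all add: lM_def cperm_multicat_def discrete_cat_def)

lemma Sigma_simps [simp]:
  "colors Sigma_operad = UNIV" "Ar (ops Sigma_operad) = Ob (ops Sigma_operad)"
  "Ob (ops Sigma_operad) = {(us, (), \<sigma>) | us \<sigma>. \<sigma> permutes {..<length us}}"
  by (simp_all add: Sigma_operad_def cperm_multicat_def discrete_cat_def)

text \<open>
  The condition $\sigma(j) = k$ says that \<open>\<sigma>\<close> moves the input $M$ to the last place, so that undoing
  \<open>\<sigma>\<close> turns the source into a word. This description treats both kinds of operations alike.
\<close>

lemma Ob_lM: "Ob (ops lM) = {(permute_list \<sigma> (word c n), c, \<sigma>) | c n \<sigma>. \<sigma> permutes {..<length (word c n)}}"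
  (is "_ = ?X")
proof -
  have A: "permute_list \<sigma> (replicate k ColA) = replicate k ColA" if "\<sigma> permutes {..<k}" for \<sigma> k
    using inv_permutes_lt(1)[OF that] by (auto intro!: nth_equalityI simp: permute_list_nth that)
  have M: "permute_list \<sigma> (word ColM n) = (replicate (Suc n) ColA)[j := ColM]"
    if \<sigma>: "\<sigma> permutes {..<Suc n}" and j: "\<sigma> j = n" for \<sigma> n j
  proof (rule nth_equalityI)
    fix i assume "i < length (permute_list \<sigma> (word ColM n))"
    then have i: "i < Suc n" by (simp add: word_def)
    have "\<sigma> i = n \<longleftrightarrow> i = j" using j \<sigma> by (metis permutes_inverses(2))
    moreover have "\<sigma> i < Suc n" using inv_permutes_lt(1)[OF \<sigma> i] .
    ultimately show "permute_list \<sigma> (word ColM n) ! i = (replicate (Suc n) ColA)[j := ColM] ! i"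
      using i \<sigma> by (auto simp: permute_list_nth word_def nth_append nth_list_update simp del: replicate_Suc)
  qed (simp add: word_def del: replicate_Suc)
  have "Ob (ops lM) = {(replicate k ColA, ColA, \<sigma>) | k \<sigma>. \<sigma> permutes {..<k}} \<union>
      {((replicate k ColA)[j := ColM], ColM, \<sigma>) | k j \<sigma>. j < k \<and> \<sigma> permutes {..<k} \<and> \<sigma> j = k - 1}"
    by (simp add: lM_def cperm_multicat_def discrete_cat_def)
  also have "\<dots> = ?X"
  proof (intro equalityI subsetI)
    fix x assume "x \<in> {(replicate k ColA, ColA, \<sigma>) | k \<sigma>. \<sigma> permutes {..<k}} \<union>
      {((replicate k ColA)[j := ColM], ColM, \<sigma>) | k j \<sigma>. j < k \<and> \<sigma> permutes {..<k} \<and> \<sigma> j = k - 1}"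
    then consider k \<sigma> where "x = (replicate k ColA, ColA, \<sigma>)" "\<sigma> permutes {..<k}"
      | k j \<sigma> where "x = ((replicate k ColA)[j := ColM], ColM, \<sigma>)" "j < k" "\<sigma> permutes {..<k}" "\<sigma> j = k - 1"
      by blast
    then show "x \<in> ?X"
    proof cases
      case 1
      then have "x = (permute_list \<sigma> (word ColA k), ColA, \<sigma>) \<and> \<sigma> permutes {..<length (word ColA k)}"
        using A by (simp add: word_def)
      then show ?thesis by blast
    next
      case 2
      then obtain n where "k = Suc n" by (cases k) auto
      then have "x = (permute_list \<sigma> (word ColM n), ColM, \<sigma>) \<and> \<sigma> permutes {..<length (word ColM n)}"
        using 2 M[of \<sigma> n j] by (simp add: word_def)
      then show ?thesis by blast
    qed
  next
    fix x assume "x \<in> ?X"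
    then obtain c n \<sigma> where x: "x = (permute_list \<sigma> (word c n), c, \<sigma>)"
      and \<sigma>: "\<sigma> permutes {..<length (word c n)}"
      by blast
    show "x \<in> {(replicate k ColA, ColA, \<sigma>) | k \<sigma>. \<sigma> permutes {..<k}} \<union>
      {((replicate k ColA)[j := ColM], ColM, \<sigma>) | k j \<sigma>. j < k \<and> \<sigma> permutes {..<k} \<and> \<sigma> j = k - 1}"
    proof (cases c)
      case ColA
      then show ?thesis using x \<sigma> A[of \<sigma> n] by (auto simp: word_def)
    next
      case ColM
      then have s: "\<sigma> permutes {..<Suc n}" using \<sigma> by (simp add: word_def)
      have "inv \<sigma> n < Suc n" "\<sigma> (inv \<sigma> n) = n" using inv_permutes_lt[OF s, of n] by auto
      then have "x = ((replicate (Suc n) ColA)[inv \<sigma> n := ColM], ColM, \<sigma>)" "\<sigma> (inv \<sigma> n) = Suc n - 1"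
        using x ColM M[OF s, of "inv \<sigma> n"] by auto
      then show ?thesis using s \<open>inv \<sigma> n < Suc n\<close> by blast
    qed
  qed
  finally show ?thesis .
qed

lemma lM_opI: "\<sigma> permutes {..<length (word c n)} \<Longrightarrow> (permute_list \<sigma> (word c n), c, \<sigma>) \<in> Ob (ops lM)"
  by (auto simp: Ob_lM)

lemma lM_opE:
  assumes "x \<in> Ob (ops lM)"
  obtains c n \<sigma> where "x = (permute_list \<sigma> (word c n), c, \<sigma>)" "\<sigma> permutes {..<length (word c n)}"
  using assms by (auto simp: Ob_lM)

text \<open>
  The last one of the words is the only one that can contain $M$, so their concatenation is a word.
\<close>

lemma concat_words:
  assumes "length ms = length (word c n)"
  shows "concat (map2 word (word c n) ms) = word c (sum_list ms)"
proof -
  have A: "concat (map2 word (replicate (length ks) ColA) ks) = replicate (sum_list ks) ColA" for ks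
    by (induction ks) (auto simp: word_def replicate_add)
  show ?thesis
  proof (cases c)
    case ColA
    then show ?thesis using assms A[of ms] by (simp add: word_def)
  next
    case ColM
    then obtain ks k where ms: "ms = ks @ [k]" "length ks = n"
      using assms by (cases ms rule: rev_cases) (auto simp: word_def)
    then show ?thesis using ColM A[of ks] by (auto simp: word_def replicate_add)
  qed
qed

lemma PermCat_simps [simp]:
  "colors PermCat = {C. permutative C}" "ops PermCat = mlin_cat" "source PermCat
    = msrc" "target PermCat = mtgt"
  "unit_op PermCat = mlin_unit" "act_ob PermCat = mlin_act" "act_ar PermCat = mtrans_act"
  "Gam_ob PermCat = mlin_Gam" "Gam_ar PermCat = mtrans_Gam"
  by (simp_all add: PermCat_def)

section \<open>The multifunctor of a left module\<close>

context left_action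
begin

definition on_col :: "lcolor \<Rightarrow> ('o, 'm) pcat" where
  "on_col c = (case c of ColA \<Rightarrow> A | ColM \<Rightarrow> D)"

definition word_op :: "lcolor \<Rightarrow> nat \<Rightarrow> ('o, 'm) mlin" where
  "word_op c n = (case c of ColA \<Rightarrow> R.word_T n | ColM \<Rightarrow> (cons_S ^^ n) (mlin_unit D))"

lemma multilinear_word_op: "multilinear (map on_col (word c n)) (on_col c) (word_op c n)"
  using R.multilinear_word_T[of n] multilinear_cons_pow[OF multilinear_unit[OF
    M.D.permutative_axioms], of n]
  by (cases c) (simp_all add: word_op_def word_def on_col_def)

lemma word_op_src [simp]: "msrc (word_op c n) = map on_col (word c n)" "mtgt (word_op c n) = on_col c"
  using multilinear_word_op[of c n] multilinear.msrc_eq multilinear.mtgt_eq by blast+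

lemma multilinear_word_op': "multilinear (msrc (word_op c n)) (mtgt (word_op c n)) (word_op c n)"
  using multilinear_word_op by simp

lemma mlin_Gam_word_op:
  assumes "length ms = length (word c n)"
  shows "mlin_Gam (word_op c n) (map2 word_op (word c n) ms) = word_op c (sum_list ms)"
proof (cases c)
  case ColA
  interpret RR: left_action A T e A T by (rule R.left_action_self)
  have "length ms = n" using assms ColA by (simp add: word_def)
  moreover have "map2 word_op (replicate (length ms) ColA) ms = map R.word_T ms"
    by (auto intro!: nth_equalityI simp: word_op_def)
  ultimately show ?thesis
    using RR.mlin_Gam_cons_pow[of "[]" "nullary_op A e" "[]" "[]" ms] ColA
      multilinear_nullary[OF R.A.permutative_axioms R.unit_in]
    by (simp add: word_def word_op_def mlin_Gam_nullary)
next
  case ColM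
  then obtain ks k where ms: "ms = ks @ [k]" "length ks = n"
    using assms by (cases ms rule: rev_cases) (auto simp: word_def)
  have w: "multilinear (map on_col (word ColM k)) D (word_op ColM k)"
    using multilinear_word_op[of ColM k] by (simp add: on_col_def)
  have "map2 word_op (replicate (length ks) ColA) ks = map R.word_T ks"
    by (auto intro!: nth_equalityI simp: word_op_def)
  moreover have "mlin_Gam ((cons_S ^^ length ks) (mlin_unit D)) (map R.word_T ks @ [word_op ColM k])
      = (cons_S ^^ sum_list ks) (mlin_Gam (mlin_unit D) [word_op ColM k])"
    by (rule mlin_Gam_cons_pow[OF multilinear_unit[OF M.D.permutative_axioms]])
       (use w mlin_Gam_unit[OF w] in \<open>simp_all add: on_col_def\<close>)
  ultimately show ?thesis
    using ColM ms mlin_Gam_unit[OF w] by (simp add: word_def word_op_def funpow_add)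
qed

text \<open>
  The number of inputs of colour $A$ does not depend on their order and recovers the length of the
  word from the permuted source.
\<close>

definition op_of :: "lcolor cperm \<Rightarrow> ('o, 'm) mlin" where
  "op_of = (\<lambda>(cs, c, \<sigma>). mlin_act \<sigma> (word_op c (count_list cs ColA)))"

lemma op_of_word:
  "\<sigma> permutes {..<length (word c n)} \<Longrightarrow> op_of (permute_list \<sigma> (word c n), c, \<sigma>) = mlin_act \<sigma> (word_op c n)"
  by (simp add: op_of_def count_list_permute)

lemma op_of_multilinear:
  assumes "x \<in> Ob (ops lM)"
  shows "multilinear (map on_col (fst x)) (on_col (fst (snd x))) (op_of x)"
    and "msrc (op_of x) = map on_col (fst x)" "mtgt (op_of x) = on_col (fst (snd x))"
proof -
  obtain c n \<sigma> where x: "x = (permute_list \<sigma> (word c n), c, \<sigma>)" and \<sigma>: "\<sigma> permutes {..<length (word c n)}"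
    using assms by (rule lM_opE)
  show *: "multilinear (map on_col (fst x)) (on_col (fst (snd x))) (op_of x)"
    using multilinear_mlin_act[OF multilinear_word_op[of c n], of \<sigma>] \<sigma> x
    by (simp add: op_of_word permute_list_map)
  show "msrc (op_of x) = map on_col (fst x)" "mtgt (op_of x) = on_col (fst (snd x))"
    using multilinear.msrc_eq[OF *] multilinear.mtgt_eq[OF *] by auto
qed

text \<open>
  Write \<open>g\<close> and the entries of \<open>fs\<close> as permuted words. By equivariance the multiproduct of their
  images is the permutation \<open>\<rho>\<close> applied to a multiproduct of word operations, which is the operation
  of a word by \<open>mlin_Gam_word_op\<close>. On the other side, \<open>\<rho>\<close> is the permutation of the multiproduct in
  \<open>lM\<close>, and undoing it in the source of that operation gives the same word by \<open>concat_words\<close>.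
\<close>

lemma op_of_Gam:
  assumes g: "g \<in> Ob (ops lM)" and fs: "set fs \<subseteq> Ob (ops lM)" and tgt: "map (fst \<circ> snd) fs = fst g"
  shows "cperm_Gam g fs \<in> Ob (ops lM)" "op_of (cperm_Gam g fs) = mlin_Gam (op_of g) (map op_of fs)"
proof -
  obtain c n \<sigma> where g: "g = (permute_list \<sigma> (word c n), c, \<sigma>)" and \<sigma>: "\<sigma> permutes {..<length (word c n)}"
    using g by (rule lM_opE)
  let ?cs = "map (fst \<circ> snd) fs"
  define ns where "ns = map (\<lambda>f. count_list (fst f) ColA) fs"
  define \<phi>s where "\<phi>s = map (snd \<circ> snd) fs"
  define ws where "ws = map2 word ?cs ns"
  define Fs where "Fs = map2 word_op ?cs ns"
  define js where "js = map (length \<circ> fst) fs"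
  define \<rho> where "\<rho> = Gamma_perm \<sigma> js \<phi>s"
  define ms where "ms = permute_list (inv \<sigma>) ns"
  have cs: "?cs = permute_list \<sigma> (word c n)" using tgt g by simp
  have len: "length fs = length (word c n)" using arg_cong[OF cs, of length] by simp
  have \<sigma>f: "\<sigma> permutes {..<length fs}" using \<sigma> len by simp
  have op: "fst (fs ! p) = permute_list (\<phi>s ! p) (ws ! p)" "(\<phi>s ! p) permutes {..<length (ws ! p)}"
    "op_of (fs ! p) = mlin_act (\<phi>s ! p) (Fs ! p)" if "p < length fs" for p
  proof -
    have "fs ! p \<in> Ob (ops lM)" using fs that by auto
    then obtain c' n' \<phi> where f: "fs ! p = (permute_list \<phi> (word c' n'), c', \<phi>)"
      and \<phi>: "\<phi> permutes {..<length (word c' n')}"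
      by (rule lM_opE)
    have "ns ! p = n'" using that f \<phi> by (simp add: ns_def count_list_permute)
    then have "ws ! p = word c' n'" "Fs ! p = word_op c' n'" "\<phi>s ! p = \<phi>"
      using that f by (simp_all add: ws_def Fs_def ns_def \<phi>s_def)
    then show "fst (fs ! p) = permute_list (\<phi>s ! p) (ws ! p)" "(\<phi>s ! p) permutes {..<length (ws ! p)}"
      "op_of (fs ! p) = mlin_act (\<phi>s ! p) (Fs ! p)"
      using f \<phi> by (simp_all add: op_of_word)
  qed
  have lens: "length ws = length fs" "length Fs = length fs" "length \<phi>s = length fs" "length ns = length fs"
    by (simp_all add: ws_def Fs_def \<phi>s_def ns_def)
  have \<phi>: "(\<phi>s ! p) permutes {..<length (fst (fs ! p))}" if "p < length fs" for p
    using op[OF that] by simp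
  have Fw: "msrc (Fs ! p) = map on_col (ws ! p)" "mtgt (Fs ! p) = on_col (?cs ! p)"
    "multilinear (msrc (Fs ! p)) (mtgt (Fs ! p)) (Fs ! p)" if "p < length fs" for p
    using that multilinear_word_op' by (simp_all add: Fs_def ws_def ns_def)
  have jsF: "js = map (length \<circ> msrc) Fs" "js = map length (map fst fs)"
    using op lens Fw by (auto intro!: nth_equalityI simp: js_def)
  have jsw: "length js = length fs" by (simp add: js_def)
  have Gam: "cperm_Gam g fs = (concat (map fst fs), c, \<rho>)"
    by (simp add: cperm_Gam_def g Let_def \<rho>_def js_def \<phi>s_def)
  have lm: "length ms = length (word c n)" by (simp add: ms_def ns_def len)
  have i\<sigma>: "inv \<sigma> permutes {..<length fs}" using \<sigma>f by (rule permutes_inv)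
  have pcs: "permute_list (inv \<sigma>) ?cs = word c n" unfolding cs using \<sigma> by (simp add: permute_list_cancel)
  have pws: "permute_list (inv \<sigma>) ws = map2 word (word c n) ms"
    unfolding ws_def ms_def using permute_map2[of "inv \<sigma>" ?cs ns word] i\<sigma> lens pcs by simp
  have pFs: "permute_list (inv \<sigma>) Fs = map2 word_op (word c n) ms"
    unfolding Fs_def ms_def using permute_map2[of "inv \<sigma>" ?cs ns word_op] i\<sigma> lens pcs by simp
  have \<rho>: "\<rho> permutes {..<length (concat (map fst fs))}"
    unfolding \<rho>_def length_concat jsF(2)[symmetric]
    by (rule Gamma_perm_permutes) (use \<sigma>f lens \<phi> jsw in \<open>auto simp: js_def\<close>)
  have "permute_list (inv \<rho>) (concat (map fst fs))
      = concat (permute_list (inv \<sigma>) (permute_blocks \<phi>s (map fst fs)))"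
    unfolding \<rho>_def jsF(2) by (rule permute_list_Gamma_perm) (use \<sigma>f lens \<phi> in auto)
  also have "permute_blocks \<phi>s (map fst fs) = ws"
    by (rule nth_equalityI) (use lens op in \<open>auto simp: permute_list_cancel\<close>)
  finally have inv\<rho>: "permute_list (inv \<rho>) (concat (map fst fs)) = word c (sum_list ms)"
    using concat_words[OF lm] pws by simp
  then have src: "concat (map fst fs) = permute_list \<rho> (word c (sum_list ms))"
    using \<rho> by (metis permute_list_cancel(1))
  have \<rho>w: "\<rho> permutes {..<length (word c (sum_list ms))}"
    using \<rho> inv\<rho> by (metis length_permute_list)
  show "cperm_Gam g fs \<in> Ob (ops lM)" unfolding Gam src using lM_opI[OF \<rho>w] .
  have "mlin_Gam (op_of g) (map op_of fs) = mlin_Gam (mlin_act \<sigma> (word_op c n)) (map2 mlin_act \<phi>s Fs)"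
  proof -
    have "map op_of fs = map2 mlin_act \<phi>s Fs"
      by (rule nth_equalityI) (use lens op in auto)
    then show ?thesis using op_of_word[OF \<sigma>] g by simp
  qed
  also have "\<dots> = mlin_act \<rho> (mlin_Gam (word_op c n) (permute_list (inv \<sigma>) Fs))"
    unfolding \<rho>_def jsF(1)
  proof (rule mlin_Gam_act)
    show "multilinear (msrc (Fs ! p)) (msrc (word_op c n) ! \<sigma> p) (Fs ! p)" if "p < length Fs" for p
    proof -
      have p: "p < length fs" using that lens by simp
      have "?cs ! p = word c n ! \<sigma> p" using p \<sigma> len cs nth_permute_inv(3)[OF \<sigma>, of p] by simp
      then show ?thesis using Fw[OF p] inv_permutes_lt(1)[OF \<sigma>f p] len by simp
    qed
    show "(\<phi>s ! p) permutes {..<length (msrc (Fs ! p))}" if "p < length Fs" for p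
      using that lens op(2)[of p] Fw(1)[of p] by simp
  qed (use \<sigma> lens len multilinear_word_op' in simp_all)
  also have "\<dots> = mlin_act \<rho> (word_op c (sum_list ms))"
    unfolding pFs using mlin_Gam_word_op[OF lm] by simp
  also have "\<dots> = op_of (cperm_Gam g fs)"
    unfolding Gam src using op_of_word[OF \<rho>w] by simp
  finally show "op_of (cperm_Gam g fs) = mlin_Gam (op_of g) (map op_of fs)" by simp
qed

lemma op_of_act:
  assumes x: "x \<in> Ob (ops lM)" and \<tau>: "\<tau> permutes {..<length (fst x)}"
  shows "cperm_act \<tau> x \<in> Ob (ops lM)" "op_of (cperm_act \<tau> x) = mlin_act \<tau> (op_of x)"
proof -
  obtain c n \<sigma> where x: "x = (permute_list \<sigma> (word c n), c, \<sigma>)" and \<sigma>: "\<sigma> permutes {..<length (word c n)}"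
    using x by (rule lM_opE)
  have \<tau>: "\<tau> permutes {..<length (word c n)}" using \<tau> x by simp
  have \<sigma>\<tau>: "(\<sigma> \<circ> \<tau>) permutes {..<length (word c n)}" by (rule permutes_compose[OF \<tau> \<sigma>])
  have c: "cperm_act \<tau> x = (permute_list (\<sigma> \<circ> \<tau>) (word c n), c, \<sigma> \<circ> \<tau>)"
    using x \<tau> by (simp add: cperm_act_def permute_list_compose)
  show "cperm_act \<tau> x \<in> Ob (ops lM)" unfolding c by (rule lM_opI[OF \<sigma>\<tau>])
  show "op_of (cperm_act \<tau> x) = mlin_act \<tau> (op_of x)"
    using c x op_of_word[OF \<sigma>] op_of_word[OF \<sigma>\<tau>] mlin_act_act[of \<sigma> "word_op c n" \<tau>] \<sigma> \<tau> by simp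
qed

text \<open>
  For the colour $A$ the word operation of length 1 is $a \otimes e$ and not $a$; they are the same
  linear map because \<open>e\<close> is a strict right unit, which includes \<open>dl_unit\<close>.
\<close>

lemma op_of_unit: "([c], c, id) \<in> Ob (ops lM)" "op_of ([c], c, id) = mlin_unit (on_col c)"
proof -
  have w: "[c] = word c (case c of ColA \<Rightarrow> 1 | ColM \<Rightarrow> 0)" by (cases c) (simp_all add: word_def)
  show "([c], c, id) \<in> Ob (ops lM)"
    using lM_opI[of id c "case c of ColA \<Rightarrow> 1 | ColM \<Rightarrow> 0"] w by (simp add: permutes_id)
  have A: "tens_op T (mlin_unit A) (nullary_op A e) = mlin_unit A"
  proof (rule mlin_eqI)
    note ap = R.cons_op_apply[OF multilinear_nullary[OF R.A.permutative_axioms R.unit_in]]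
      R.cons_op_mar[OF multilinear_nullary[OF R.A.permutative_axioms R.unit_in]]
    show "mob (cons_T (nullary_op A e)) xs = mob (mlin_unit A) xs" if "xs \<in> obs (msrc (mlin_unit A))" for xs
      using that ap(1) by (auto simp: prod_single R.ten_unit_ob)
    show "mar (cons_T (nullary_op A e)) xs = mar (mlin_unit A) xs" if "xs \<in> ars (msrc (mlin_unit A))" for xs
      using that ap(4) by (auto simp: prod_single R.ten_unit_ar)
    show "mdel (cons_T (nullary_op A e)) i xs x' = mdel (mlin_unit A) i xs x'"
      if "i < length (msrc (mlin_unit A))" "xs \<in> obs (msrc (mlin_unit A))" "x'
        \<in> Ob (msrc (mlin_unit A) ! i)" for i xs x'
      using that ap(2) by (auto simp: prod_single R.dl_unit)
  qed simp_all
  show "op_of ([c], c, id) = mlin_unit (on_col c)"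
    using multilinear.mlin_ext[OF multilinear_word_op] A
    by (cases c) (simp_all add: op_of_def mlin_act_id word_op_def on_col_def)
qed

definition module_fun where
  "module_fun = \<lparr>on_color = on_col, on_ob = restrict op_of (Ob (ops lM)),
     on_ar = restrict (\<lambda>x. ident mlin_cat (op_of x)) (Ob (ops lM))\<rparr>"

lemma multifunctor_module_fun: "multifunctor lM PermCat module_fun"
proof (rule multifunctor.intro)
  note [simp] = module_fun_def op_of_multilinear
  have ml: "multilinear (msrc (op_of x)) (mtgt (op_of x)) (op_of x)" if "x \<in> Ob (ops lM)" for x
    using op_of_multilinear[OF that] by simp
  show "on_color module_fun c \<in> colors PermCat" for c
    using R.A.permutative_axioms M.D.permutative_axioms by (cases c) (simp_all add: on_col_def)
  show "preserves_cat (ops lM) (ops PermCat) (on_ob module_fun) (on_ar module_fun)"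
    unfolding preserves_cat_def
    using ml multilinear.multilinear_trans_ident[OF ml] Comp_ident_mlin[OF ml]
    by (auto simp: hom_def)
  show "on_ob module_fun (unit_op lM c) = unit_op PermCat (on_color module_fun c)" for c
    using op_of_unit[of c] by simp
  show "on_ob module_fun (act_ob lM \<tau> x) = act_ob PermCat \<tau> (on_ob module_fun x)"
    if "x \<in> Ob (ops lM)" "\<tau> permutes {..<length (source lM x)}" for x \<tau>
    using that op_of_act[of x \<tau>] by simp
  show "on_ar module_fun (act_ar lM \<tau> x) = act_ar PermCat \<tau> (on_ar module_fun x)"
    if "x \<in> Ar (ops lM)" "\<tau> permutes {..<length (source lM (Dom (ops lM) x))}" for x \<tau>
    using that op_of_act[of x \<tau>] mtrans_act_ident[of \<tau> "op_of x"] by simp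
  show "on_ob module_fun (Gam_ob lM g fs) = Gam_ob PermCat (on_ob module_fun g) (map (on_ob module_fun) fs)"
    if "g \<in> Ob (ops lM)" "set fs \<subseteq> Ob (ops lM)" "map (target lM) fs = source lM g" for g fs
  proof -
    have "map (on_ob module_fun) fs = map op_of fs" using that(2) by auto
    then show ?thesis using op_of_Gam[of g fs] that by (simp del: map_eq_conv)
  qed
  show "on_ar module_fun (Gam_ar lM g fs) = Gam_ar PermCat (on_ar module_fun g) (map (on_ar module_fun) fs)"
    if "g \<in> Ar (ops lM)" "set fs \<subseteq> Ar (ops lM)"
      "map (\<lambda>\<phi>. target lM (Dom (ops lM) \<phi>)) fs = source lM (Dom (ops lM) g)" for g fs
  proof -
    have t: "map (fst \<circ> snd) fs = fst g" using that(3) by (simp add: comp_def)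
    have "map (on_ar module_fun) fs = map (ident mlin_cat) (map op_of fs)" using that(2) by auto
    moreover have "mtrans_Gam (ident mlin_cat (op_of g)) (map (ident mlin_cat) (map op_of fs))
        = ident mlin_cat (mlin_Gam (op_of g) (map op_of fs))"
    proof (rule mtrans_Gam_ident)
      show "multilinear (msrc (op_of g)) (mtgt (op_of g)) (op_of g)" using ml that by simp
      show "length (map op_of fs) = length (msrc (op_of g))"
        using that arg_cong[OF t, of length] by simp
      fix p assume "p < length (map op_of fs)"
      then have p: "p < length fs" and f: "fs ! p \<in> Ob (ops lM)" using that by auto
      have "fst g ! p = fst (snd (fs ! p))" "p < length (fst g)" using p t[symmetric] by simp_all
      then show "multilinear (msrc (map op_of fs ! p)) (msrc (op_of g) ! p) (map op_of fs ! p)"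
        using ml[OF f] p f that by simp
    qed
    ultimately show ?thesis using op_of_Gam[of g fs] that t by (simp del: map_eq_conv map_map)
  qed
qed (auto simp: module_fun_def op_of_multilinear)

lemma module_fun_incl: "mfun_comp Sigma_operad module_fun lM_incl = structure_map A T e"
proof -
  have eq: "(map (\<lambda>_. ColA) us, ColA, \<sigma>) \<in> Ob (ops lM) \<and> op_of (map (\<lambda>_. ColA) us, ColA, \<sigma>)
    = structure_op A T e (length us) \<sigma>"
    if \<sigma>: "\<sigma> permutes {..<length us}" for us :: "unit list" and \<sigma>
  proof -
    have w: "map (\<lambda>_. ColA) us = permute_list \<sigma> (word ColA (length us))"
      using R.permute_replicate[OF \<sigma>, of ColA] by (simp add: word_def map_replicate_const)
    show ?thesis
      unfolding w using lM_opI[of \<sigma> ColA "length us"] op_of_word[of \<sigma> ColA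
        "length us"] R.structure_op_eq[OF \<sigma>] \<sigma>
      by (simp add: word_def word_op_def)
  qed
  have "on_ob (mfun_comp Sigma_operad module_fun lM_incl) x = on_ob (structure_map A T e) x
      \<and> on_ar (mfun_comp Sigma_operad module_fun lM_incl) x = on_ar (structure_map A T e) x" for x
  proof (cases "x \<in> Ob (ops Sigma_operad)")
    case True
    then obtain us \<sigma> where "x = (us, (), \<sigma>)" "\<sigma> permutes {..<length us}" by auto
    then show ?thesis
      using eq[of \<sigma> us] by (simp add: mfun_comp_def structure_map_def module_fun_def lM_incl_def
        Let_def compose_def)
  next
    case False
    then show ?thesis by (simp add: mfun_comp_def structure_map_def compose_def del: Sigma_simps(3))
  qed
  moreover have "on_color (mfun_comp Sigma_operad module_fun lM_incl) = on_color (structure_map A T e)"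
    by (simp add: mfun_comp_def structure_map_def module_fun_def lM_incl_def Let_def compose_def on_col_def
        fun_eq_iff)
  ultimately show ?thesis by (simp add: fun_eq_iff mfun.equality)
qed

end

section \<open>The left module of a multifunctor\<close>

lemma pairing_of_simps [simp]:
  "ten_ob (pairing_of m) a d = mob m [a, d]" "ten_ar (pairing_of m) f h = mar m [f, h]"
  "dl (pairing_of m) a a' d = mdel m 0 [a, d] a'" "dr (pairing_of m) a d d' = mdel m (Suc 0) [a, d] d'"
  by (simp_all add: pairing_of_def)

lemma cperm_Gam_id:
  assumes "\<And>f. f \<in> set fs \<Longrightarrow> snd (snd f) = id"
  shows "cperm_Gam (bs, b, id) fs = (concat (map fst fs), b, id)"
  using Gamma_perm_id[of "map (snd \<circ> snd) fs" "map (length \<circ> fst) fs"] assms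
  by (simp add: cperm_Gam_def Let_def)

lemma mlin_Gam_bilinear:
  assumes "multilinear [A, D] D m" "multilinear Cs A f" "multilinear Ds D h"
  shows "mlin_Gam m [f, h] = tens_op (pairing_of m) f h"
proof -
  interpret m: multilinear "[A, D]" D m by fact
  interpret f: multilinear Cs A f by fact
  interpret h: multilinear Ds D h by fact
  note [simp] = f.msrc_eq f.mtgt_eq f.mob_in f.mar_in f.mdel_simps h.msrc_eq h.mtgt_eq h.mob_in h.mar_in
    h.mdel_simps m.msrc_eq m.mtgt_eq prod_append tuple_update
  let ?lhs = "mlin_Gam m [f, h]" and ?rhs = "tens_op (pairing_of m) f h"
  show ?thesis
  proof (rule mlin_eqI)
    show "mob ?lhs xs = mob ?rhs xs"
      if "xs \<in> obs (msrc ?rhs)" for xs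
    proof -
      from that obtain us vs where [simp]: "xs = us @ vs" "us \<in> obs Cs" "vs \<in> obs Ds"
        by (auto dest!: prod_appendE(1))
      have [simp]: "length us = length Cs" "length vs = length Ds"
        using length_tuple(1)[of _ Cs] length_tuple(1)[of _ Ds] by simp_all
      show ?thesis
        using tens_op_apply(1)[of us f vs h "pairing_of m"] mlin_Gam_apply(1)[of xs "[f, h]" m] by simp
    qed
    show "mar ?lhs xs = mar ?rhs xs"
      if "xs \<in> ars (msrc ?rhs)" for xs
    proof -
      from that obtain us vs where [simp]: "xs = us @ vs" "us \<in> ars Cs" "vs \<in> ars Ds"
        by (auto dest!: prod_appendE(2))
      have [simp]: "length us = length Cs" "length vs = length Ds"
        using length_tuple(2)[of _ Cs] length_tuple(2)[of _ Ds] by simp_all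
      show ?thesis
        using tens_op_apply(2)[of us f vs h "pairing_of m"] mlin_Gam_apply(2)[of xs "[f, h]" m] by simp
    qed
    show "mdel ?lhs n xs x' = mdel ?rhs n xs x'"
      if n: "n < length (msrc ?rhs)"
        and xs: "xs \<in> obs (msrc ?rhs)"
        and x': "x' \<in> Ob (msrc ?rhs ! n)" for n xs x'
    proof -
      from xs obtain us vs where [simp]: "xs = us @ vs" "us \<in> obs Cs" "vs \<in> obs Ds"
        by (auto dest!: prod_appendE(1))
      have [simp]: "length us = length Cs" "length vs = length Ds"
        using length_tuple(1)[of _ Cs] length_tuple(1)[of _ Ds] by simp_all
      show ?thesis
      proof (cases "n < length Cs")
        case True
        then show ?thesis
          using mlin_Gam_mdel[of 0 "[f, h]" n xs x' "[us, vs]" n m] x'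
          tens_op_apply(3)[of us f vs h n x' "pairing_of m"] by (simp add: nth_append)
      next
        case False
        then obtain i where "n = length Cs + i" "i < length Ds" using n
          by (metis add_less_cancel_left f.msrc_eq h.msrc_eq le_Suc_ex length_append
          linorder_not_less tens_op_simps(1))
        then show ?thesis
          using mlin_Gam_mdel[of 1 "[f, h]" i xs x' "[us, vs]" n m] x'
          tens_op_apply(4)[of us f vs h i x' "pairing_of m"] by (simp add: nth_append)
      qed
    qed
  qed simp_all
qed

lemma (in associative_category) word_T_2:
  assumes "a \<in> Ob A" "b \<in> Ob A"
  shows "mob (word_T 2) [a, b] = a \<otimes>\<^bsub>T\<^esub> b"
    and "a' \<in> Ob A \<Longrightarrow> mdel (word_T 2) 0 [a, b] a' = dl T a a' b"
    and "b' \<in> Ob A \<Longrightarrow> mdel (word_T 2) (Suc 0) [a, b] b' = dr T a b b'"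
  using assms word_T_mob[of "[a, b]"] word_T_mdel[of "[a, b]" a' 0] word_T_mdel[of "[a, b]" b' 1]
  by (simp_all add: ten_list_def ten_unit_ob unit_ten_ob dr_unit dl_unit ten_unit_ar numeral_2_eq_2)

lemma (in associative_category) word_T_2_mar:
  "\<lbrakk>f \<in> Ar A; g \<in> Ar A\<rbrakk> \<Longrightarrow> mar (word_T 2) [f, g] = f \<boxtimes>\<^bsub>T\<^esub> g"
  using word_T_mar[of "[f, g]"] by (simp add: ten_list_ar_def ten_unit_ar numeral_2_eq_2)

locale extends_structure_map = associative_category A T e + multifunctor lM PermCat F
  for A :: "('o, 'm) pcat" and D :: "('o, 'm) pcat" (structure)
    and T :: "('o, 'm) pairing" and e :: 'o
    and F :: "(lcolor, lcolor cperm, lcolor cperm, ('o, 'm) pcat, ('o, 'm) mlin, ('o, 'm) mtrans) mfun" +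
  assumes color_A: "on_color F ColA = A" and color_M: "on_color F ColM = D"
    and restriction: "mfun_comp Sigma_operad F lM_incl = structure_map A T e"
begin

definition pair_op where "pair_op = on_ob F ([ColA, ColM], ColM, id)"

lemma op_A:
  assumes "\<sigma> permutes {..<k}"
  shows "on_ob F (replicate k ColA, ColA, \<sigma>) = structure_op A T e k \<sigma>"
proof -
  have "on_ob (mfun_comp Sigma_operad F lM_incl) (replicate k (), (), \<sigma>) = structure_op A T e k \<sigma>"
    using assms by (simp add: restriction structure_map_def)
  then show ?thesis
    using assms by (simp add: mfun_comp_def lM_incl_def Let_def compose_def)
qed

lemma op_A_id: "on_ob F (replicate k ColA, ColA, id) = word_T k"
  using op_A[OF permutes_id] structure_op_eq[OF permutes_id] multilinear.mlin_ext[OF multilinear_word_T]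
  by (simp add: mlin_act_id)

lemma A_in: "(replicate k ColA, ColA, id) \<in> Ob (ops lM)"
  using lM_opI[of id ColA k] by (simp add: word_def permutes_id)

lemma M_in: "(replicate k ColA @ [ColM], ColM, id) \<in> Ob (ops lM)"
  using lM_opI[of id ColM k] by (simp add: word_def permutes_id)

lemma pair_in: "([ColA, ColM], ColM, id) \<in> Ob (ops lM)"
  using M_in[of 1] by simp

lemma multilinear_pair_op: "multilinear [A, D] D pair_op"
proof -
  have "pair_op \<in> Ob mlin_cat" using pair_in functorial by (simp add: preserves_cat_def pair_op_def)
  moreover have "msrc pair_op = [A, D]" "mtgt pair_op = D"
    using pres_source[OF pair_in] pres_target[OF pair_in] color_A color_M by (simp_all add: pair_op_def)
  ultimately show ?thesis by simp
qed

lemma D_perm: "permutative D"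
  using color_in[of ColM] color_M by simp

lemma op_unit: "on_ob F ([ColA], ColA, id) = mlin_unit A" "on_ob F ([ColM], ColM, id) = mlin_unit D"
  using pres_unit[of ColA] pres_unit[of ColM] color_A color_M by simp_all

lemma Gam_pair_op:
  assumes "f \<in> Ob (ops lM)" "h \<in> Ob (ops lM)" "f = (cs, ColA, id)" "h = (ds, ColM, id)"
  shows "on_ob F (cs @ ds, ColM, id) = mlin_Gam pair_op [on_ob F f, on_ob F h]"
proof -
  have "cperm_Gam ([ColA, ColM], ColM, id) [f, h] = (cs @ ds, ColM, id)"
    by (subst cperm_Gam_id) (use assms in auto)
  then show ?thesis using pres_Gam_ob[OF pair_in, of "[f, h]"] assms by (simp add: pair_op_def)
qed

lemma op_M_id: "on_ob F (replicate k ColA @ [ColM], ColM, id) = mlin_Gam pair_op [word_T k, mlin_unit D]"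
  using Gam_pair_op[OF A_in[of k] M_in[of 0] refl, of "[ColM]"] op_A_id op_unit by simp

lemma op_M:
  assumes "\<sigma> permutes {..<length (word ColM n)}"
  shows "on_ob F (permute_list \<sigma> (word ColM n), ColM, \<sigma>)
    = mlin_act \<sigma> (mlin_Gam pair_op [word_T n, mlin_unit D])"
  using pres_act_ob[OF M_in[of n], of \<sigma>] assms op_M_id[of n]
  by (simp add: cperm_act_def word_def)

lemma on_ar_eq: "x \<in> Ob (ops lM) \<Longrightarrow> on_ar F x = ident mlin_cat (on_ob F x)"
  using functorial by (auto simp: preserves_cat_def)

text \<open>
  Both sides are the image of the operation $A\,A\,M \to M$ with the identity permutation, which is a
  multiproduct of the pairing with the multiplication of $A$ and also of the pairing with itself.
\<close>

lemma tens_assoc: "tens_op (pairing_of pair_op) (word_T 2) (mlin_unit D)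
  = tens_op (pairing_of pair_op) (mlin_unit A) pair_op"
proof -
  have "on_ob F ([ColA, ColA, ColM], ColM, id) = mlin_Gam pair_op [word_T 2, mlin_unit D]"
    using op_M_id[of 2] by (simp add: numeral_2_eq_2)
  moreover have "on_ob F ([ColA, ColA, ColM], ColM, id) = mlin_Gam pair_op [mlin_unit A, pair_op]"
    using Gam_pair_op[OF A_in[of 1] pair_in refl refl] op_unit by (simp add: pair_op_def)
  ultimately show ?thesis
    using mlin_Gam_bilinear[OF multilinear_pair_op multilinear_word_T multilinear_unit[OF D_perm], of 2]
      mlin_Gam_bilinear[OF multilinear_pair_op multilinear_unit[OF A.permutative_axioms]
        multilinear_pair_op]
    by simp
qed

lemma tens_unit: "tens_op (pairing_of pair_op) (nullary_op A e) (mlin_unit D) = mlin_unit D"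
  using op_M_id[of 0] op_unit mlin_Gam_bilinear[OF multilinear_pair_op multilinear_word_T
    multilinear_unit[OF D_perm], of 0]
  by simp

text \<open>
  The conditions that mention the multiplication or the unit of $A$ are read off from \<open>tens_assoc\<close>
  and \<open>tens_unit\<close> by evaluating them and their distributivity maps. All others are instances of the
  axioms for the bilinear map \<open>pair_op\<close>.
\<close>

lemma left_module_pair_op: "left_module A T e D (pairing_of pair_op)"
proof -
  interpret m: multilinear "[A, D]" D pair_op by (rule multilinear_pair_op)
  interpret D: permutative D by (rule D_perm)
  note [simp] = m.msrc_eq m.mtgt_eq ten_unit_ob
  have m_ob: "a \<in> Ob A \<Longrightarrow> d \<in> Ob D \<Longrightarrow> mob pair_op [a, d] \<in> Ob D" for a d using m.mob_in[of "[a, d]"] by simp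
  have m_id: "a \<in> Ob A \<Longrightarrow> d \<in> Ob D \<Longrightarrow> mar pair_op [ident A a, ident D d]
    = ident D (mob pair_op [a, d])" for a d
    using m.mar_ident[of "[a, d]"] by simp
  have m_dl: "mdel pair_op 0 [a, d] a' \<in> Ar D" "Dom D (mdel pair_op 0 [a, d] a')
    = mob pair_op [a, d] \<oplus> mob pair_op [a', d]"
    "Cod D (mdel pair_op 0 [a, d] a') = mob pair_op [a \<oplus>\<^bsub>A\<^esub> a', d]"
    if "a \<in> Ob A" "a' \<in> Ob A" "d \<in> Ob D" for a a' d
    using m.mdel_simps[of "[a, d]" 0 a'] that by simp_all
  have m_dr: "mdel pair_op (Suc 0) [a, d] d' \<in> Ar D" "Dom D (mdel pair_op (Suc 0) [a, d] d')
    = mob pair_op [a, d] \<oplus> mob pair_op [a, d']"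
    "Cod D (mdel pair_op (Suc 0) [a, d] d') = mob pair_op [a, d \<oplus> d']"
    if "a \<in> Ob A" "d \<in> Ob D" "d' \<in> Ob D" for a d d'
    using m.mdel_simps[of "[a, d]" 1 d'] that by simp_all
  note [simp] = m_ob m_id m_dl m_dr
  have w2: "msrc (word_T 2) = [A, A]" "mtgt (word_T 2) = A"
    using multilinear.msrc_eq[OF multilinear_word_T[of 2]] multilinear.mtgt_eq[OF multilinear_word_T[of 2]]
    by (simp_all add: numeral_2_eq_2)
  let ?S = "pairing_of pair_op"
  have m_ar: "mar pair_op [f, h] \<in> Ar D" "Dom D (mar pair_op [f, h]) = mob pair_op [Dom A f, Dom D h]"
    "Cod D (mar pair_op [f, h]) = mob pair_op [Cod A f, Cod D h]"
    if "f \<in> Ar A" "h \<in> Ar D" for f h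
    using m.mar_in[of "[f, h]"] m.mar_Dom[of "[f, h]"] m.mar_Cod[of "[f, h]"] that by simp_all
  note [simp] = m_ar
  have unit_ob: "e \<otimes>\<^bsub>?S\<^esub> d = d" if "d \<in> Ob D" for d
    using arg_cong[OF tens_unit, of "\<lambda>f. mob f [d]"] that
      tens_op_apply(1)[of "[]" "nullary_op A e" "[d]" "mlin_unit D" ?S] by simp
  have unit_ar: "ident A e \<boxtimes>\<^bsub>?S\<^esub> h = h" if "h \<in> Ar D" for h
    using arg_cong[OF tens_unit, of "\<lambda>f. mar f [h]"] that
      tens_op_apply(2)[of "[]" "nullary_op A e" "[h]" "mlin_unit D" ?S] by simp
  show ?thesis
  proof (intro left_module.intro tensor_action.intro tensor_action_axioms.intro left_module_axioms.intro
      A.permutative_axioms D_perm)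
    show "bifunctor A D D (ten_ob ?S) (ten_ar ?S)"
      using m.mar_Comp[of "[_, _]" "[_, _]"] by (simp add: bifunctor_def hom_def)
    show "e \<in> Ob A" by simp
    show "(a \<otimes>\<^bsub>T\<^esub> b) \<otimes>\<^bsub>?S\<^esub> d = a \<otimes>\<^bsub>?S\<^esub> (b \<otimes>\<^bsub>?S\<^esub> d)"
      if "a \<in> Ob A" "b \<in> Ob A" "d \<in> Ob D" for a b d
      using arg_cong[OF tens_assoc, of "\<lambda>f. mob f [a, b, d]"] that w2
        tens_op_apply(1)[of "[a, b]" "word_T 2" "[d]" "mlin_unit D" ?S]
        tens_op_apply(1)[of "[a]" "mlin_unit A" "[b, d]" pair_op ?S]
      by (simp add: word_T_2)
    show "(f \<boxtimes>\<^bsub>T\<^esub> g) \<boxtimes>\<^bsub>?S\<^esub> h = f \<boxtimes>\<^bsub>?S\<^esub> (g \<boxtimes>\<^bsub>?S\<^esub> h)"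
      if "f \<in> Ar A" "g \<in> Ar A" "h \<in> Ar D" for f g h
      using arg_cong[OF tens_assoc, of "\<lambda>k. mar k [f, g, h]"] that w2
        tens_op_apply(2)[of "[f, g]" "word_T 2" "[h]" "mlin_unit D" ?S]
        tens_op_apply(2)[of "[f]" "mlin_unit A" "[g, h]" pair_op ?S]
      by (simp add: word_T_2_mar)
    show "e \<otimes>\<^bsub>?S\<^esub> d = d" if "d \<in> Ob D" for d by (rule unit_ob[OF that])
    show "ident A e \<boxtimes>\<^bsub>?S\<^esub> h = h" if "h \<in> Ar D" for h by (rule unit_ar[OF that])
    show "dl ?S a a' d \<in> hom D ((a \<otimes>\<^bsub>?S\<^esub> d) \<oplus> (a' \<otimes>\<^bsub>?S\<^esub> d)) ((a \<oplus>\<^bsub>A\<^esub> a') \<otimes>\<^bsub>?S\<^esub> d)"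
      if "a \<in> Ob A" "a' \<in> Ob A" "d \<in> Ob D" for a a' d
      using m_dl that by (simp add: hom_def)
    show "((f \<boxplus>\<^bsub>A\<^esub> f') \<boxtimes>\<^bsub>?S\<^esub> h) \<cdot> dl ?S (Dom A f) (Dom A f') (Dom D h)
        = dl ?S (Cod A f) (Cod A f') (Cod D h) \<cdot> ((f \<boxtimes>\<^bsub>?S\<^esub> h) \<boxplus> (f' \<boxtimes>\<^bsub>?S\<^esub> h))"
      if "f \<in> Ar A" "f' \<in> Ar A" "h \<in> Ar D" for f f' h
      using m.mdel_natural[of "[f, h]" 0 f'] that by simp
    show "dr ?S a d d' \<in> hom D ((a \<otimes>\<^bsub>?S\<^esub> d) \<oplus> (a \<otimes>\<^bsub>?S\<^esub> d')) (a \<otimes>\<^bsub>?S\<^esub> (d \<oplus> d'))"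
      if "a \<in> Ob A" "d \<in> Ob D" "d' \<in> Ob D" for a d d'
      using m_dr that by (simp add: hom_def)
    show "(f \<boxtimes>\<^bsub>?S\<^esub> (h \<boxplus> h')) \<cdot> dr ?S (Dom A f) (Dom D h) (Dom D h')
        = dr ?S (Cod A f) (Cod D h) (Cod D h') \<cdot> ((f \<boxtimes>\<^bsub>?S\<^esub> h) \<boxplus> (f \<boxtimes>\<^bsub>?S\<^esub> h'))"
      if "f \<in> Ar A" "h \<in> Ar D" "h' \<in> Ar D" for f h h'
      using m.mdel_natural[of "[f, h]" 1 h'] that by simp
    show "a \<otimes>\<^bsub>?S\<^esub> \<zero> = \<zero>" if "a \<in> Ob A" for a
      using m.mob_null[of "[a, \<zero>]" 1] that by simp
    show "f \<boxtimes>\<^bsub>?S\<^esub> ident D \<zero> = ident D \<zero>" if "f \<in> Ar A" for f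
      using m.mar_null[of "[f, ident D \<zero>]" 1] that by simp
    show "\<zero>\<^bsub>A\<^esub> \<otimes>\<^bsub>?S\<^esub> d = \<zero>" if "d \<in> Ob D" for d
      using m.mob_null[of "[\<zero>\<^bsub>A\<^esub>, d]" 0] that by simp
    show "ident A \<zero>\<^bsub>A\<^esub> \<boxtimes>\<^bsub>?S\<^esub> h = ident D \<zero>" if "h \<in> Ar D" for h
      using m.mar_null[of "[ident A \<zero>\<^bsub>A\<^esub>, h]" 0] that by simp
    show "dl ?S a a' d = ident D ((a \<oplus>\<^bsub>A\<^esub> a') \<otimes>\<^bsub>?S\<^esub> d)"
      if "a \<in> Ob A" "a' \<in> Ob A" "d \<in> Ob D" "a = \<zero>\<^bsub>A\<^esub> \<or> a' = \<zero>\<^bsub>A\<^esub> \<or> d = \<zero>" for a a' d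
    proof -
      have "a' = \<zero>\<^bsub>A\<^esub> \<or> (\<exists>j<2. [a, d] ! j = \<zero>\<^bsub>[A, D] ! j\<^esub>)"
        using that(4) by (auto simp: numeral_2_eq_2 less_Suc_eq)
      then show ?thesis using m.mdel_null[of "[a, d]" 0 a'] that(1-3) by (simp add: numeral_2_eq_2)
    qed
    show "dr ?S a d d' = ident D (a \<otimes>\<^bsub>?S\<^esub> (d \<oplus> d'))"
      if "a \<in> Ob A" "d \<in> Ob D" "d' \<in> Ob D" "a = \<zero>\<^bsub>A\<^esub> \<or> d = \<zero> \<or> d' = \<zero>" for a d d'
    proof -
      have "d' = \<zero> \<or> (\<exists>j<2. [a, d] ! j = \<zero>\<^bsub>[A, D] ! j\<^esub>)"
        using that(4) by (auto simp: numeral_2_eq_2 less_Suc_eq)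
      then show ?thesis using m.mdel_null[of "[a, d]" 1 d'] that(1-3) by (simp add: numeral_2_eq_2)
    qed
    show "dr ?S e d d' = ident D (d \<oplus> d')" if "d \<in> Ob D" "d' \<in> Ob D" for d d'
      using arg_cong[OF tens_unit, of "\<lambda>f. mdel f 0 [d] d'"] that unit_ob unit_ar m_dr[of e d d']
        tens_op_apply(4)[of "[]" "nullary_op A e" "[d]" "mlin_unit D" 0 d' ?S] by simp
    show "dl ?S (a \<oplus>\<^bsub>A\<^esub> a') a'' d \<cdot> (dl ?S a a' d \<boxplus> ident D (a'' \<otimes>\<^bsub>?S\<^esub> d))
        = dl ?S a (a' \<oplus>\<^bsub>A\<^esub> a'') d \<cdot> (ident D (a \<otimes>\<^bsub>?S\<^esub> d) \<boxplus> dl ?S a' a'' d)"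
      if "a \<in> Ob A" "a' \<in> Ob A" "a'' \<in> Ob A" "d \<in> Ob D" for a a' a'' d
      using m.mdel_assoc[of "[a, d]" 0 a' a''] that by simp
    show "dr ?S a (d \<oplus> d') d'' \<cdot> (dr ?S a d d' \<boxplus> ident D (a \<otimes>\<^bsub>?S\<^esub> d''))
        = dr ?S a d (d' \<oplus> d'') \<cdot> (ident D (a \<otimes>\<^bsub>?S\<^esub> d) \<boxplus> dr ?S a d' d'')"
      if "a \<in> Ob A" "d \<in> Ob D" "d' \<in> Ob D" "d'' \<in> Ob D" for a d d' d''
      using m.mdel_assoc[of "[a, d]" 1 d' d''] that by simp
    show "(\<gamma>\<^bsub>A\<^esub> a a' \<boxtimes>\<^bsub>?S\<^esub> ident D d) \<cdot> dl ?S a a' d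
        = dl ?S a' a d \<cdot> \<gamma> (a \<otimes>\<^bsub>?S\<^esub> d) (a' \<otimes>\<^bsub>?S\<^esub> d)"
      if "a \<in> Ob A" "a' \<in> Ob A" "d \<in> Ob D" for a a' d
      using m.mdel_gam[of "[a, d]" 0 a'] that by simp
    show "(ident A a \<boxtimes>\<^bsub>?S\<^esub> \<gamma> d d') \<cdot> dr ?S a d d'
        = dr ?S a d' d \<cdot> \<gamma> (a \<otimes>\<^bsub>?S\<^esub> d) (a \<otimes>\<^bsub>?S\<^esub> d')"
      if "a \<in> Ob A" "d \<in> Ob D" "d' \<in> Ob D" for a d d'
      using m.mdel_gam[of "[a, d]" 1 d'] that by simp
    show "dl ?S a a' (b \<otimes>\<^bsub>?S\<^esub> d)
        = (dl T a a' b \<boxtimes>\<^bsub>?S\<^esub> ident D d) \<cdot> dl ?S (a \<otimes>\<^bsub>T\<^esub> b) (a' \<otimes>\<^bsub>T\<^esub> b) d"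
      if "a \<in> Ob A" "a' \<in> Ob A" "b \<in> Ob A" "d \<in> Ob D" for a a' b d
      \<comment> \<open>This and the next two conditions compare the distributivity maps of the two sides of
        \<open>tens_assoc\<close> in the first, the last and the middle variable.\<close>
      using arg_cong[OF tens_assoc, of "\<lambda>f. mdel f 0 [a, b, d] a'"] that w2
        tens_op_apply(3)[of "[a, b]" "word_T 2" "[d]" "mlin_unit D" 0 a' ?S]
        tens_op_apply(3)[of "[a]" "mlin_unit A" "[b, d]" pair_op 0 a' ?S]
      by (simp add: word_T_2)
    show "dr ?S (a \<otimes>\<^bsub>T\<^esub> b) d d'
        = (ident A a \<boxtimes>\<^bsub>?S\<^esub> dr ?S b d d') \<cdot> dr ?S a (b \<otimes>\<^bsub>?S\<^esub> d) (b \<otimes>\<^bsub>?S\<^esub> d')"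
      if "a \<in> Ob A" "b \<in> Ob A" "d \<in> Ob D" "d' \<in> Ob D" for a b d d'
      using arg_cong[OF tens_assoc, of "\<lambda>f. mdel f (Suc (Suc 0)) [a, b, d] d'"] that w2
        tens_op_apply(4)[of "[a, b]" "word_T 2" "[d]" "mlin_unit D" 0 d' ?S]
        tens_op_apply(4)[of "[a]" "mlin_unit A" "[b, d]" pair_op 1 d' ?S]
      by (simp add: word_T_2)
    show "(dr T a b b' \<boxtimes>\<^bsub>?S\<^esub> ident D d) \<cdot> dl ?S (a \<otimes>\<^bsub>T\<^esub> b) (a \<otimes>\<^bsub>T\<^esub> b') d
        = (ident A a \<boxtimes>\<^bsub>?S\<^esub> dl ?S b b' d) \<cdot> dr ?S a (b \<otimes>\<^bsub>?S\<^esub> d) (b' \<otimes>\<^bsub>?S\<^esub> d)"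
      if "a \<in> Ob A" "b \<in> Ob A" "b' \<in> Ob A" "d \<in> Ob D" for a b b' d
      using arg_cong[OF tens_assoc, of "\<lambda>f. mdel f 1 [a, b, d] b'"] that w2
        tens_op_apply(3)[of "[a, b]" "word_T 2" "[d]" "mlin_unit D" 1 b' ?S]
        tens_op_apply(4)[of "[a]" "mlin_unit A" "[b, d]" pair_op 0 b' ?S]
      by (simp add: word_T_2)
    show "dl ?S a a' (d \<oplus> d') \<cdot> (dr ?S a d d' \<boxplus> dr ?S a' d d')
        = dr ?S (a \<oplus>\<^bsub>A\<^esub> a') d d' \<cdot> (dl ?S a a' d \<boxplus> dl ?S a a' d')
          \<cdot> (ident D (a \<otimes>\<^bsub>?S\<^esub> d) \<boxplus> \<gamma> (a \<otimes>\<^bsub>?S\<^esub> d') (a' \<otimes>\<^bsub>?S\<^esub> d)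
          \<boxplus> ident D (a' \<otimes>\<^bsub>?S\<^esub> d'))"
      if "a \<in> Ob A" "a' \<in> Ob A" "d \<in> Ob D" "d' \<in> Ob D" for a a' d d'
      \<comment> \<open>The exchange axiom with the second variable as the inner one; the other order would give
        the inverse symmetry.\<close>
      using m.mdel_mdel[of "[a, d]" 1 0 d' a'] that by simp
    show "a \<otimes>\<^bsub>?S\<^esub> d = undefined" if "\<not> (a \<in> Ob A \<and> d \<in> Ob D)" for a d
      using m.mob_ext that by (auto simp: extensional_def)
    show "f \<boxtimes>\<^bsub>?S\<^esub> h = undefined" if "\<not> (f \<in> Ar A \<and> h \<in> Ar D)" for f h
      using m.mar_ext that by (auto simp: extensional_def)
    show "dl ?S a a' d = undefined" if "\<not> (a \<in> Ob A \<and> a' \<in> Ob A \<and> d \<in> Ob D)" for a a' d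
      using m.mdel_ext[of 0 "[a, d]" a'] that by auto
    show "dr ?S a d d' = undefined" if "\<not> (a \<in> Ob A \<and> d \<in> Ob D \<and> d' \<in> Ob D)" for a d d'
      using m.mdel_ext[of 1 "[a, d]" d'] that by auto
  qed
qed

end

lemma pairing_of_inject:
  assumes f: "multilinear [A, D] E f" and g: "multilinear [A, D] E g" and eq: "pairing_of f = pairing_of g"
  shows "f = g"
proof (rule mlin_eqI)
  interpret f: multilinear "[A, D]" E f by fact
  interpret g: multilinear "[A, D]" E g by fact
  note [simp] = f.msrc_eq g.msrc_eq f.mtgt_eq g.mtgt_eq
  show "mlin_ext f" "mlin_ext g" by (rule f.mlin_ext g.mlin_ext)+
  show "msrc f = msrc g" "mtgt f = mtgt g" by simp_all
  have ob: "mob f [a, d] = mob g [a, d]" for a d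
    using arg_cong[OF eq, of "\<lambda>S. ten_ob S a d"] by simp
  have ar: "mar f [a, d] = mar g [a, d]" for a d
    using arg_cong[OF eq, of "\<lambda>S. ten_ar S a d"] by simp
  have dl: "mdel f 0 [a, d] a' = mdel g 0 [a, d] a'" for a d a'
    using arg_cong[OF eq, of "\<lambda>S. dl S a a' d"] by simp
  have dr: "mdel f (Suc 0) [a, d] d' = mdel g (Suc 0) [a, d] d'" for a d d'
    using arg_cong[OF eq, of "\<lambda>S. dr S a d d'"] by simp
  show "mob f xs = mob g xs" if "xs \<in> obs (msrc g)" for xs
    using that ob by (auto simp: Ob_prod_Cons)
  show "mar f fs = mar g fs" if "fs \<in> ars (msrc g)" for fs
    using that ar by (auto simp: Ar_prod_Cons)
  show "mdel f i xs x' = mdel g i xs x'" if "i < length (msrc g)" "xs \<in> obs (msrc g)" for i xs x'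
    using that dl dr by (auto simp: Ob_prod_Cons less_Suc_eq)
qed

text \<open>
  Operations with target $A$ are in the image of the operad of symmetric groups. By \<open>op_M\<close> the values
  on the others are expressed by \<open>pair_op\<close> and the structure map. The values on arrows are identity
  transformations.
\<close>

lemma multifunctor_determined:
  assumes F: "extends_structure_map A D T e F" and G: "extends_structure_map A D T e G"
    and eq: "on_ob F ([ColA, ColM], ColM, id) = on_ob G ([ColA, ColM], ColM, id)"
  shows "F = G"
proof -
  interpret F: extends_structure_map A D T e F by fact
  interpret G: extends_structure_map A D T e G by fact
  have ob: "on_ob F x = on_ob G x" if xin: "x \<in> Ob (ops lM)" for x
  proof -
    obtain c n \<sigma> where x: "x = (permute_list \<sigma> (word c n), c, \<sigma>)" and \<sigma>: "\<sigma> permutes {..<length (word c n)}"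
      using xin by (rule lM_opE)
    show ?thesis
    proof (cases c)
      case ColA
      then have "\<sigma> permutes {..<n}" using \<sigma> by (simp add: word_def)
      then show ?thesis
        using F.op_A[of \<sigma> n] G.op_A[of \<sigma> n] F.permute_replicate[of \<sigma> n ColA] ColA x by (simp add: word_def)
    next
      case ColM
      then show ?thesis using F.op_M[of \<sigma> n] G.op_M[of \<sigma> n] \<sigma> x eq
        by (simp add: F.pair_op_def G.pair_op_def)
    qed
  qed
  have "on_color F c = on_color G c" for c
    using F.color_A F.color_M G.color_A G.color_M by (cases c) simp_all
  moreover have "on_ob F = on_ob G"
    using F.ob_ext G.ob_ext ob by (rule extensionalityI)
  moreover have "on_ar F = on_ar G"
    by (rule extensionalityI[OF F.ar_ext G.ar_ext]) (simp add: F.on_ar_eq G.on_ar_eq ob)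
  ultimately show ?thesis by (simp add: fun_eq_iff mfun.equality)
qed

text \<open>
  The word $A\,M$ is sent to $a \otimes d$ with the distributivity maps \<open>dl\<close> and \<open>dr\<close> of \<open>S\<close>. The
  extensionality conditions in the definition of a left module make the two pairings equal as
  records.
\<close>

lemma (in left_action) pairing_of_module_fun:
  assumes "left_module A T e D S"
  shows "pairing_of (on_ob module_fun ([ColA, ColM], ColM, id)) = S"
proof -
  interpret S: left_module A T e D S by fact
  have u: "multilinear [D] D (mlin_unit D)" by (rule multilinear_unit[OF M.D.permutative_axioms])
  have "([ColA, ColM], ColM, id) \<in> Ob (ops lM)"
    using lM_opI[of id ColM 1] by (simp add: word_def permutes_id)
  then have m: "on_ob module_fun ([ColA, ColM], ColM, id) = cons_S (mlin_unit D)"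
    by (simp add: module_fun_def op_of_def word_op_def mlin_act_id)
  note ap = M.cons_op_apply[OF u] M.cons_op_mar[OF u]
  have ext: "mlin_ext (cons_S (mlin_unit D))" by simp
  have "mob (cons_S (mlin_unit D)) [a, d] = a \<otimes>\<^bsub>S\<^esub> d" for a d
    using ap(1)[of a "[d]"] S.ten_ob_ext[of a d] ext
    by (cases "a \<in> Ob A \<and> d \<in> Ob D") (auto simp: mlin_ext_def extensional_def)
  moreover have "mar (cons_S (mlin_unit D)) [f, h] = f \<boxtimes>\<^bsub>S\<^esub> h" for f h
    using ap(4)[of f "[h]"] S.ten_ar_ext[of f h] ext
    by (cases "f \<in> Ar A \<and> h \<in> Ar D") (auto simp: mlin_ext_def extensional_def)
  moreover have "mdel (cons_S (mlin_unit D)) 0 [a, d] a' = dl S a a' d" for a d a'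
  proof (cases "a \<in> Ob A \<and> a' \<in> Ob A \<and> d \<in> Ob D")
    case True
    then show ?thesis using ap(2)[of a "[d]" a'] by simp
  next
    case False
    then have "mdel (cons_S (mlin_unit D)) 0 [a, d] a' = undefined"
      using ext unfolding mlin_ext_def by (metis prod_Cons_simps(1) mlin_unit_simps(1)
        tens_op_simps(1) append_Cons append_Nil nth_Cons_0)
    then show ?thesis using S.dl_ext[of a a' d] False by simp
  qed
  moreover have "mdel (cons_S (mlin_unit D)) (Suc 0) [a, d] d' = dr S a d d'" for a d d'
  proof (cases "a \<in> Ob A \<and> d \<in> Ob D \<and> d' \<in> Ob D")
    case True
    then show ?thesis using ap(3)[of a "[d]" 0 d'] by (simp add: M.ldel_def)
  next
    case False
    then have "mdel (cons_S (mlin_unit D)) (Suc 0) [a, d] d' = undefined"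
      using ext unfolding mlin_ext_def by (metis prod_Cons_simps(1) mlin_unit_simps(1)
        tens_op_simps(1) append_Cons append_Nil nth_Cons_0 nth_Cons_Suc)
    then show ?thesis using S.dr_ext[of a d d'] False by simp
  qed
  ultimately show ?thesis by (simp add: m pairing_of_def)
qed

section \<open>The correspondence\<close>

theorem theorem9p1p3:
  fixes A D :: "('o, 'm) pcat" and T :: "('o, 'm) pairing" and e :: 'o
  assumes "associative_category A T e" and "permutative D"
  shows "bij_betw (\<lambda>F. pairing_of (on_ob F ([ColA, ColM], ColM, id)))
    {F. multifunctor lM PermCat F \<and> on_color F ColA = A \<and> on_color F ColM = D \<and>
        mfun_comp Sigma_operad F lM_incl = structure_map A T e}
    {S. left_module A T e D S}"
proof -
  have ext: "{F. multifunctor lM PermCat F \<and> on_color F ColA = A \<and> on_color F ColM = D \<and>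
        mfun_comp Sigma_operad F lM_incl = structure_map A T e} = {F. extends_structure_map A D T e F}"
    using assms(1) by (auto simp: extends_structure_map_def extends_structure_map_axioms_def)
  show ?thesis
    unfolding ext
  proof (rule bij_betw_imageI)
    show "inj_on (\<lambda>F. pairing_of (on_ob F ([ColA, ColM], ColM, id))) {F. extends_structure_map A D T e F}"
    proof (rule inj_onI, clarify)
      fix F G assume FG: "extends_structure_map A D T e F" "extends_structure_map A D T e G"
        and eq: "pairing_of (on_ob F ([ColA, ColM], ColM, id))
          = pairing_of (on_ob G ([ColA, ColM], ColM, id))"
      interpret F: extends_structure_map A D T e F by fact
      interpret G: extends_structure_map A D T e G by fact
      have "F.pair_op = G.pair_op"
        by (rule pairing_of_inject[OF F.multilinear_pair_op G.multilinear_pair_op]) (simp add: eq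
          F.pair_op_def G.pair_op_def)
      then show "F = G" by (intro multifunctor_determined[OF FG]) (simp add: F.pair_op_def G.pair_op_def)
    qed
    have "pairing_of (on_ob F ([ColA, ColM], ColM, id)) \<in> {S. left_module A T e D S}"
      if "extends_structure_map A D T e F" for F
      using extends_structure_map.left_module_pair_op[OF that]
        by (simp add: extends_structure_map.pair_op_def[OF that])
    moreover have "S \<in> (\<lambda>F. pairing_of (on_ob F ([ColA, ColM], ColM, id))) ` {F.
      extends_structure_map A D T e F}"
      if "left_module A T e D S" for S
    proof -
      interpret left_action A T e D S
        using assms(1) that by (simp add: left_action_def left_tensor_def left_module_def)
      have "extends_structure_map A D T e module_fun"
        using multifunctor_module_fun module_fun_incl assms(1)
        by (simp add: extends_structure_map_def extends_structure_map_axioms_def module_fun_def on_col_def)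
      then show ?thesis using pairing_of_module_fun[OF that] by force
    qed
    ultimately show "(\<lambda>F. pairing_of (on_ob F ([ColA, ColM], ColM, id))) ` {F.
      extends_structure_map A D T e F}
        = {S. left_module A T e D S}"
      by blast
  qed
qed

end
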